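(* Let $T$ be a complete first-order NIP theory, let $M \models T$, and let $\phi(x,y)$ and $\psi(y)$ be formulas over $M$. Assume that the pair $(\phi,\psi)$ has the $(p,q)$-property for some natural numbers $p,q$ with $\mathrm{VC}^*(\phi) < q \le p$. Then there are finitely many formulas $\psi_0(y),\dots,\psi_{n-1}(y)$ over $M$ such that $\psi(y)$ is equivalent (in $M$) to the disjunction $\bigvee_{i<n}\psi_i(y)$ and, for each $i<n$, the set of formulas $\{\phi(x,b) \mid b \in \psi_i(M)\}$ is consistent.
   Context: Variables $x,y$ denote finite tuples of variables; $M^x$ denotes the set of tuples of $M$ of the sort of $x$; $\psi(M)=\{b\in M^y \mid M\models\psi(b)\}$ and $\phi(M,b)=\{a\in M^x \mid M\models \phi(a,b)\}$. "Over $M$" means with parameters from $M$. A set of formulas with parameters in $M$ is consistent if it is finitely satisfiable in $M$ (equivalently, realized in some elementary extension of $M$). VC-dimension: for a family $\mathcal{F}\subseteq \mathcal{P}(X)$, a set $A\subseteq X$ is shattered by $\mathcal{F}$ if every $S\subseteq A$ is of the form $F\cap A$ with $F\in\mathcal{F}$. $\mathrm{VC}(\mathcal{F})$ is the smallest integer $n$ such that no subset of $X$ of size $n+1$ is shattered, and $\infty$ if there is none; $\mathcal{F}$ is a VC-class if $\mathrm{VC}(\mathcal{F})<\infty$. A formula $\phi(x,y)$ is NIP if $\{\phi(M,a)\mid a\in M^y\}$ is a VC-class. The dual VC-dimension $\mathrm{VC}^*(\phi)$ is the VC-dimension of the family $\{\{b\in M^y \mid M\models\phi(a,b)\} \mid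 a\in M^x\}$ of subsets of $M^y$. $T$ is NIP if all formulas are NIP. $(p,q)$-property: for $q\le p<\omega$, the pair $(\phi(x,y),\psi(y))$ of formulas over $M$ has the $(p,q)$-property if $\mathcal{F}:=\{\phi(M,b)\mid b\in\psi(M)\}$ is a family of nonempty sets such that among any $p$ distinct elements of $\mathcal{F}$ there are some $q$ of them with nonempty intersection. *)

theory Defs
  imports Main "HOL-Library.Extended_Nat"
begin

section \<open>Many-sorted first-order logic\<close>

text \<open>Sorts are the elements of the type \<open>'s\<close>; a one-sorted language is the case where \<open>'s\<close> is
  the type \<open>unit\<close>. Constants are function symbols with an empty list of argument sorts.\<close>

record ('s, 'f, 'r) lang =
  funs :: "'f set"
  rels :: "'r set"
  fdom :: "'f \<Rightarrow> 's list"
  fcod :: "'f \<Rightarrow> 's"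
  rdom :: "'r \<Rightarrow> 's list"

type_synonym 's var = "'s \<times> nat"

datatype ('s, 'f) trm =
    Var "'s var"
  | Fun 'f "('s, 'f) trm list"

datatype ('s, 'f, 'r) fm =
    Eq "('s, 'f) trm" "('s, 'f) trm"
  | Rel 'r "('s, 'f) trm list"
  | Neg "('s, 'f, 'r) fm"
  | Conj "('s, 'f, 'r) fm" "('s, 'f, 'r) fm"
  | Exists "'s var" "('s, 'f, 'r) fm"

inductive has_sort :: "('s, 'f, 'r) lang \<Rightarrow> ('s, 'f) trm \<Rightarrow> 's \<Rightarrow> bool" for L where
  var: "has_sort L (Var v) (fst v)"
| app: "f \<in> funs L \<Longrightarrow> list_all2 (has_sort L) ts (fdom L f) \<Longrightarrow> has_sort L (Fun f ts) (fcod L f)"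

primrec wf_fm :: "('s, 'f, 'r) lang \<Rightarrow> ('s, 'f, 'r) fm \<Rightarrow> bool" where
  "wf_fm L (Eq t u) \<longleftrightarrow> (\<exists>s. has_sort L t s \<and> has_sort L u s)"
| "wf_fm L (Rel r ts) \<longleftrightarrow> r \<in> rels L \<and> list_all2 (has_sort L) ts (rdom L r)"
| "wf_fm L (Neg \<phi>) \<longleftrightarrow> wf_fm L \<phi>"
| "wf_fm L (Conj \<phi> \<chi>) \<longleftrightarrow> wf_fm L \<phi> \<and> wf_fm L \<chi>"
| "wf_fm L (Exists v \<phi>) \<longleftrightarrow> wf_fm L \<phi>"

primrec fv_trm :: "('s, 'f) trm \<Rightarrow> 's var set" where
  "fv_trm (Var v) = {v}"
| "fv_trm (Fun f ts) = \<Union> (set (map fv_trm ts))"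

primrec fv :: "('s, 'f, 'r) fm \<Rightarrow> 's var set" where
  "fv (Eq t u) = fv_trm t \<union> fv_trm u"
| "fv (Rel r ts) = \<Union> (set (map fv_trm ts))"
| "fv (Neg \<phi>) = fv \<phi>"
| "fv (Conj \<phi> \<chi>) = fv \<phi> \<union> fv \<chi>"
| "fv (Exists v \<phi>) = fv \<phi> - {v}"

text \<open>A tuple of variables is a list of distinct variables; \<open>formula_in L x \<phi>\<close> says that \<open>\<phi>\<close> is an
  \<open>L\<close>-formula \<open>\<phi>(x)\<close>, that is, its free variables are among those of \<open>x\<close>.\<close>

definition formula_in :: "('s, 'f, 'r) lang \<Rightarrow> 's var list \<Rightarrow> ('s, 'f, 'r) fm \<Rightarrow> bool" where
  "formula_in L x \<phi> \<longleftrightarrow> wf_fm L \<phi> \<and> fv \<phi> \<subseteq> set x"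

record ('s, 'f, 'r, 'a) struct =
  univ :: "'s \<Rightarrow> 'a set"
  fint :: "'f \<Rightarrow> 'a list \<Rightarrow> 'a"
  rint :: "'r \<Rightarrow> 'a list \<Rightarrow> bool"

definition tuples :: "('s, 'f, 'r, 'a) struct \<Rightarrow> 's list \<Rightarrow> 'a list set" where
  "tuples M ss = {as. list_all2 (\<lambda>a s. a \<in> univ M s) as ss}"

definition is_structure :: "('s, 'f, 'r) lang \<Rightarrow> ('s, 'f, 'r, 'a) struct \<Rightarrow> bool" where
  "is_structure L M \<longleftrightarrow> (\<forall>s. univ M s \<noteq> {}) \<and>
     (\<forall>f \<in> funs L. \<forall>as \<in> tuples M (fdom L f). fint M f as \<in> univ M (fcod L f))"

primrec eval :: "('s, 'f, 'r, 'a) struct \<Rightarrow> ('s var \<Rightarrow> 'a) \<Rightarrow> ('s, 'f) trm \<Rightarrow> 'a" where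
  "eval M e (Var v) = e v"
| "eval M e (Fun f ts) = fint M f (map (eval M e) ts)"

primrec sat :: "('s, 'f, 'r, 'a) struct \<Rightarrow> ('s var \<Rightarrow> 'a) \<Rightarrow> ('s, 'f, 'r) fm \<Rightarrow> bool" where
  "sat M e (Eq t u) \<longleftrightarrow> eval M e t = eval M e u"
| "sat M e (Rel r ts) \<longleftrightarrow> rint M r (map (eval M e) ts)"
| "sat M e (Neg \<phi>) \<longleftrightarrow> \<not> sat M e \<phi>"
| "sat M e (Conj \<phi> \<chi>) \<longleftrightarrow> sat M e \<phi> \<and> sat M e \<chi>"
| "sat M e (Exists v \<phi>) \<longleftrightarrow> (\<exists>a \<in> univ M (fst v). sat M (e(v := a)) \<phi>)"

text \<open>The valuation sending the tuple \<open>x\<close> to the tuple \<open>a\<close>; the value elsewhere is irrelevant for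
  formulas whose free variables are among \<open>x\<close>.\<close>

definition assign :: "'s var list \<Rightarrow> 'a list \<Rightarrow> 's var \<Rightarrow> 'a" where
  "assign x a v = (case map_of (zip x a) v of Some c \<Rightarrow> c | None \<Rightarrow> undefined)"

definition holds :: "('s, 'f, 'r, 'a) struct \<Rightarrow> ('s, 'f, 'r) fm \<Rightarrow> 's var list \<Rightarrow> 'a list \<Rightarrow> bool" where
  "holds M \<phi> x a \<longleftrightarrow> sat M (assign x a) \<phi>"

text \<open>\<open>var_space M x\<close> is the set $M^x$, and \<open>defset M \<psi> y\<close> is $\psi(M)$ for a formula $\psi(y)$.\<close>

definition var_space :: "('s, 'f, 'r, 'a) struct \<Rightarrow> 's var list \<Rightarrow> 'a list set" where
  "var_space M x = tuples M (map fst x)"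

definition defset :: "('s, 'f, 'r, 'a) struct \<Rightarrow> ('s, 'f, 'r) fm \<Rightarrow> 's var list \<Rightarrow> 'a list set" where
  "defset M \<psi> y = {b \<in> var_space M y. holds M \<psi> y b}"

section \<open>Theories and models\<close>

definition theory_in :: "('s, 'f, 'r) lang \<Rightarrow> ('s, 'f, 'r) fm set \<Rightarrow> bool" where
  "theory_in L T \<longleftrightarrow> (\<forall>\<sigma> \<in> T. formula_in L [] \<sigma>)"

definition models :: "('s, 'f, 'r) lang \<Rightarrow> ('s, 'f, 'r, 'a) struct \<Rightarrow> ('s, 'f, 'r) fm set \<Rightarrow> bool" where
  "models L M T \<longleftrightarrow> is_structure L M \<and> (\<forall>\<sigma> \<in> T. holds M \<sigma> [] [])"

text \<open>Logical consequence. HOL cannot quantify over models in all types at once; by downward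
  Loewenheim-Skolem it suffices to consider models whose elements are taken from a type of size at
  least the number of formulas of the language, such as the type of formulas itself.\<close>

definition entails :: "('s, 'f, 'r) lang \<Rightarrow> ('s, 'f, 'r) fm set \<Rightarrow> ('s, 'f, 'r) fm \<Rightarrow> bool" where
  "entails L T \<sigma> \<longleftrightarrow>
     (\<forall>N :: ('s, 'f, 'r, ('s, 'f, 'r) fm) struct. models L N T \<longrightarrow> holds N \<sigma> [] [])"

text \<open>Every sentence is decided. Since exactly one of \<open>\<sigma>\<close> and its negation is required to be a
  consequence, this includes consistency.\<close>

definition complete_theory :: "('s, 'f, 'r) lang \<Rightarrow> ('s, 'f, 'r) fm set \<Rightarrow> bool" where
  "complete_theory L T \<longleftrightarrow> theory_in L T \<and>
     (\<forall>\<sigma>. formula_in L [] \<sigma> \<longrightarrow> entails L T \<sigma> \<noteq> entails L T (Neg \<sigma>))"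

section \<open>Formulas over a structure\<close>

text \<open>The language \<open>L(M)\<close> has a new constant \<open>Inr (s, a)\<close> for each element \<open>a\<close> of sort \<open>s\<close>. The sort
  is recorded because the universes of distinct sorts need not be disjoint. A formula over \<open>M\<close> is a
  formula of \<open>L(M)\<close>, interpreted in the expansion of \<open>M\<close> naming every element by its constant.\<close>

definition lang_over ::
  "('s, 'f, 'r) lang \<Rightarrow> ('s, 'f, 'r, 'a) struct \<Rightarrow> ('s, 'f + 's \<times> 'a, 'r) lang" where
  "lang_over L M =
     \<lparr> funs = Inl ` funs L \<union> Inr ` {(s, a). a \<in> univ M s},
       rels = rels L,
       fdom = case_sum (fdom L) (\<lambda>_. []),
       fcod = case_sum (fcod L) fst,
       rdom = rdom L \<rparr>"

definition expansion :: "('s, 'f, 'r, 'a) struct \<Rightarrow> ('s, 'f + 's \<times> 'a, 'r, 'a) struct" where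
  "expansion M =
     \<lparr> univ = univ M,
       fint = case_sum (fint M) (\<lambda>(s, a) _. a),
       rint = rint M \<rparr>"

text \<open>Substitution. No renaming of bound variables is done; below, only closed terms are
  substituted, so that no variable is captured.\<close>

primrec subst_trm :: "('s var \<Rightarrow> ('s, 'f) trm) \<Rightarrow> ('s, 'f) trm \<Rightarrow> ('s, 'f) trm" where
  "subst_trm \<theta> (Var v) = \<theta> v"
| "subst_trm \<theta> (Fun f ts) = Fun f (map (subst_trm \<theta>) ts)"

primrec subst :: "('s var \<Rightarrow> ('s, 'f) trm) \<Rightarrow> ('s, 'f, 'r) fm \<Rightarrow> ('s, 'f, 'r) fm" where
  "subst \<theta> (Eq t u) = Eq (subst_trm \<theta> t) (subst_trm \<theta> u)"
| "subst \<theta> (Rel r ts) = Rel r (map (subst_trm \<theta>) ts)"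
| "subst \<theta> (Neg \<phi>) = Neg (subst \<theta> \<phi>)"
| "subst \<theta> (Conj \<phi> \<chi>) = Conj (subst \<theta> \<phi>) (subst \<theta> \<chi>)"
| "subst \<theta> (Exists v \<phi>) = Exists v (subst (\<theta>(v := Var v)) \<phi>)"

text \<open>\<open>instance_at \<phi> y b\<close> is the formula $\phi(x,b)$ obtained from $\phi(x,y)$ by replacing the
  variables \<open>y\<close> with the constants naming \<open>b\<close>.\<close>

definition instance_at ::
  "('s, 'f + 's \<times> 'a, 'r) fm \<Rightarrow> 's var list \<Rightarrow> 'a list \<Rightarrow> ('s, 'f + 's \<times> 'a, 'r) fm" where
  "instance_at \<phi> y b =
     subst (\<lambda>v. case map_of (zip y b) v of Some c \<Rightarrow> Fun (Inr (fst v, c)) [] | None \<Rightarrow> Var v) \<phi>"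

text \<open>Consistency of a set of formulas in the variables \<open>x\<close> over \<open>M\<close>: finite satisfiability in
  \<open>M\<close>.\<close>

definition consistent ::
  "('s, 'f, 'r, 'a) struct \<Rightarrow> 's var list \<Rightarrow> ('s, 'f + 's \<times> 'a, 'r) fm set \<Rightarrow> bool" where
  "consistent M x \<Gamma> \<longleftrightarrow>
     (\<forall>\<Delta> \<subseteq> \<Gamma>. finite \<Delta> \<longrightarrow>
        (\<exists>a \<in> var_space M x. \<forall>\<gamma> \<in> \<Delta>. holds (expansion M) \<gamma> x a))"

section \<open>VC-dimension, NIP and the (p,q)-property\<close>

definition shatters :: "'x set set \<Rightarrow> 'x set \<Rightarrow> bool" where
  "shatters F A \<longleftrightarrow> (\<forall>S \<subseteq> A. \<exists>B \<in> F. S = B \<inter> A)"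

text \<open>The least \<open>n\<close> such that no subset of \<open>X\<close> of size \<open>n + 1\<close> is shattered; the infimum of the
  empty set in \<^typ>\<open>enat\<close> is \<open>\<infinity>\<close>.\<close>

definition vc_dim :: "'x set \<Rightarrow> 'x set set \<Rightarrow> enat" where
  "vc_dim X F = Inf (enat ` {n. \<not> (\<exists>A \<subseteq> X. finite A \<and> card A = n + 1 \<and> shatters F A)})"

definition fibre ::
  "('s, 'f, 'r, 'a) struct \<Rightarrow> ('s, 'f, 'r) fm \<Rightarrow> 's var list \<Rightarrow> 's var list \<Rightarrow> 'a list \<Rightarrow> 'a list set"
where
  "fibre M \<phi> x y b = {a \<in> var_space M x. holds M \<phi> (x @ y) (a @ b)}"

definition nip_formula ::
  "('s, 'f, 'r, 'a) struct \<Rightarrow> ('s, 'f, 'r) fm \<Rightarrow> 's var list \<Rightarrow> 's var list \<Rightarrow> bool" where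
  "nip_formula M \<phi> x y \<longleftrightarrow> vc_dim (var_space M x) (fibre M \<phi> x y ` var_space M y) < \<infinity>"

definition dual_vc ::
  "('s, 'f, 'r, 'a) struct \<Rightarrow> ('s, 'f, 'r) fm \<Rightarrow> 's var list \<Rightarrow> 's var list \<Rightarrow> enat" where
  "dual_vc M \<phi> x y =
     vc_dim (var_space M y)
       ((\<lambda>a. {b \<in> var_space M y. holds M \<phi> (x @ y) (a @ b)}) ` var_space M x)"

text \<open>NIP for the complete theory of \<open>M\<close>: every formula $\phi(x,y)$ of the language \<open>L\<close> of the
  theory is NIP, as evaluated in \<open>M\<close>. For a complete theory the choice of the model \<open>M\<close> does not
  matter.\<close>

definition nip_theory_of :: "('s, 'f, 'r) lang \<Rightarrow> ('s, 'f, 'r, 'a) struct \<Rightarrow> bool" where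
  "nip_theory_of L M \<longleftrightarrow>
     (\<forall>x y \<phi>. distinct (x @ y) \<and> formula_in L (x @ y) \<phi> \<longrightarrow> nip_formula M \<phi> x y)"

definition pq_property ::
  "('s, 'f, 'r, 'a) struct \<Rightarrow> ('s, 'f, 'r) fm \<Rightarrow> ('s, 'f, 'r) fm \<Rightarrow> 's var list \<Rightarrow> 's var list \<Rightarrow>
    nat \<Rightarrow> nat \<Rightarrow> bool" where
  "pq_property M \<phi> \<psi> x y p q \<longleftrightarrow>
     (let F = fibre M \<phi> x y ` defset M \<psi> y in
        {} \<notin> F \<and>
        (\<forall>G \<subseteq> F. finite G \<and> card G = p \<longrightarrow> (\<exists>H \<subseteq> G. card H = q \<and> \<Inter>H \<noteq> {})))"

end

theory Submission
  imports Defs Complex_Main "HOL-Library.Ramsey" "HOL-Library.FuncSet" "HOL-Library.Nat_Bijection"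
begin

text \<open>By compactness it suffices to show that every ultrafilter \<open>p\<close> of subsets of \<open>\<psi>(M)\<close> contains a definable
  set \<open>\<theta>\<close> such that \<open>{\<phi>(x,b) | b \<in> \<theta>}\<close> is consistent. Call a set \<open>A\<close> of tuples \<open>x\<close> large if for every \<open>n\<close>
  there is a definable \<open>\<theta>\<close> in \<open>p\<close> such that any \<open>n\<close> of the sets \<open>\<phi>(A,b)\<close> with \<open>b \<in> \<theta>\<close> have a common
  element. If \<open>A\<close> is not large, then, because few alternations occur along products of ultrafilters, every
  definable set in \<open>p\<close> contains a finite sample of which each element of \<open>A\<close> satisfies only a small
  fraction; by Ramsey's theorem this is incompatible with a \<open>(p,q)\<close>-property for \<open>q\<close> above the dual
  VC-dimension. The large sets are thus those with some \<open>q\<close>-consistent \<open>\<theta>\<close>, and the others form an ideal.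

  It remains to make \<open>\<theta>\<close> independent of \<open>n\<close>. Choose a maximal sequence \<open>b\<close> such that all pieces cut
  out by sign conditions on the formulas \<open>\<phi>(x,b i)\<close> are large; its length is less than \<open>q\<close>. By maximality, for
  \<open>p\<close>-almost all \<open>c\<close> the part of some piece outside \<open>\<phi>(x,c)\<close> is not large, so on this piece \<open>\<phi>(x,c)\<close>
  follows from \<open>q\<close> instances of \<open>\<phi>\<close> with parameters \<open>d\<close> from any prescribed \<open>\<theta>'\<close> in \<open>p\<close>. The relation
  ``\<open>d\<close> implies \<open>c\<close>'' has finite VC-dimension by NIP and satisfies a \<open>(p,q)\<close>-property of its own, so it is
  consistent to any finite order on some \<open>\<theta>''\<close> in \<open>p\<close>. Given finitely many \<open>c \<in> \<theta>''\<close>, multiplicative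
  weights produce a list of tuples \<open>d\<close> of which a fixed fraction implies each \<open>c\<close>, and an epsilon-net
  reduces the instances that have to be realized to a bounded number, which \<open>\<theta>'\<close> was chosen to allow.\<close>

section \<open>Ultrafilters\<close>

text \<open>\<open>M\<close> need not be saturated and the ultrafilter \<open>p\<close> need not be
  definable, so no infinite Morley sequences are at hand, and arguments that would use them become
  statements about finite samples. The obstacle is that iterating \<open>p\<close> leads out of the
  definable sets. The alternation bound needs marginals that agree with \<open>p\<close> on all
  sets, whereas the ultrafilter at hand has the right marginals on definable sets only; it is
  therefore extended. A sample can be brought back from the extension only along definable
  conditions, which is the reason for \<open>tame\<close> and for building samples as trees, one
  block at a time. The passage from every finite order to one common \<theta> faces a circle: the
  set supplying the implying instances has to be consistent to the order given by the size of an
  epsilon-net, this size depends on a VC-bound for the implication relation, and that relation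
  involves the set. NIP breaks the circle, because its bound is uniform in the set.\<close>

text \<open>An ultrafilter is encoded as a quantifier on predicates; commuting with conjunction and
  negation already yields monotonicity and properness. Products of ultrafilters become nested
  quantifiers such as \<open>p (\<lambda>w. p (\<lambda>c. B c w))\<close>.\<close>

definition ultra :: "(('a \<Rightarrow> bool) \<Rightarrow> bool) \<Rightarrow> bool" where
  "ultra F \<longleftrightarrow> (\<forall>P Q. F (\<lambda>x. P x \<and> Q x) \<longleftrightarrow> F P \<and> F Q) \<and> (\<forall>P. F (\<lambda>x. \<not> P x) \<longleftrightarrow> \<not> F P)"

lemma ultra_conj: "ultra F \<Longrightarrow> F (\<lambda>x. P x \<and> Q x) \<longleftrightarrow> F P \<and> F Q"
  by (simp add: ultra_def)

lemma ultra_not: "ultra F \<Longrightarrow> F (\<lambda>x. \<not> P x) \<longleftrightarrow> \<not> F P"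
  by (simp add: ultra_def)

lemma ultra_mono: assumes "ultra F" "F P" "\<And>x. P x \<Longrightarrow> Q x" shows "F Q"
proof -
  have "(\<lambda>x. P x \<and> Q x) = P" using assms(3) by auto
  then show ?thesis using ultra_conj[OF assms(1), of P Q] assms(2) by simp
qed

lemma ultra_True: "ultra F \<Longrightarrow> F (\<lambda>x. True)"
  using ultra_not[of F "\<lambda>_. True"] ultra_conj[of F "\<lambda>_. False" "\<lambda>_. True"] by auto

lemma ultra_const: "ultra F \<Longrightarrow> F (\<lambda>x. c) \<longleftrightarrow> c"
  by (cases "c = True") (use ultra_True[of F] ultra_not[of F "\<lambda>_. True"] in simp_all)

lemma ultra_disj: assumes "ultra F" shows "F (\<lambda>x. P x \<or> Q x) \<longleftrightarrow> F P \<or> F Q"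
proof -
  have "F (\<lambda>x. P x \<or> Q x) \<longleftrightarrow> F (\<lambda>x. \<not> (\<not> P x \<and> \<not> Q x))" by simp
  then show ?thesis by (simp only: ultra_not[OF assms] ultra_conj[OF assms]) simp
qed

lemma ultra_ex: assumes "ultra F" "F P" shows "\<exists>x. P x"
proof (rule ccontr)
  assume "\<not> (\<exists>x. P x)"
  then have "P = (\<lambda>x. False)" by auto
  with assms show False by (simp add: ultra_const)
qed

lemma ultra_ball: assumes "ultra F" "finite I"
  shows "F (\<lambda>x. \<forall>i\<in>I. P i x) \<longleftrightarrow> (\<forall>i\<in>I. F (P i))"
  using assms(2) by induct (simp_all add: ultra_const[OF assms(1)] ultra_conj[OF assms(1)])

lemma ultra_bex: assumes "ultra F" "finite I"
  shows "F (\<lambda>x. \<exists>i\<in>I. P i x) \<longleftrightarrow> (\<exists>i\<in>I. F (P i))"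
  using assms(2) by induct (simp_all add: ultra_const[OF assms(1)] ultra_disj[OF assms(1)])

lemma ball_subset: "\<forall>x\<in>B. P x \<Longrightarrow> A \<subseteq> B \<Longrightarrow> \<forall>x\<in>A. P x"
  by blast

text \<open>Zorn's lemma gives a maximal family with the finite intersection property. A set that
  cannot be added is disjoint from some finite intersection of members, so its complement can be
  added.\<close>

lemma ultra_exists:
  fixes C :: "('a \<Rightarrow> bool) set"
  assumes fip: "\<And>D. finite D \<Longrightarrow> D \<subseteq> C \<Longrightarrow> \<exists>x. \<forall>P\<in>D. P x"
  obtains F where "ultra F" "\<And>P. P \<in> C \<Longrightarrow> F P"
proof -
  define fipp where "fipp M \<longleftrightarrow> (\<forall>D. finite D \<and> D \<subseteq> M \<longrightarrow> (\<exists>x. \<forall>P\<in>D. P x))" for M :: "('a \<Rightarrow> bool) set"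
  let ?A = "{M. C \<subseteq> M \<and> fipp M}"
  have "\<exists>M\<in>?A. \<forall>X\<in>?A. M \<subseteq> X \<longrightarrow> X = M"
  proof (rule subset_Zorn_nonempty)
    show "?A \<noteq> {}" using fip by (auto simp: fipp_def)
    fix Z assume Z: "Z \<noteq> {}" "subset.chain ?A Z"
    have "fipp (\<Union>Z)"
      unfolding fipp_def
    proof (intro allI impI)
      fix D assume D: "finite D \<and> D \<subseteq> \<Union>Z"
      obtain M where "M \<in> Z" "D \<subseteq> M"
        by (rule finite_subset_Union_chain[of D Z ?A]) (use D Z in auto)
      moreover have "fipp M" using Z \<open>M \<in> Z\<close> by (auto simp: subset.chain_def)
      ultimately show "\<exists>x. \<forall>P\<in>D. P x" using D by (auto simp: fipp_def)
    qed
    moreover have "C \<subseteq> \<Union>Z"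
    proof -
      obtain M where "M \<in> Z" using Z(1) by blast
      then have "C \<subseteq> M" using Z(2) unfolding subset.chain_def by blast
      then show ?thesis using \<open>M \<in> Z\<close> by blast
    qed
    ultimately show "\<Union>Z \<in> ?A" by simp
  qed
  then obtain M where MA: "M \<in> ?A" and max': "\<forall>X\<in>?A. M \<subseteq> X \<longrightarrow> X = M" by blast
  have M: "C \<subseteq> M" "fipp M" using MA by auto
  have max: "X = M" if "M \<subseteq> X" "fipp X" for X using max' M that by auto
  have ext: "P \<in> M" if "\<And>D. finite D \<Longrightarrow> D \<subseteq> M \<Longrightarrow> \<exists>x. P x \<and> (\<forall>Q\<in>D. Q x)" for P
  proof -
    have "fipp (insert P M)"
      unfolding fipp_def
    proof (intro allI impI)
      fix D assume D: "finite D \<and> D \<subseteq> insert P M"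
      have "\<exists>x. P x \<and> (\<forall>Q\<in>D - {P}. Q x)" using D by (intro that) auto
      then obtain x where "P x \<and> (\<forall>Q\<in>D - {P}. Q x)" ..
      then have "\<forall>Q\<in>insert P (D - {P}). Q x" unfolding ball_simps .
      then have "\<forall>Q\<in>D. Q x" by (rule ball_subset) auto
      then show "\<exists>x. \<forall>Q\<in>D. Q x" ..
    qed
    then show ?thesis using max[of "insert P M"] by auto
  qed
  have FD: "\<exists>x. \<forall>P\<in>D. P x" if "finite D" "D \<subseteq> M" for D
    using M(2) that by (auto simp: fipp_def)
  have mono: "Q \<in> M" if "P \<in> M" "\<And>x. P x \<Longrightarrow> Q x" for P Q
  proof (rule ext)
    fix D assume "finite D" "D \<subseteq> M"
    then have "\<exists>x. \<forall>R\<in>insert P D. R x" using that(1) by (intro FD) simp_all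
    then obtain x where "\<forall>R\<in>insert P D. R x" ..
    then have "P x \<and> (\<forall>R\<in>D. R x)" unfolding ball_simps .
    then have "Q x \<and> (\<forall>R\<in>D. R x)" using that(2)[of x] by blast
    then show "\<exists>x. Q x \<and> (\<forall>R\<in>D. R x)" ..
  qed
  have conj: "(\<lambda>x. P x \<and> Q x) \<in> M \<longleftrightarrow> P \<in> M \<and> Q \<in> M" for P Q
  proof
    assume a: "(\<lambda>x. P x \<and> Q x) \<in> M"
    show "P \<in> M \<and> Q \<in> M" using mono[OF a, of P] mono[OF a, of Q] by simp
  next
    assume a: "P \<in> M \<and> Q \<in> M"
    show "(\<lambda>x. P x \<and> Q x) \<in> M"
    proof (rule ext)
      fix D assume "finite D" "D \<subseteq> M"
      then have "\<exists>x. \<forall>R\<in>insert P (insert Q D). R x" using a by (intro FD) simp_all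
      then obtain x where "\<forall>R\<in>insert P (insert Q D). R x" ..
      then have "(P x \<and> Q x) \<and> (\<forall>R\<in>D. R x)" unfolding ball_simps conj_assoc .
      then show "\<exists>x. (P x \<and> Q x) \<and> (\<forall>R\<in>D. R x)" ..
    qed
  qed
  have neg: "(\<lambda>x. \<not> P x) \<in> M \<longleftrightarrow> P \<notin> M" for P
  proof
    assume a: "(\<lambda>x. \<not> P x) \<in> M"
    show "P \<notin> M"
    proof
      assume "P \<in> M"
      then have "\<exists>x. \<forall>R\<in>{P, \<lambda>x. \<not> P x}. R x" using a by (intro FD) simp_all
      then show False by simp
    qed
  next
    assume "P \<notin> M"
    then have "\<not> (\<forall>D. finite D \<longrightarrow> D \<subseteq> M \<longrightarrow> (\<exists>x. P x \<and> (\<forall>Q\<in>D. Q x)))"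
      using ext[of P] by blast
    then obtain D where D: "finite D" "D \<subseteq> M" "\<not> (\<exists>x. P x \<and> (\<forall>Q\<in>D. Q x))" by blast
    show "(\<lambda>x. \<not> P x) \<in> M"
    proof (rule ext)
      fix D' assume "finite D'" "D' \<subseteq> M"
      then have "\<exists>x. \<forall>R\<in>D \<union> D'. R x" using D by (intro FD) simp_all
      then obtain x where x: "\<forall>R\<in>D \<union> D'. R x" ..
      then have "(\<forall>R\<in>D. R x) \<and> (\<forall>R\<in>D'. R x)" unfolding ball_Un .
      then have "\<not> P x \<and> (\<forall>R\<in>D'. R x)" using D(3) by blast
      then show "\<exists>x. \<not> P x \<and> (\<forall>R\<in>D'. R x)" ..
    qed
  qed
  have "ultra (\<lambda>P. P \<in> M)" unfolding ultra_def using conj neg by simp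
  then show thesis by (rule that) (use M(1) in blast)
qed

section \<open>Random samples\<close>

text \<open>Exchanging \<open>u j\<close> with a fresh value \<open>v\<close> is an involution on
  pairs, so a point with one entry redrawn is distributed like the original point.\<close>

lemma card_fibre_update:
  fixes I :: "'i set" and B :: "(nat \<Rightarrow> 'i) \<Rightarrow> bool"
  assumes I: "finite I" and j: "j < n"
  defines "U \<equiv> PiE {..<n} (\<lambda>_. I)"
  shows "card {u\<in>U. B u} * card I = (\<Sum>u\<in>U. card {v\<in>I. B (u(j := v))})"
proof -
  have finU: "finite U" unfolding U_def using I by (intro finite_PiE) auto
  have upd: "u(j := v) \<in> U" if "u \<in> U" "v \<in> I" for u v
    using that j by (auto simp: U_def PiE_iff extensional_def)
  have val: "u j \<in> I" if "u \<in> U" for u using that j by (auto simp: U_def)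
  have "bij_betw (\<lambda>(u, v). (u(j := v), u j)) {(u, v). u \<in> U \<and> v \<in> I \<and> B (u(j := v))} ({u\<in>U. B u} \<times> I)"
    by (rule bij_betw_byWitness[where f' = "\<lambda>(u, v). (u(j := v), u j)"]) (auto simp: upd val)
  then have "card ({u\<in>U. B u} \<times> I) = card {(u, v). u \<in> U \<and> v \<in> I \<and> B (u(j := v))}"
    by (simp add: bij_betw_same_card)
  also have "{(u, v). u \<in> U \<and> v \<in> I \<and> B (u(j := v))} = (SIGMA u:U. {v\<in>I. B (u(j := v))})" by auto
  also have "card \<dots> = (\<Sum>u\<in>U. card {v\<in>I. B (u(j := v))})"
    using finU I by (intro card_SigmaI) auto
  finally show ?thesis by (simp add: card_cartesian_product)
qed

text \<open>The union bound, with probabilities as counts in a finite product. Each event is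
  estimated by redrawing the single entry \<open>j e\<close> while the others stay fixed.\<close>

lemma sample_avoid:
  fixes I :: "'i set" and B :: "'e \<Rightarrow> (nat \<Rightarrow> 'i) \<Rightarrow> bool" and \<delta> :: real
  assumes I: "finite I" "I \<noteq> {}" and E: "finite E" and j: "\<And>e. e \<in> E \<Longrightarrow> j e < n"
    and small: "\<And>e u. e \<in> E \<Longrightarrow> u \<in> PiE {..<n} (\<lambda>_. I) \<Longrightarrow> card {v\<in>I. B e (u(j e := v))} \<le> \<delta> * card I"
    and \<delta>: "card E * \<delta> < 1"
  shows "\<exists>u\<in>PiE {..<n} (\<lambda>_. I). \<forall>e\<in>E. \<not> B e u"
proof -
  define U where "U = PiE {..<n} (\<lambda>_. I)"
  have finU: "finite U" unfolding U_def using I by (intro finite_PiE) auto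
  have "U \<noteq> {}" unfolding U_def using I by (simp add: PiE_eq_empty_iff)
  then have cU: "card U > 0" using finU by (simp add: card_gt_0_iff)
  have cI: "card I > 0" using I by (simp add: card_gt_0_iff)
  have b: "card {u\<in>U. B e u} \<le> \<delta> * card U" if e: "e \<in> E" for e
  proof -
    have "real (card {u\<in>U. B e u}) * card I = (\<Sum>u\<in>U. real (card {v\<in>I. B e (u(j e := v))}))"
      using arg_cong[OF card_fibre_update[OF I(1) j[OF e], of "B e"], of real] by (simp add: U_def)
    also have "\<dots> \<le> (\<Sum>u\<in>U. \<delta> * card I)"
      by (intro sum_mono small[OF e]) (simp add: U_def)
    also have "\<dots> = (\<delta> * card U) * card I" by simp
    finally show ?thesis using cI by simp
  qed
  have "real (card (\<Union>e\<in>E. {u\<in>U. B e u})) \<le> real (\<Sum>e\<in>E. card {u\<in>U. B e u})"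
    using card_UN_le[OF E, of "\<lambda>e. {u\<in>U. B e u}"] by (simp only: of_nat_le_iff)
  also have "\<dots> = (\<Sum>e\<in>E. real (card {u\<in>U. B e u}))" by simp
  also have "\<dots> \<le> (\<Sum>e\<in>E. \<delta> * card U)" by (intro sum_mono b)
  also have "\<dots> = (card E * \<delta>) * card U" by simp
  also have "\<dots> < card U" using \<delta> cU by simp
  finally have lt: "card (\<Union>e\<in>E. {u\<in>U. B e u}) < card U" by simp
  have "\<not> U \<subseteq> (\<Union>e\<in>E. {u\<in>U. B e u})"
  proof
    assume "U \<subseteq> (\<Union>e\<in>E. {u\<in>U. B e u})"
    then have "card U \<le> card (\<Union>e\<in>E. {u\<in>U. B e u})"
      using finU E by (intro card_mono) auto
    with lt show False by simp
  qed
  then obtain u where u: "u \<in> U" "u \<notin> (\<Union>e\<in>E. {u\<in>U. B e u})" by (auto simp: subset_iff)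
  then show ?thesis by (intro bexI[of _ u]) (simp_all add: U_def)
qed

section \<open>Shattering\<close>

text \<open>Points are given by an indexed sequence, which is convenient for samples with
  repetitions; an index set on which \<open>b\<close> is not injective is never shattered.\<close>

definition shat_at :: "('d \<Rightarrow> 'y \<Rightarrow> bool) \<Rightarrow> 'd set \<Rightarrow> nat set \<Rightarrow> (nat \<Rightarrow> 'y) \<Rightarrow> bool" where
  "shat_at R D I b \<longleftrightarrow> (\<forall>W\<subseteq>I. \<exists>d\<in>D. \<forall>i\<in>I. R d (b i) \<longleftrightarrow> i \<in> W)"

text \<open>This means VC-dimension less than \<open>k\<close>. With this normalization the bounds
  of a union simply add up.\<close>

definition vcb :: "('d \<Rightarrow> 'y \<Rightarrow> bool) \<Rightarrow> 'd set \<Rightarrow> 'y set \<Rightarrow> nat \<Rightarrow> bool" where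
  "vcb R D Y k \<longleftrightarrow> (\<forall>I b. finite I \<and> card I = k \<and> b ` I \<subseteq> Y \<longrightarrow> \<not> shat_at R D I b)"

lemma shat_at_subset: assumes "shat_at R D I b" "J \<subseteq> I" shows "shat_at R D J b"
  unfolding shat_at_def
proof (intro allI impI)
  fix W assume "W \<subseteq> J"
  then obtain d where "d \<in> D" "\<forall>i\<in>I. R d (b i) \<longleftrightarrow> i \<in> W"
    using assms unfolding shat_at_def by (meson subset_trans)
  then show "\<exists>d\<in>D. \<forall>i\<in>J. R d (b i) \<longleftrightarrow> i \<in> W" using assms(2) by auto
qed

lemma vcb_mono: assumes "vcb R D Y k" "D' \<subseteq> D" "Y' \<subseteq> Y" "k \<le> k'" shows "vcb R D' Y' k'"
  unfolding vcb_def
proof (intro allI impI notI)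
  fix I and b :: "nat \<Rightarrow> 'b" assume I: "finite I \<and> card I = k' \<and> b ` I \<subseteq> Y'" and s: "shat_at R D' I b"
  obtain J where J: "J \<subseteq> I" "card J = k" using I assms(4) by (metis obtain_subset_with_card_n)
  have "shat_at R D J b"
    using shat_at_subset[OF s J(1)] assms(2) unfolding shat_at_def by (meson subsetD)
  moreover have "finite J \<and> card J = k \<and> b ` J \<subseteq> Y" using I J assms(3) by (auto intro: finite_subset)
  ultimately show False using assms(1) unfolding vcb_def by blast
qed

text \<open>A union of two families that shatters a disjoint union of two sets does so because one family
  shatters one of the sets.\<close>

lemma vcb_Un:
  assumes "vcb R D1 Y k1" "vcb R D2 Y k2"
  shows "vcb R (D1 \<union> D2) Y (k1 + k2)"
  unfolding vcb_def
proof (intro allI impI notI)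
  fix I and b :: "nat \<Rightarrow> 'b" assume I: "finite I \<and> card I = k1 + k2 \<and> b ` I \<subseteq> Y" and s: "shat_at R (D1 \<union> D2) I b"
  obtain J where J: "J \<subseteq> I" "card J = k1" using I by (metis le_add1 obtain_subset_with_card_n)
  have cJ: "card (I - J) = k2" using I J by (simp add: card_Diff_subset finite_subset)
  have fJ: "finite J" using I J finite_subset by blast
  have bJ: "b ` J \<subseteq> Y" using I J by blast
  have "\<not> shat_at R D1 J b" using assms(1) J(2) fJ bJ unfolding vcb_def by blast
  then obtain W where W: "W \<subseteq> J" "\<not> (\<exists>d\<in>D1. \<forall>i\<in>J. R d (b i) \<longleftrightarrow> i \<in> W)"
    unfolding shat_at_def by blast
  have "shat_at R D2 (I - J) b"
    unfolding shat_at_def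
  proof (intro allI impI)
    fix V assume V: "V \<subseteq> I - J"
    have "W \<union> V \<subseteq> I" using W(1) J(1) V by blast
    then obtain d where d: "d \<in> D1 \<union> D2" "\<forall>i\<in>I. R d (b i) \<longleftrightarrow> i \<in> W \<union> V"
      using s unfolding shat_at_def by blast
    have "R d (b i) \<longleftrightarrow> i \<in> W" if "i \<in> J" for i using d(2) J(1) V that by blast
    then have "d \<in> D2" using d(1) W(2) by blast
    moreover have "R d (b i) \<longleftrightarrow> i \<in> V" if "i \<in> I - J" for i using d(2) W(1) that by blast
    ultimately show "\<exists>d\<in>D2. \<forall>i\<in>I - J. R d (b i) \<longleftrightarrow> i \<in> V" by blast
  qed
  moreover have "finite (I - J)" "b ` (I - J) \<subseteq> Y" using I by auto
  ultimately show False using assms(2) cJ unfolding vcb_def by blast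
qed

lemma vcb_empty: "vcb R {} Y 0"
  unfolding vcb_def shat_at_def by auto

lemma vcb_UN:
  assumes "finite T" "\<And>t. t \<in> T \<Longrightarrow> vcb R (D t) Y k"
  shows "vcb R (\<Union>t\<in>T. D t) Y (card T * k)"
  using assms
proof (induct T)
  case empty
  then show ?case by (simp add: vcb_empty)
next
  case (insert t T)
  then have "vcb R (D t \<union> (\<Union>t\<in>T. D t)) Y (k + card T * k)" by (intro vcb_Un) auto
  then show ?case using insert by simp
qed

section \<open>Samples whose consistent subsets are cut out exactly\<close>

text \<open>The witness \<open>g K u\<close> chosen for a consistent index set \<open>K\<close>
  depends only on the entries of \<open>u\<close> in \<open>K\<close>. An entry outside
  \<open>K\<close> is independent of it and hence satisfies the relation with probability at most
  \<delta>. The union bound runs over the at most \<open>2 ^ n * n\<close> pairs of a set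
  \<open>K\<close> and an index outside \<open>K\<close>.\<close>

lemma sample_exact:
  fixes R :: "'d \<Rightarrow> 'y \<Rightarrow> bool" and \<delta> :: real
  assumes ys: "ys \<noteq> []" and small: "\<And>d. d \<in> D \<Longrightarrow> length (filter (R d) ys) \<le> \<delta> * length ys"
    and \<delta>: "2 ^ n * n * \<delta> < (1::real)"
  shows "\<exists>b. (\<forall>i. b i \<in> set ys) \<and>
    (\<forall>K\<subseteq>{..<n}. (\<exists>d\<in>D. \<forall>i\<in>K. R d (b i)) \<longrightarrow> (\<exists>d\<in>D. \<forall>i<n. R d (b i) \<longleftrightarrow> i \<in> K))"
proof (cases "D = {}")
  case True
  then show ?thesis using ys by (intro exI[of _ "\<lambda>_. ys ! 0"]) simp
next
  case False
  have d0: "0 \<le> \<delta>"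
  proof -
    obtain d where "d \<in> D" using False by auto
    then have "0 \<le> \<delta> * length ys" using small[of d] by (meson of_nat_0_le_iff order_trans)
    then show ?thesis using ys by (simp add: zero_le_mult_iff)
  qed
  define I where "I = {..<length ys}"
  have I: "finite I" "I \<noteq> {}" using ys by (auto simp: I_def lessThan_empty_iff)
  define g where "g K u = (SOME d. d \<in> D \<and> (\<forall>i\<in>K. R d (ys ! u i)))" for K and u :: "nat \<Rightarrow> nat"
  have gP: "g K u \<in> D \<and> (\<forall>i\<in>K. R (g K u) (ys ! u i))" if "\<exists>d\<in>D. \<forall>i\<in>K. R d (ys ! u i)" for K u
    unfolding g_def by (rule someI_ex) (use that in blast)
  define E where "E = (SIGMA K:Pow {..<n}. {..<n} - K)"
  define B where "B e u \<longleftrightarrow> (\<exists>d\<in>D. \<forall>i\<in>fst e. R d (ys ! u i)) \<and> R (g (fst e) u) (ys ! u (snd e))"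
    for e :: "nat set \<times> nat" and u
  have finE: "finite E" unfolding E_def by auto
  have "card E \<le> 2 ^ n * n"
  proof -
    have "E \<subseteq> Pow {..<n} \<times> {..<n}" unfolding E_def by auto
    then have "card E \<le> card (Pow {..<n} \<times> {..<n})" by (intro card_mono) auto
    then show ?thesis by (simp add: card_cartesian_product card_Pow)
  qed
  then have "real (card E) \<le> real (2 ^ n * n)" by (rule of_nat_mono)
  then have "real (card E) \<le> 2 ^ n * real n" by simp
  then have "card E * \<delta> \<le> 2 ^ n * real n * \<delta>" using d0 by (intro mult_right_mono)
  then have E1: "card E * \<delta> < 1" using \<delta> by linarith
  have sm: "card {v\<in>I. B e (u(snd e := v))} \<le> \<delta> * card I" if e: "e \<in> E" for e u
  proof (cases "\<exists>d\<in>D. \<forall>i\<in>fst e. R d (ys ! u i)")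
    case ex: True
    have ne: "snd e \<notin> fst e" using e by (auto simp: E_def)
    have eq: "(\<forall>i\<in>fst e. R d (ys ! (u(snd e := v)) i)) \<longleftrightarrow> (\<forall>i\<in>fst e. R d (ys ! u i))" for d v
      using ne by auto
    have geq: "g (fst e) (u(snd e := v)) = g (fst e) u" for v
      unfolding g_def eq ..
    have gD: "g (fst e) u \<in> D" using gP[OF ex] by blast
    have "{v\<in>I. B e (u(snd e := v))} = {v. v < length ys \<and> R (g (fst e) u) (ys ! v)}"
      unfolding B_def geq eq using ex by (auto simp: I_def)
    then have "card {v\<in>I. B e (u(snd e := v))} = length (filter (R (g (fst e) u)) ys)"
      by (simp add: length_filter_conv_card)
    then show ?thesis using small[OF gD] by (simp add: I_def)
  next
    case False
    have ne: "snd e \<notin> fst e" using e by (auto simp: E_def)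
    have eq: "(\<forall>i\<in>fst e. R d (ys ! (u(snd e := v)) i)) \<longleftrightarrow> (\<forall>i\<in>fst e. R d (ys ! u i))" for d v
      using ne by auto
    have "{v\<in>I. B e (u(snd e := v))} = {}" unfolding B_def eq using False by auto
    then have "card {v\<in>I. B e (u(snd e := v))} = 0" by (metis card.empty)
    then show ?thesis using d0 by simp
  qed
  have jE: "snd e < n" if "e \<in> E" for e using that by (auto simp: E_def)
  have "\<exists>u\<in>PiE {..<n} (\<lambda>_. I). \<forall>e\<in>E. \<not> B e u"
  proof (rule sample_avoid[OF I finE])
    show "snd e < n" if "e \<in> E" for e by (rule jE[OF that])
    show "card {v\<in>I. B e (u(snd e := v))} \<le> \<delta> * card I" if "e \<in> E" for e u by (rule sm[OF that])
    show "card E * \<delta> < 1" by (rule E1)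
  qed
  then obtain u where u1: "u \<in> PiE {..<n} (\<lambda>_. I)" and u2: "\<forall>e\<in>E. \<not> B e u" ..
  define b where "b i = (if i < n then ys ! u i else ys ! 0)" for i
  show ?thesis
  proof (intro exI[of _ b] conjI allI impI)
    fix i show "b i \<in> set ys" using u1 ys by (auto simp: b_def I_def PiE_iff)
  next
    fix K assume K: "K \<subseteq> {..<n}" and ex: "\<exists>d\<in>D. \<forall>i\<in>K. R d (b i)"
    have ex': "\<exists>d\<in>D. \<forall>i\<in>K. R d (ys ! u i)" proof -
      obtain d where d: "d \<in> D" "\<forall>i\<in>K. R d (b i)" using ex by blast
      have "R d (ys ! u i)" if "i \<in> K" for i
      proof -
        have "i < n" using that K by blast
        moreover have "R d (b i)" using d(2) that by blast
        ultimately show ?thesis by (simp add: b_def)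
      qed
      then show ?thesis using d(1) by blast
    qed
    have g: "g K u \<in> D" "\<forall>i\<in>K. R (g K u) (ys ! u i)" using gP[OF ex'] by simp_all
    have "\<not> R (g K u) (b i)" if "i < n" "i \<notin> K" for i
    proof -
      have "(K, i) \<in> E" using that K by (simp add: E_def)
      then have "\<not> B (K, i) u" using u2 by blast
      then show ?thesis using ex' that by (simp add: B_def b_def)
    qed
    moreover have "R (g K u) (b i)" if "i \<in> K" for i
    proof -
      have "i < n" using that K by blast
      moreover have "R (g K u) (ys ! u i)" using g(2) that by blast
      ultimately show ?thesis by (simp add: b_def)
    qed
    ultimately show "\<exists>d\<in>D. \<forall>i<n. R d (b i) \<longleftrightarrow> i \<in> K" using g(1) by blast
  qed
qed

text \<open>A subset \<open>W\<close> of \<open>I\<close> is padded by points of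
  \<open>H - I\<close> to exactly \<open>q\<close> points, which are consistent; the element that
  cuts out the padded set cuts out \<open>W\<close> on \<open>I\<close>. The size
  \<open>2 * q\<close> leaves room for the padding.\<close>

lemma exact_shatter:
  assumes ex: "\<And>K. K \<subseteq> {..<n} \<Longrightarrow> \<exists>d\<in>D. \<forall>i\<in>K. R d (b i) \<Longrightarrow> \<exists>d\<in>D. \<forall>i<n. R d (b i) \<longleftrightarrow> i \<in> K"
    and H: "H \<subseteq> {..<n}" "card H = 2 * q"
    and cons: "\<And>K. K \<subseteq> H \<Longrightarrow> card K = q \<Longrightarrow> \<exists>d\<in>D. \<forall>i\<in>K. R d (b i)"
  shows "\<exists>I\<subseteq>H. card I = q \<and> shat_at R D I b"
proof -
  have finH: "finite H" using H(1) finite_subset by blast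
  obtain I where I: "I \<subseteq> H" "card I = q" using H by (metis dvd_triv_right le_add1 mult_2 obtain_subset_with_card_n)
  have c: "card (H - I) = q" using I H finH by (simp add: card_Diff_subset finite_subset)
  have "shat_at R D I b"
    unfolding shat_at_def
  proof (intro allI impI)
    fix W assume W: "W \<subseteq> I"
    have finI: "finite I" using I finH finite_subset by blast
    have "card W \<le> q" using W I finI by (metis card_mono)
    then obtain V where V: "V \<subseteq> H - I" "card V = q - card W" using c by (metis diff_le_self obtain_subset_with_card_n)
    have "card (W \<union> V) = card W + card V"
      using W V I finH finI by (intro card_Un_disjoint) (auto intro: finite_subset)
    then have "card (W \<union> V) = q" using V \<open>card W \<le> q\<close> by simp
    moreover have "W \<union> V \<subseteq> H" using W V I by auto
    ultimately have "\<exists>d\<in>D. \<forall>i<n. R d (b i) \<longleftrightarrow> i \<in> W \<union> V"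
      using H(1) by (intro ex cons) auto
    then obtain d where "d \<in> D" "\<forall>i<n. R d (b i) \<longleftrightarrow> i \<in> W \<union> V" by blast
    moreover have "\<forall>i\<in>I. i < n \<and> i \<notin> V" using V I H by auto
    ultimately show "\<exists>d\<in>D. \<forall>i\<in>I. R d (b i) \<longleftrightarrow> i \<in> W" by auto
  qed
  then show ?thesis using I by auto
qed

text \<open>The fraction that \<open>sample_exact\<close> tolerates when \<open>n\<close> is
  \<open>2 * q\<close>; the summand 1 makes the required inequality strict.\<close>

definition frac_const :: "nat \<Rightarrow> real" where
  "frac_const q = 1 / (2 ^ (2 * q) * (2 * q) + 1)"

lemma frac_const_pos: "frac_const q > 0" "frac_const q \<le> 1"
  by (auto simp: frac_const_def add_nonneg_pos divide_le_eq_1 intro!: divide_pos_pos)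

text \<open>If every element of \<open>D\<close> satisfied only a smaller fraction, some sample of
  \<open>2 * q\<close> entries would have all its consistent subsets cut out exactly. As any
  \<open>q\<close> entries are consistent, \<open>q\<close> of them would be shattered.\<close>

lemma consistent_fraction:
  fixes R :: "'d \<Rightarrow> 'y \<Rightarrow> bool"
  assumes cons: "\<And>b. (\<And>i. b i \<in> Y) \<Longrightarrow> \<exists>d\<in>D. \<forall>i<q. R d (b i)"
    and vc: "vcb R D Y q" and ys: "ys \<noteq> []" "set ys \<subseteq> Y"
  shows "\<exists>d\<in>D. length (filter (R d) ys) \<ge> frac_const q * length ys"
proof (rule ccontr)
  assume "\<not> ?thesis"
  then have small: "\<And>d. d \<in> D \<Longrightarrow> length (filter (R d) ys) \<le> frac_const q * length ys" by force
  have lt: "2 ^ (2 * q) * real (2 * q) * frac_const q < 1"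
    unfolding frac_const_def by (simp add: divide_less_eq add_nonneg_pos)
  have "\<exists>b. (\<forall>i. b i \<in> set ys) \<and>
    (\<forall>K\<subseteq>{..<2 * q}. (\<exists>d\<in>D. \<forall>i\<in>K. R d (b i)) \<longrightarrow> (\<exists>d\<in>D. \<forall>i<2 * q. R d (b i) \<longleftrightarrow> i \<in> K))"
    by (rule sample_exact[OF ys(1) _ lt]) (rule small)
  then obtain b where b: "\<And>i. b i \<in> set ys"
    "\<And>K. K \<subseteq> {..<2 * q} \<Longrightarrow> \<exists>d\<in>D. \<forall>i\<in>K. R d (b i) \<Longrightarrow> \<exists>d\<in>D. \<forall>i<2 * q. R d (b i) \<longleftrightarrow> i \<in> K"
    by blast
  have "\<exists>d\<in>D. \<forall>i\<in>K. R d (b i)" if K: "K \<subseteq> {..<2 * q}" "card K = q" for K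
  proof -
    have "finite K" using K finite_subset by blast
    then obtain h where h: "bij_betw h {0..<q} K" using K(2) ex_bij_betw_nat_finite by blast
    obtain d where "d \<in> D" "\<forall>i<q. R d (b (h i))" using cons[of "\<lambda>i. b (h i)"] b(1) ys(2) by blast
    moreover have "K = h ` {0..<q}" using h by (simp add: bij_betw_def)
    ultimately show ?thesis by (intro bexI[of _ d]) auto
  qed
  then obtain I where "I \<subseteq> {..<2 * q}" "card I = q" "shat_at R D I b"
    using exact_shatter[where D = D and R = R and b = b and n = "2 * q" and H = "{..<2 * q}" and q = q] b(2) by auto
  moreover have "finite I" using calculation finite_subset by blast
  moreover have "b ` I \<subseteq> Y" using b(1) ys(2) by auto
  ultimately show False using vc unfolding vcb_def by blast
qed

section \<open>The Sauer--Shelah lemma and epsilon-nets\<close>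

definition shat :: "'y set set \<Rightarrow> 'y set \<Rightarrow> bool" where
  "shat F B \<longleftrightarrow> (\<forall>W\<subseteq>B. \<exists>S\<in>F. S \<inter> B = W)"

text \<open>Pajor's form of the Sauer--Shelah lemma. \<open>U\<close> collects the traces without
  \<open>a\<close>, and \<open>V\<close> those with \<open>a\<close>, from which \<open>a\<close> is
  then removed. Their union is the trace on \<open>K\<close>, while a set shattered by their
  intersection stays shattered by \<open>F\<close> when \<open>a\<close> is added, because both
  values at \<open>a\<close> are available.\<close>

lemma pajor:
  assumes "finite K"
  shows "card ((\<lambda>S. S \<inter> K) ` F) \<le> card {B. B \<subseteq> K \<and> shat F B}"
  using assms
proof (induct K arbitrary: F)
  case empty
  show ?case
  proof (cases "F = {}")
    case False
    have "{B. B \<subseteq> {} \<and> shat F B} = {{}}" using False by (auto simp: shat_def)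
    moreover have "(\<lambda>S. S \<inter> {}) ` F = {{}}" using False by auto
    ultimately show ?thesis by simp
  qed simp
next
  case (insert a K)
  define tr where "tr = (\<lambda>S. S \<inter> insert a K) ` F"
  define U where "U = {T\<in>tr. a \<notin> T}"
  define V where "V = (\<lambda>T. T - {a}) ` {T\<in>tr. a \<in> T}"
  have fin: "finite tr" unfolding tr_def by (rule finite_subset[of _ "Pow (insert a K)"]) (use insert in auto)
  have "inj_on (\<lambda>T. T - {a}) {T\<in>tr. a \<in> T}"
    by (rule inj_onI) (metis (no_types, lifting) insert_Diff mem_Collect_eq)
  then have cV: "card V = card {T\<in>tr. a \<in> T}" unfolding V_def by (rule card_image)
  have "card tr = card (U \<union> {T\<in>tr. a \<in> T})" by (rule arg_cong[of _ _ card]) (auto simp: U_def)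
  also have "\<dots> = card U + card {T\<in>tr. a \<in> T}"
    using fin by (intro card_Un_disjoint) (auto simp: U_def)
  also have "\<dots> = card U + card V" by (simp add: cV)
  also have "\<dots> = card (U \<union> V) + card (U \<inter> V)"
    using fin by (intro card_Un_Int) (auto simp: U_def V_def)
  finally have ctr: "card tr = card (U \<union> V) + card (U \<inter> V)" .
  have UV: "U \<union> V = (\<lambda>S. S \<inter> K) ` F"
  proof (intro set_eqI iffI)
    fix T assume "T \<in> U \<union> V"
    then show "T \<in> (\<lambda>S. S \<inter> K) ` F"
    proof
      assume "T \<in> U"
      then obtain S where "S \<in> F" "T = S \<inter> insert a K" "a \<notin> T" by (auto simp: U_def tr_def)
      then have "T = S \<inter> K" by auto
      then show ?thesis using \<open>S \<in> F\<close> by auto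
    next
      assume "T \<in> V"
      then obtain S where "S \<in> F" "T = S \<inter> insert a K - {a}" by (auto simp: V_def tr_def)
      then have "T = S \<inter> K" using insert(2) by auto
      then show ?thesis using \<open>S \<in> F\<close> by auto
    qed
  next
    fix T assume "T \<in> (\<lambda>S. S \<inter> K) ` F"
    then obtain S where S: "S \<in> F" "T = S \<inter> K" by auto
    show "T \<in> U \<union> V"
    proof (cases "a \<in> S")
      case True
      then have "T = S \<inter> insert a K - {a}" "a \<in> S \<inter> insert a K" using S insert(2) by auto
      then show ?thesis using S(1) unfolding V_def tr_def by blast
    next
      case False
      then have "T = S \<inter> insert a K" "a \<notin> T" using S insert(2) by auto
      then show ?thesis using S(1) unfolding U_def tr_def by blast
    qed
  qed
  have UVK: "S \<subseteq> K" if "S \<in> U \<inter> V" for S using that by (auto simp: U_def tr_def)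
  then have img: "(\<lambda>S. S \<inter> K) ` (U \<inter> V) = U \<inter> V" by (auto simp: image_iff Int_absorb2)
  have c1: "card (U \<union> V) \<le> card {B. B \<subseteq> K \<and> shat F B}" unfolding UV by (rule insert(3))
  have c2: "card (U \<inter> V) \<le> card {B. B \<subseteq> K \<and> shat (U \<inter> V) B}" using insert(3)[of "U \<inter> V"] img by simp
  have sh: "shat F (insert a B)" if B: "B \<subseteq> K" "shat (U \<inter> V) B" for B
    unfolding shat_def
  proof (intro allI impI)
    fix W assume W: "W \<subseteq> insert a B"
    then have "W - {a} \<subseteq> B" by auto
    then obtain T where T: "T \<in> U" "T \<in> V" "T \<inter> B = W - {a}" using B(2) unfolding shat_def by blast
    obtain S1 where S1: "S1 \<in> F" "T = S1 \<inter> insert a K" "a \<notin> T" using T(1) by (auto simp: U_def tr_def)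
    obtain S2 where S2: "S2 \<in> F" "T = S2 \<inter> insert a K - {a}" "a \<in> S2" using T(2) by (auto simp: V_def tr_def)
    show "\<exists>S\<in>F. S \<inter> insert a B = W"
    proof (cases "a \<in> W")
      case True
      have "S2 \<inter> insert a B = W" using True S2 T(3) B(1) W insert(2) by auto
      then show ?thesis using S2(1) by blast
    next
      case False
      have "S1 \<inter> insert a B = W" using False S1 T(3) B(1) W insert(2) by auto
      then show ?thesis using S1(1) by blast
    qed
  qed
  define P where "P = {B. B \<subseteq> K \<and> shat F B}"
  define Q where "Q = {B. B \<subseteq> K \<and> shat (U \<inter> V) B}"
  have finPQ: "finite P" "finite Q" unfolding P_def Q_def using insert(1) by auto
  have "inj_on (insert a) Q" using insert(2) by (intro inj_onI) (auto simp: Q_def dest: insert_ident[THEN iffD1, rotated 2])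
  then have cQ: "card (insert a ` Q) = card Q" by (rule card_image)
  have "card tr \<le> card P + card (insert a ` Q)" using ctr c1 c2 cQ by (simp add: P_def Q_def)
  also have "\<dots> = card (P \<union> insert a ` Q)"
    using finPQ insert(2) by (intro card_Un_disjoint[symmetric]) (auto simp: P_def)
  also have "\<dots> \<le> card {B. B \<subseteq> insert a K \<and> shat F B}"
    using insert(1) sh by (intro card_mono) (auto simp: P_def Q_def)
  finally show ?case by (simp add: tr_def)
qed

text \<open>The crude bound \<open>card K choose i \<le> (k choose i) * card K ^ i\<close> completes
  the sum to a binomial expansion.\<close>

lemma card_small_subsets:
  assumes "finite K"
  shows "card {B. B \<subseteq> K \<and> card B < k} \<le> (card K + 1) ^ k"
proof -
  have "card {B. B \<subseteq> K \<and> card B < k} = card (\<Union>i\<in>{..<k}. {B. B \<subseteq> K \<and> card B = i})"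
    by (rule arg_cong[of _ _ card]) auto
  also have "\<dots> \<le> (\<Sum>i<k. card {B. B \<subseteq> K \<and> card B = i})" by (rule card_UN_le) simp
  also have "\<dots> = (\<Sum>i<k. card K choose i)" using assms by (simp add: n_subsets)
  also have "\<dots> \<le> (\<Sum>i<k. (k choose i) * card K ^ i)"
  proof (rule sum_mono)
    fix i assume "i \<in> {..<k}"
    then have "1 \<le> k choose i" by (simp add: Suc_leI)
    moreover have "card K choose i \<le> card K ^ i"
      by (cases "i \<le> card K") (auto simp: binomial_le_pow binomial_eq_0)
    ultimately show "card K choose i \<le> (k choose i) * card K ^ i"
      by (metis mult_le_mono mult_1)
  qed
  also have "\<dots> \<le> (\<Sum>i\<le>k. (k choose i) * card K ^ i)" by (intro sum_mono2) auto
  also have "\<dots> = (card K + 1) ^ k" using binomial[of "card K" 1 k] by simp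
  finally show ?thesis .
qed

lemma sauer:
  assumes "finite K" "\<And>B. B \<subseteq> K \<Longrightarrow> card B = k \<Longrightarrow> \<not> shat F B"
  shows "card ((\<lambda>S. S \<inter> K) ` F) \<le> (card K + 1) ^ k"
proof -
  have "{B. B \<subseteq> K \<and> shat F B} \<subseteq> {B. B \<subseteq> K \<and> card B < k}"
  proof clarify
    fix B assume B: "B \<subseteq> K" "shat F B"
    show "card B < k"
    proof (rule ccontr)
      assume "\<not> card B < k"
      then obtain C where C: "C \<subseteq> B" "card C = k" by (meson not_less obtain_subset_with_card_n)
      have "shat F C"
        unfolding shat_def
      proof (intro allI impI)
        fix W assume "W \<subseteq> C"
        then have "W \<subseteq> B" using C(1) by blast
        then obtain S where "S \<in> F" "S \<inter> B = W" using B(2) unfolding shat_def by blast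
        then have "S \<inter> C = W" using C(1) \<open>W \<subseteq> C\<close> by blast
        then show "\<exists>S\<in>F. S \<inter> C = W" using \<open>S \<in> F\<close> by blast
      qed
      then show False using assms(2)[of C] C B(1) by blast
    qed
  qed
  then have "card {B. B \<subseteq> K \<and> shat F B} \<le> card {B. B \<subseteq> K \<and> card B < k}"
    using assms(1) by (intro card_mono) auto
  then show ?thesis using pajor[OF assms(1), of F] card_small_subsets[OF assms(1), of k] by linarith
qed

text \<open>Provides the number \<open>s\<close> of groups for the epsilon-net: the groups together
  have at most \<open>c * s ^ 2\<close> points, and the left-hand side bounds the number of traces
  on them.\<close>

lemma exp_beats_poly: "\<exists>s>0. (c * s ^ 2 + 1) ^ k < (2::nat) ^ s"
proof -
  define r where "r = (k + 1) * (c + 5)"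
  define s where "s = (2::nat) ^ (2 * r)"
  have r1: "1 \<le> r" unfolding r_def by simp
  have "c * s ^ 2 + 1 \<le> 2 ^ (c + 4 * r + 1)"
  proof -
    have "c < 2 ^ c" by (rule less_exp)
    then have "c * s ^ 2 \<le> 2 ^ c * s ^ 2" by (intro mult_right_mono) simp_all
    also have "2 ^ c * s ^ 2 = 2 ^ (c + 4 * r)" unfolding s_def by (simp add: power_add flip: power_mult)
    finally have "c * s ^ 2 \<le> 2 ^ (c + 4 * r)" .
    moreover have "(1::nat) \<le> 2 ^ (c + 4 * r)" by simp
    moreover have "(2::nat) ^ (c + 4 * r + 1) = 2 ^ (c + 4 * r) + 2 ^ (c + 4 * r)" by simp
    ultimately show ?thesis by linarith
  qed
  then have "(c * s ^ 2 + 1) ^ k \<le> (2 ^ (c + 4 * r + 1)) ^ k" by (rule power_mono) simp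
  also have "\<dots> = 2 ^ ((c + 4 * r + 1) * k)" by (rule power_mult[symmetric])
  also have "\<dots> < 2 ^ s"
  proof (rule power_strict_increasing)
    have "(c + 4 * r + 1) * k \<le> (c + 1) * k + 4 * (r * k)" by (simp add: algebra_simps)
    also have "\<dots> \<le> r + 4 * (r * k)" unfolding r_def by (simp add: algebra_simps)
    also have "\<dots> \<le> r * (4 * k + 1)" by (simp add: algebra_simps)
    also have "\<dots> \<le> r * r" unfolding r_def by (rule mult_le_mono2) (simp add: algebra_simps)
    also have "\<dots> < (2 ^ r) * (2 ^ r)" using less_exp[of r] by (intro mult_strict_mono) auto
    also have "\<dots> = s" unfolding s_def by (simp add: mult_2 power_add)
    finally show "(c + 4 * r + 1) * k < s" .
  qed simp
  finally show ?thesis unfolding s_def by (intro exI[of _ "2 ^ (2 * r)"]) auto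
qed

text \<open>If every small set were missed by a large member of the family, a random choice of \<open>s\<close> groups
  would be separated by \<open>2 ^ s\<close> members of the family, one for each set of groups to be missed.\<close>

lemma eps_net:
  fixes \<epsilon> :: real
  assumes \<epsilon>: "0 < \<epsilon>"
  shows "\<exists>m. \<forall>(F :: 'y set set) ys. (\<forall>B\<subseteq>set ys. card B = k \<longrightarrow> \<not> shat F B) \<longrightarrow> ys \<noteq> [] \<longrightarrow>
    (\<exists>Q\<subseteq>set ys. card Q \<le> m \<and> (\<forall>S\<in>F. S \<inter> Q = {} \<longrightarrow> length (filter (\<lambda>y. y \<in> S) ys) < \<epsilon> * length ys))"
proof -
  \<comment> \<open>A smaller threshold is harmless, as large sets remain large; the cap 1/2 keeps
    \<open>1 - \<eta>\<close> positive.\<close>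
  define \<eta> where "\<eta> = min \<epsilon> (1 / 2)"
  have \<eta>: "0 < \<eta>" "\<eta> < 1" "\<eta> \<le> \<epsilon>" using \<epsilon> by (auto simp: \<eta>_def)
  \<comment> \<open>There are fewer than \<open>4 ^ s\<close> bad events below, each of probability
    at most \<open>(1 - \<eta>) ^ (c * s)\<close>, hence at most \<open>(1 / 4) ^ s\<close>.\<close>
  obtain c where c: "(1 - \<eta>) ^ c < 1 / 4" using real_arch_pow_inv[of "1 / 4" "1 - \<eta>"] \<eta> by auto
  obtain s where s: "s > 0" "(c * s ^ 2 + 1) ^ k < (2::nat) ^ s" using exp_beats_poly by blast
  define g where "g = c * s"
  show ?thesis
  proof (intro exI[of _ "s * g"] allI impI)
    fix F :: "'y set set" and ys :: "'y list"
    assume nsh: "\<forall>B\<subseteq>set ys. card B = k \<longrightarrow> \<not> shat F B" and ys: "ys \<noteq> []"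
    show "\<exists>Q\<subseteq>set ys. card Q \<le> s * g \<and> (\<forall>S\<in>F. S \<inter> Q = {} \<longrightarrow> length (filter (\<lambda>y. y \<in> S) ys) < \<epsilon> * length ys)"
    proof (rule ccontr)
      assume neg: "\<not> ?thesis"
      have "\<forall>Q. \<exists>S. Q \<subseteq> set ys \<and> card Q \<le> s * g \<longrightarrow>
        S \<in> F \<and> S \<inter> Q = {} \<and> \<epsilon> * length ys \<le> length (filter (\<lambda>y. y \<in> S) ys)"
        using neg by (meson not_le)
      then obtain sel where sel: "\<And>Q. Q \<subseteq> set ys \<Longrightarrow> card Q \<le> s * g \<Longrightarrow>
        sel Q \<in> F \<and> sel Q \<inter> Q = {} \<and> \<epsilon> * length ys \<le> length (filter (\<lambda>y. y \<in> sel Q) ys)"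
        by metis
      define N where "N = length ys"
      have N: "N > 0" using ys by (simp add: N_def)
      \<comment> \<open>An element of \<open>I\<close> is one group of \<open>g\<close> entries,
        drawn by position in \<open>ys\<close> so that multiplicities count.\<close>
      define I where "I = PiE {..<g} (\<lambda>_. {..<N})"
      have finI: "finite I" unfolding I_def by (intro finite_PiE) auto
      have neI: "I \<noteq> {}" unfolding I_def using N by (simp add: PiE_eq_empty_iff lessThan_empty_iff)
      have cI: "card I = N ^ g" unfolding I_def by (simp add: card_PiE)
      define pts where "pts v = (\<lambda>a. ys ! v a) ` {..<g}" for v :: "nat \<Rightarrow> nat"
      have pts: "pts v \<subseteq> set ys" "card (pts v) \<le> g" if "v \<in> I" for v
      proof -
        show "pts v \<subseteq> set ys" using that unfolding pts_def I_def N_def by (auto simp: PiE_iff)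
        show "card (pts v) \<le> g" unfolding pts_def by (metis card_image_le card_lessThan finite_lessThan)
      qed
      define Q where "Q u T = (\<Union>i\<in>T. pts (u i))" for u :: "nat \<Rightarrow> nat \<Rightarrow> nat" and T
      have Q: "Q u T \<subseteq> set ys" "card (Q u T) \<le> s * g" if "\<And>i. i \<in> T \<Longrightarrow> u i \<in> I" "T \<subseteq> {..<s}" for u T
      proof -
        show "Q u T \<subseteq> set ys" unfolding Q_def using pts(1) that(1) by blast
        have finT: "finite T" using that(2) finite_subset by blast
        have "card (Q u T) \<le> (\<Sum>i\<in>T. card (pts (u i)))" unfolding Q_def by (rule card_UN_le[OF finT])
        also have "\<dots> \<le> (\<Sum>i\<in>T. g)" using pts(2) that(1) by (intro sum_mono) blast
        also have "\<dots> \<le> s * g" using that(2) card_mono[of "{..<s}" T] by simp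
        finally show "card (Q u T) \<le> s * g" .
      qed
      define E where "E = (SIGMA T:Pow {..<s}. {..<s} - T)"
      have finE: "finite E" unfolding E_def by auto
      \<comment> \<open>The large member selected to miss the groups in \<open>fst e\<close> also
        misses the group \<open>snd e\<close>. This group is not among those in
        \<open>fst e\<close>, so it is independent of the selection.\<close>
      define B where "B e u \<longleftrightarrow> sel (Q u (fst e)) \<inter> pts (u (snd e)) = {}" for e :: "nat set \<times> nat" and u
      have "\<exists>u\<in>PiE {..<s} (\<lambda>_. I). \<forall>e\<in>E. \<not> B e u"
      proof (rule sample_avoid[OF finI neI finE])
        show "snd e < s" if "e \<in> E" for e using that by (auto simp: E_def)
        show "card {v\<in>I. B e (u(snd e := v))} \<le> (1 - \<eta>) ^ g * card I"
          if e: "e \<in> E" and u: "u \<in> PiE {..<s} (\<lambda>_. I)" for e u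
        proof -
          have ne: "snd e \<notin> fst e" and sub: "fst e \<subseteq> {..<s}" using e by (auto simp: E_def)
          define S where "S = sel (Q u (fst e))"
          have Qeq: "Q (u(snd e := v)) (fst e) = Q u (fst e)" for v
            unfolding Q_def using ne by (intro SUP_cong) auto
          have uI: "u i \<in> I" if "i \<in> fst e" for i using u sub that by (meson PiE_mem subsetD)
          have S: "\<epsilon> * N \<le> length (filter (\<lambda>y. y \<in> S) ys)"
            using sel[OF Q[OF uI sub]] by (simp add: S_def N_def)
          define J where "J = {i. i < N \<and> ys ! i \<notin> S}"
          have cJ: "card J \<le> (1 - \<eta>) * N"
          proof -
            have "card J = length (filter (\<lambda>y. y \<notin> S) ys)" by (simp add: J_def N_def length_filter_conv_card)
            moreover have "length (filter (\<lambda>y. y \<in> S) ys) + length (filter (\<lambda>y. y \<notin> S) ys) = N"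
              unfolding N_def by (rule sum_length_filter_compl)
            ultimately have "real (card J) = real N - real (length (filter (\<lambda>y. y \<in> S) ys))" by linarith
            also have "\<dots> \<le> N - \<epsilon> * N" using S by simp
            also have "\<dots> \<le> (1 - \<eta>) * N" using \<eta>(3) by (simp add: algebra_simps mult_right_mono)
            finally show ?thesis .
          qed
          have "{v\<in>I. B e (u(snd e := v))} \<subseteq> PiE {..<g} (\<lambda>_. J)"
            unfolding B_def Qeq by (auto simp: I_def J_def PiE_iff pts_def S_def extensional_def)
          moreover have "finite (PiE {..<g} (\<lambda>_. J))" by (intro finite_PiE) (auto simp: J_def)
          ultimately have "card {v\<in>I. B e (u(snd e := v))} \<le> card (PiE {..<g} (\<lambda>_. J))"
            by (intro card_mono)
          also have "\<dots> = card J ^ g" by (simp add: card_PiE)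
          finally have "real (card {v\<in>I. B e (u(snd e := v))}) \<le> real (card J) ^ g"
            by (metis of_nat_mono of_nat_power)
          also have "\<dots> \<le> ((1 - \<eta>) * N) ^ g" using cJ by (rule power_mono) simp
          also have "\<dots> = (1 - \<eta>) ^ g * card I" by (simp add: cI power_mult_distrib)
          finally show ?thesis .
        qed
        show "card E * (1 - \<eta>) ^ g < 1"
        proof -
          have "E \<subseteq> Pow {..<s} \<times> {..<s}" unfolding E_def by auto
          then have "card E \<le> card (Pow {..<s} \<times> {..<s})" by (intro card_mono) auto
          then have "card E \<le> 2 ^ s * s" by (simp add: card_cartesian_product card_Pow)
          then have "real (card E) \<le> real (2 ^ s * s)" by (rule of_nat_mono)
          then have "real (card E) \<le> 2 ^ s * real s" by simp
          moreover have "real s < 2 ^ s" using of_nat_less_two_power by blast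
          ultimately have "real (card E) < 2 ^ s * 2 ^ s" by (smt (verit) mult_less_cancel_left_pos zero_less_power)
          also have "(2 ^ s * 2 ^ s :: real) = 4 ^ s" by (simp flip: power_mult_distrib)
          finally have E4: "real (card E) < 4 ^ s" .
          have "(1 - \<eta>) ^ g = ((1 - \<eta>) ^ c) ^ s" unfolding g_def by (rule power_mult)
          also have "\<dots> \<le> (1 / 4) ^ s" using c \<eta> by (intro power_mono) auto
          finally have "card E * (1 - \<eta>) ^ g \<le> card E * (1 / 4) ^ s" by (intro mult_left_mono) auto
          also have "\<dots> < 4 ^ s * (1 / 4) ^ s" using E4 by (intro mult_strict_right_mono) auto
          also have "\<dots> = 1" by (simp add: power_one_over)
          finally show ?thesis .
        qed
      qed
      then obtain u where u: "u \<in> PiE {..<s} (\<lambda>_. I)" and nB: "\<forall>e\<in>E. \<not> B e u" ..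
      have uI: "u i \<in> I" if "i < s" for i using u that by auto
      define K where "K = Q u {..<s}"
      have K: "K \<subseteq> set ys" "card K \<le> s * g" unfolding K_def using Q[of "{..<s}" u] uI by auto
      have finK: "finite K" using K(1) finite_subset by blast
      define tr where "tr T = sel (Q u T) \<inter> K" for T
      have selT: "sel (Q u T) \<in> F \<and> sel (Q u T) \<inter> Q u T = {}" if "T \<subseteq> {..<s}" for T
        using sel[OF Q[of T u]] uI that by blast
      \<comment> \<open>A trace on \<open>K\<close> remembers which groups it misses, so the
        \<open>2 ^ s\<close> sets \<open>T\<close> give different traces.\<close>
      have tr: "tr T \<inter> pts (u i) = {} \<longleftrightarrow> i \<in> T" if T: "T \<subseteq> {..<s}" "i < s" for T i
      proof
        assume "i \<in> T"
        then have "pts (u i) \<subseteq> Q u T" by (auto simp: Q_def)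
        then show "tr T \<inter> pts (u i) = {}" unfolding tr_def using selT[OF T(1)] by blast
      next
        assume h: "tr T \<inter> pts (u i) = {}"
        show "i \<in> T"
        proof (rule ccontr)
          assume "i \<notin> T"
          then have "(T, i) \<in> E" using T by (simp add: E_def)
          then have "\<not> B (T, i) u" using nB by blast
          then have "sel (Q u T) \<inter> pts (u i) \<noteq> {}" by (simp add: B_def)
          moreover have "pts (u i) \<subseteq> K" unfolding K_def Q_def using T(2) by blast
          ultimately show False using h unfolding tr_def by blast
        qed
      qed
      have "inj_on tr (Pow {..<s})"
      proof (rule inj_onI)
        fix T T' assume T: "T \<in> Pow {..<s}" "T' \<in> Pow {..<s}" "tr T = tr T'"
        have "i \<in> T \<longleftrightarrow> i \<in> T'" if "i < s" for i
          using tr[of T i] tr[of T' i] T that by simp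
        then show "T = T'" using T by blast
      qed
      then have "2 ^ s = card (tr ` Pow {..<s})" by (simp add: card_image card_Pow)
      also have "\<dots> \<le> card ((\<lambda>S. S \<inter> K) ` F)"
      proof (rule card_mono)
        show "finite ((\<lambda>S. S \<inter> K) ` F)" by (rule finite_subset[of _ "Pow K"]) (use finK in auto)
        show "tr ` Pow {..<s} \<subseteq> (\<lambda>S. S \<inter> K) ` F" unfolding tr_def using selT by blast
      qed
      also have "\<dots> \<le> (card K + 1) ^ k"
        by (rule sauer[OF finK]) (use nsh K(1) in blast)
      also have "\<dots> \<le> (c * s ^ 2 + 1) ^ k"
        using K(2) by (intro power_mono) (simp_all add: g_def power2_eq_square algebra_simps)
      finally show False using s(2) by simp
    qed
  qed
qed

section \<open>Multiplicative weights\<close>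

text \<open>The weight of \<open>c\<close> after \<open>t\<close> rounds is \<open>2 ^ (t - r)\<close>, where \<open>r\<close> is the number of rounds in which
  \<open>c\<close> was hit, so that the total weight grows by a factor of at most \<open>2 - \<beta>\<close> in every round.\<close>

lemma weights_rounds:
  fixes R :: "'d \<Rightarrow> 'y \<Rightarrow> bool" and \<beta> :: real
  assumes F: "finite F" "F \<noteq> {}"
    and frac: "\<And>cs. cs \<noteq> [] \<Longrightarrow> set cs \<subseteq> F \<Longrightarrow> \<exists>d\<in>D. \<beta> * length cs \<le> length (filter (R d) cs)"
  shows "\<exists>ds. length ds = t \<and> set ds \<subseteq> D \<and>
    (\<Sum>c\<in>F. 2 ^ length (filter (\<lambda>d. \<not> R d c) ds)) \<le> (2 - \<beta>) ^ t * card F"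
proof (induct t)
  case 0
  show ?case by (intro exI[of _ "[]"]) simp
next
  case (Suc t)
  then obtain ds where ds: "length ds = t" "set ds \<subseteq> D"
    and W: "(\<Sum>c\<in>F. 2 ^ length (filter (\<lambda>d. \<not> R d c) ds)) \<le> (2 - \<beta>) ^ t * card F" by blast
  define w where "w c = (2::nat) ^ length (filter (\<lambda>d. \<not> R d c) ds)" for c
  obtain xs where xs: "set xs = F" "distinct xs" using F(1) finite_distinct_list by blast
  \<comment> \<open>Integer weights become multiplicities in a list, so that the hypothesis on lists
    applies to the weighted points.\<close>
  define cs where "cs = concat (map (\<lambda>c. replicate (w c) c) xs)"
  have cnt: "length (filter P cs) = (\<Sum>c\<in>F. if P c then w c else 0)" for P
  proof -
    have "length (filter P cs) = sum_list (map (\<lambda>c. if P c then w c else 0) xs)"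
      unfolding cs_def by (simp add: filter_concat length_concat comp_def filter_replicate if_distrib cong: if_cong)
    then show ?thesis using xs by (simp add: sum_list_distinct_conv_sum_set)
  qed
  have len: "length cs = (\<Sum>c\<in>F. w c)" using cnt[of "\<lambda>_. True"] by simp
  have "w c > 0" for c by (simp add: w_def)
  then have "set cs = F" unfolding cs_def using xs(1) by auto
  then obtain d where d: "d \<in> D" "\<beta> * length cs \<le> length (filter (R d) cs)"
    using frac[of cs] F(2) by fastforce
  have "(\<Sum>c\<in>F. (2::real) ^ length (filter (\<lambda>d. \<not> R d c) (d # ds))) =
    (\<Sum>c\<in>F. 2 * real (w c) - (if R d c then real (w c) else 0))"
    by (rule sum.cong) (auto simp: w_def)
  also have "\<dots> = 2 * (\<Sum>c\<in>F. real (w c)) - (\<Sum>c\<in>F. if R d c then real (w c) else 0)"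
    by (simp add: sum_subtractf sum_distrib_left)
  also have "(\<Sum>c\<in>F. if R d c then real (w c) else 0) = length (filter (R d) cs)"
    unfolding cnt by (simp add: of_nat_sum if_distrib cong: if_cong)
  also have "2 * (\<Sum>c\<in>F. real (w c)) - length (filter (R d) cs) \<le> (2 - \<beta>) * (\<Sum>c\<in>F. real (w c))"
    using d(2) len by (simp add: algebra_simps)
  also have "\<dots> \<le> (2 - \<beta>) * ((2 - \<beta>) ^ t * card F)"
  proof (rule mult_left_mono)
    show "(\<Sum>c\<in>F. real (w c)) \<le> (2 - \<beta>) ^ t * card F" using W by (simp add: w_def)
    have "\<beta> * length cs \<le> length cs" using d(2) by (meson length_filter_le of_nat_mono order_trans)
    moreover have "length cs > 0" using \<open>set cs = F\<close> F(2) by force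
    ultimately have "\<beta> \<le> 1" by simp
    then show "0 \<le> 2 - \<beta>" by simp
  qed
  finally have "(\<Sum>c\<in>F. 2 ^ length (filter (\<lambda>d. \<not> R d c) (d # ds))) \<le> (2 - \<beta>) ^ Suc t * card F" by simp
  then show ?case using ds d(1) by (intro exI[of _ "d # ds"]) auto
qed

text \<open>A finite substitute for the minimax theorem. A point missed in more than
  \<open>(1 - \<beta> / 4) * t\<close> rounds would alone have weight above
  \<open>2 powr ((1 - \<beta> / 4) * t)\<close>, which for large \<open>t\<close> exceeds the bound
  \<open>(2 - \<beta>) ^ t * card F\<close> on the total weight.\<close>

lemma weights_majority:
  fixes R :: "'d \<Rightarrow> 'y \<Rightarrow> bool" and \<beta> :: real
  assumes F: "finite F" "F \<noteq> {}" and \<beta>: "0 < \<beta>" "\<beta> \<le> 1"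
    and frac: "\<And>cs. cs \<noteq> [] \<Longrightarrow> set cs \<subseteq> F \<Longrightarrow> \<exists>d\<in>D. \<beta> * length cs \<le> length (filter (R d) cs)"
  shows "\<exists>ds. ds \<noteq> [] \<and> set ds \<subseteq> D \<and> (\<forall>c\<in>F. \<beta> / 4 * length ds \<le> length (filter (\<lambda>d. R d c) ds))"
proof -
  define r where "r = (2 - \<beta>) / 2 powr (1 - \<beta> / 4)"
  \<comment> \<open>The factor 1/4 leaves enough slack:
    \<open>2 powr (1 - \<beta> / 4) \<ge> 2 - \<beta> / 2 > 2 - \<beta>\<close>, by
    \<open>exp x \<ge> 1 + x\<close> and \<open>ln 2 \<le> 1\<close>.\<close>
  have "r < 1"
  proof -
    have "ln 2 \<le> (1::real)" using ln_le_minus_one[of 2] by simp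
    then have "\<beta> / 4 * ln 2 \<le> \<beta> / 4" using \<beta> by (simp add: mult_left_le)
    then have "1 - \<beta> / 4 \<le> 1 + (- (\<beta> / 4) * ln 2)" by simp
    also have "\<dots> \<le> exp (- (\<beta> / 4) * ln 2)" by (rule exp_ge_add_one_self)
    also have "\<dots> = 2 powr (- (\<beta> / 4))" by (simp add: powr_def)
    finally have "2 * (1 - \<beta> / 4) \<le> 2 powr (1 - \<beta> / 4)" using powr_add[of 2 1 "- (\<beta> / 4)"] by simp
    then have "2 - \<beta> < 2 powr (1 - \<beta> / 4)" using \<beta> by simp
    then show ?thesis unfolding r_def by (simp add: divide_less_eq)
  qed
  moreover have r0: "0 < r" unfolding r_def using \<beta> by simp
  ultimately obtain t where t: "r ^ t < 1 / card F" using real_arch_pow_inv[of "1 / card F" r] F by (auto simp: card_gt_0_iff)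
  have cF: "card F > 0" using F by (simp add: card_gt_0_iff)
  have t0: "t > 0"
  proof (rule ccontr)
    assume "\<not> t > 0"
    then have "1 < 1 / real (card F)" using t by simp
    then show False using cF by (simp add: less_divide_eq)
  qed
  obtain ds where ds: "length ds = t" "set ds \<subseteq> D"
    "(\<Sum>c\<in>F. 2 ^ length (filter (\<lambda>d. \<not> R d c) ds)) \<le> (2 - \<beta>) ^ t * card F"
    using weights_rounds[where R = R and D = D and \<beta> = \<beta> and t = t, OF F frac] by blast
  have "\<beta> / 4 * length ds \<le> length (filter (\<lambda>d. R d c) ds)" if c: "c \<in> F" for c
  proof (rule ccontr)
    define a where "a = length (filter (\<lambda>d. \<not> R d c) ds)"
    assume neg: "\<not> ?thesis"
    have "length (filter (\<lambda>d. R d c) ds) + a = t" unfolding a_def ds(1)[symmetric] by (rule sum_length_filter_compl)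
    then have "real (length (filter (\<lambda>d. R d c) ds)) + real a = t" by linarith
    then have "(1 - \<beta> / 4) * t < a" using neg ds(1) by (simp add: algebra_simps)
    then have "2 powr ((1 - \<beta> / 4) * t) < 2 powr a" by simp
    then have "(2 powr (1 - \<beta> / 4)) ^ t < 2 ^ a" by (simp add: powr_powr[symmetric] powr_realpow)
    also have "(2::real) ^ a \<le> (\<Sum>c\<in>F. 2 ^ length (filter (\<lambda>d. \<not> R d c) ds))"
      unfolding a_def using F(1) c by (intro member_le_sum) auto
    also have "\<dots> \<le> (2 - \<beta>) ^ t * card F" by (rule ds(3))
    finally have "(2 powr (1 - \<beta> / 4)) ^ t < (2 - \<beta>) ^ t * card F" .
    then have "1 < r ^ t * card F" unfolding r_def by (simp add: power_divide divide_simps)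
    moreover have "r ^ t * card F < 1" using t cF by (simp add: field_simps)
    ultimately show False by simp
  qed
  then show ?thesis using ds t0 by (intro exI[of _ ds]) auto
qed

section \<open>Definable relations\<close>

text \<open>\<open>DD\<close> is a collection of relations on \<open>Y\<close>, written as predicates on sequences of elements of \<open>Y\<close>
  that depend on finitely many entries. It plays the role of the relations definable with parameters.\<close>

locale definable =
  fixes Y :: "'y set" and DD :: "((nat \<Rightarrow> 'y) \<Rightarrow> bool) set"
  assumes DD_ne: "DD \<noteq> {}"
    and DD_cong: "\<lbrakk>P \<in> DD; \<And>e. range e \<subseteq> Y \<Longrightarrow> Q e \<longleftrightarrow> P e\<rbrakk> \<Longrightarrow> Q \<in> DD"
    and DD_not: "P \<in> DD \<Longrightarrow> (\<lambda>e. \<not> P e) \<in> DD"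
    and DD_conj: "\<lbrakk>P \<in> DD; Q \<in> DD\<rbrakk> \<Longrightarrow> (\<lambda>e. P e \<and> Q e) \<in> DD"
    and DD_ex: "P \<in> DD \<Longrightarrow> (\<lambda>e. \<exists>b\<in>Y. P (e(i := b))) \<in> DD"
    and DD_subst: "\<lbrakk>P \<in> DD; \<And>m. \<sigma> m \<in> range Inl \<union> Inr ` Y\<rbrakk> \<Longrightarrow>
      (\<lambda>e. P (\<lambda>m. case_sum e id (\<sigma> m))) \<in> DD"
    and DD_fin: "P \<in> DD \<Longrightarrow>
      \<exists>n. \<forall>e e'. range e \<subseteq> Y \<longrightarrow> range e' \<subseteq> Y \<longrightarrow> (\<forall>i<n. e i = e' i) \<longrightarrow> P e \<longrightarrow> P e'"
begin

definition U :: "(nat \<Rightarrow> 'y) set" where "U = {e. range e \<subseteq> Y}"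

lemma U_iff: "e \<in> U \<longleftrightarrow> (\<forall>i. e i \<in> Y)"
  by (auto simp: U_def)

lemma DD_congU: assumes "P \<in> DD" "\<And>e. e \<in> U \<Longrightarrow> Q e \<longleftrightarrow> P e" shows "Q \<in> DD"
  by (rule DD_cong[OF assms(1)]) (simp add: assms(2) U_def)

lemma DD_const: "(\<lambda>e. c) \<in> DD"
proof -
  obtain P where "P \<in> DD" using DD_ne by blast
  then have "(\<lambda>e. P e \<and> \<not> P e) \<in> DD" by (intro DD_conj DD_not)
  then have F: "(\<lambda>e. False) \<in> DD" by simp
  from DD_not[OF F] F show ?thesis by (cases c) simp_all
qed

lemma DD_disj: assumes "P \<in> DD" "Q \<in> DD" shows "(\<lambda>e. P e \<or> Q e) \<in> DD"
  using DD_not[OF DD_conj[OF DD_not[OF assms(1)] DD_not[OF assms(2)]]] by simp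

lemma DD_iff_const: assumes "P \<in> DD" shows "(\<lambda>e. P e \<longleftrightarrow> c) \<in> DD"
  using assms DD_not[OF assms] by (cases c) simp_all

lemma DD_ball: "\<lbrakk>finite I; \<And>i. i \<in> I \<Longrightarrow> P i \<in> DD\<rbrakk> \<Longrightarrow> (\<lambda>e. \<forall>i\<in>I. P i e) \<in> DD"
  by (induct rule: finite_induct) (simp_all add: DD_const DD_conj)

lemma DD_bex: "\<lbrakk>finite I; \<And>i. i \<in> I \<Longrightarrow> P i \<in> DD\<rbrakk> \<Longrightarrow> (\<lambda>e. \<exists>i\<in>I. P i e) \<in> DD"
  by (induct rule: finite_induct) (simp_all add: DD_const DD_disj)

lemma DD_reindex: assumes "P \<in> DD" shows "(\<lambda>e. P (\<lambda>m. e (\<sigma> m))) \<in> DD"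
  using DD_subst[OF assms, of "\<lambda>m. Inl (\<sigma> m)"] by simp

lemma DD_exs_finite:
  assumes "P \<in> DD" "finite J"
  shows "(\<lambda>e. \<exists>h\<in>U. P (override_on e h J)) \<in> DD"
  using assms(2)
proof induct
  case empty
  show ?case
  proof (cases "U = {}")
    case True
    then show ?thesis by (simp add: DD_const)
  next
    case False
    then show ?thesis using assms(1) by (simp add: ex_in_conv[symmetric] del: ex_in_conv)
  qed
next
  case (insert i J)
  have "(\<lambda>e. \<exists>b\<in>Y. \<exists>h\<in>U. P (override_on (e(i := b)) h J)) \<in> DD" by (rule DD_ex[OF insert(3)])
  then show ?case
  proof (rule DD_congU)
    fix e assume "e \<in> U"
    show "(\<exists>h\<in>U. P (override_on e h (insert i J))) \<longleftrightarrow> (\<exists>b\<in>Y. \<exists>h\<in>U. P (override_on (e(i := b)) h J))"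
    proof
      assume "\<exists>h\<in>U. P (override_on e h (insert i J))"
      then obtain h where h: "h \<in> U" "P (override_on e h (insert i J))" by blast
      have "override_on e h (insert i J) = override_on (e(i := h i)) h J"
        using insert(2) by (auto simp: override_on_def)
      then show "\<exists>b\<in>Y. \<exists>h\<in>U. P (override_on (e(i := b)) h J)" using h by (metis U_iff)
    next
      assume "\<exists>b\<in>Y. \<exists>h\<in>U. P (override_on (e(i := b)) h J)"
      then obtain b h where h: "b \<in> Y" "h \<in> U" "P (override_on (e(i := b)) h J)" by blast
      have "override_on e (h(i := b)) (insert i J) = override_on (e(i := b)) h J"
        using insert(2) by (auto simp: override_on_def)
      moreover have "h(i := b) \<in> U" using h by (simp add: U_iff)
      ultimately show "\<exists>h\<in>U. P (override_on e h (insert i J))" using h(3) by metis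
    qed
  qed
qed

text \<open>By \<open>DD_fin\<close> only finitely many entries matter, so quantifying a possibly
  infinite set of entries reduces to finitely many quantifiers.\<close>

lemma DD_exs:
  assumes "P \<in> DD"
  shows "(\<lambda>e. \<exists>h\<in>U. P (override_on e h I)) \<in> DD"
proof -
  obtain n where n: "\<And>e e'. e \<in> U \<Longrightarrow> e' \<in> U \<Longrightarrow> (\<forall>i<n. e i = e' i) \<Longrightarrow> P e \<Longrightarrow> P e'"
    using DD_fin[OF assms] unfolding U_def by blast
  have "(\<lambda>e. \<exists>h\<in>U. P (override_on e h (I \<inter> {..<n}))) \<in> DD" by (rule DD_exs_finite[OF assms]) simp
  then show ?thesis
  proof (rule DD_congU)
    fix e assume e: "e \<in> U"
    have "P (override_on e h I) \<longleftrightarrow> P (override_on e h (I \<inter> {..<n}))" if h: "h \<in> U" for h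
    proof -
      have "override_on e h I \<in> U" "override_on e h (I \<inter> {..<n}) \<in> U"
        using e h by (auto simp: U_iff override_on_def)
      moreover have "\<forall>i<n. override_on e h I i = override_on e h (I \<inter> {..<n}) i"
        by (auto simp: override_on_def)
      ultimately show ?thesis using n by (metis (no_types, lifting))
    qed
    then show "(\<exists>h\<in>U. P (override_on e h I)) \<longleftrightarrow> (\<exists>h\<in>U. P (override_on e h (I \<inter> {..<n})))" by blast
  qed
qed

definition dset :: "'y set \<Rightarrow> bool" where
  "dset \<theta> \<longleftrightarrow> \<theta> \<subseteq> Y \<and> (\<lambda>e. e 0 \<in> \<theta>) \<in> DD"

lemma dset_coord: "dset \<theta> \<Longrightarrow> (\<lambda>e. e i \<in> \<theta>) \<in> DD"
  unfolding dset_def using DD_reindex[of "\<lambda>e. e 0 \<in> \<theta>" "\<lambda>_. i"] by simp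

lemma dset_section:
  assumes "P \<in> DD" "e \<in> U"
  shows "dset {b\<in>Y. P (e(k := b))}"
proof -
  have "(\<lambda>e'. P (\<lambda>m. case_sum e' id (if m = k then Inl 0 else Inr (e m)))) \<in> DD"
    using assms(2) by (intro DD_subst[OF assms(1)]) (auto simp: U_iff)
  then have "(\<lambda>e'. e' 0 \<in> {b\<in>Y. P (e(k := b))}) \<in> DD"
  proof (rule DD_congU)
    fix e' assume "e' \<in> U"
    moreover have "(\<lambda>m. case_sum e' id (if m = k then Inl 0 else Inr (e m))) = e(k := e' 0)" by auto
    ultimately show "e' 0 \<in> {b\<in>Y. P (e(k := b))} \<longleftrightarrow>
        P (\<lambda>m. case_sum e' id (if m = k then Inl 0 else Inr (e m)))"
      by (simp add: U_iff)
  qed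
  then show ?thesis unfolding dset_def by auto
qed

lemma dset_Int: "dset \<theta> \<Longrightarrow> dset \<theta>' \<Longrightarrow> dset (\<theta> \<inter> \<theta>')"
  unfolding dset_def using DD_conj[of "\<lambda>e. e 0 \<in> \<theta>" "\<lambda>e. e 0 \<in> \<theta>'"] by auto

lemma dset_Diff: "dset \<theta> \<Longrightarrow> dset (Y - \<theta>)"
proof -
  assume "dset \<theta>"
  then have "(\<lambda>e. e 0 \<notin> \<theta>) \<in> DD" unfolding dset_def using DD_not by blast
  then have "(\<lambda>e. e 0 \<in> Y - \<theta>) \<in> DD" by (rule DD_congU) (simp add: U_iff)
  then show ?thesis by (simp add: dset_def)
qed

lemma dset_Y: "dset Y"
  unfolding dset_def by (auto intro: DD_congU[OF DD_const[of True]] simp: U_iff)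

text \<open>A relation between \<open>A\<close> and \<open>Y\<close> is tame if quantifiers over \<open>A\<close> do not lead out of \<open>DD\<close>.\<close>

definition tame :: "('x \<Rightarrow> 'y \<Rightarrow> bool) \<Rightarrow> 'x set \<Rightarrow> bool" where
  "tame \<phi> A \<longleftrightarrow> (\<forall>m S. (\<lambda>e. \<exists>x\<in>A. \<forall>i<m. \<phi> x (e i) \<longleftrightarrow> i \<in> S) \<in> DD)"

text \<open>The truth pattern of \<open>m\<close> instances takes finitely many values, so any
  condition \<beta> on the pattern may stand under the quantifier. The map \<sigma> decides which
  instances have variables and which have parameters.\<close>

lemma tame_ex:
  fixes \<sigma> :: "nat \<Rightarrow> nat + 'y"
  assumes t: "tame \<phi> A" and \<sigma>: "\<And>m. \<sigma> m \<in> range Inl \<union> Inr ` Y"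
  shows "(\<lambda>e. \<exists>x\<in>A. \<beta> {i. i < m \<and> \<phi> x (case_sum e id (\<sigma> i))}) \<in> DD"
proof -
  define P where "P S e \<longleftrightarrow> (\<exists>x\<in>A. \<forall>i<m. \<phi> x (e i) \<longleftrightarrow> i \<in> S)" for S and e :: "nat \<Rightarrow> 'y"
  have P: "P S \<in> DD" for S using t unfolding tame_def P_def by blast
  have "(\<lambda>e. \<exists>S\<in>{S. S \<subseteq> {..<m} \<and> \<beta> S}. P S (\<lambda>i. case_sum e id (\<sigma> i))) \<in> DD"
    by (intro DD_bex DD_subst P \<sigma>) simp
  then show ?thesis
  proof (rule DD_congU)
    fix e :: "nat \<Rightarrow> 'y"
    let ?v = "\<lambda>i. case_sum e id (\<sigma> i)"
    show "(\<exists>x\<in>A. \<beta> {i. i < m \<and> \<phi> x (?v i)}) \<longleftrightarrow> (\<exists>S\<in>{S. S \<subseteq> {..<m} \<and> \<beta> S}. P S ?v)"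
    proof
      assume "\<exists>x\<in>A. \<beta> {i. i < m \<and> \<phi> x (?v i)}"
      then obtain x where x: "x \<in> A" "\<beta> {i. i < m \<and> \<phi> x (?v i)}" by blast
      then have "P {i. i < m \<and> \<phi> x (?v i)} ?v" unfolding P_def by auto
      then show "\<exists>S\<in>{S. S \<subseteq> {..<m} \<and> \<beta> S}. P S ?v"
        using x(2) by (intro bexI[of _ "{i. i < m \<and> \<phi> x (?v i)}"]) auto
    next
      assume "\<exists>S\<in>{S. S \<subseteq> {..<m} \<and> \<beta> S}. P S ?v"
      then obtain S x where S: "S \<subseteq> {..<m}" "\<beta> S" "x \<in> A" "\<forall>i<m. \<phi> x (?v i) \<longleftrightarrow> i \<in> S"
        unfolding P_def by blast
      have "{i. i < m \<and> \<phi> x (?v i)} = S" using S(1,4) by auto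
      then show "\<exists>x\<in>A. \<beta> {i. i < m \<and> \<phi> x (?v i)}" using S by metis
    qed
  qed
qed

lemma tame_all:
  fixes \<sigma> :: "nat \<Rightarrow> nat + 'y"
  assumes "tame \<phi> A" "\<And>m. \<sigma> m \<in> range Inl \<union> Inr ` Y"
  shows "(\<lambda>e. \<forall>x\<in>A. \<beta> {i. i < m \<and> \<phi> x (case_sum e id (\<sigma> i))}) \<in> DD"
  using DD_not[OF tame_ex[OF assms, of "\<lambda>S. \<not> \<beta> S" m]] by simp

lemma tame_all':
  assumes "tame \<phi> A"
  shows "(\<lambda>e. \<forall>x\<in>A. \<beta> {i. i < m \<and> \<phi> x (e i)}) \<in> DD"
  using tame_all[OF assms, of "\<lambda>i. Inl i" \<beta> m] by simp

lemma tame_sub: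
  assumes t: "tame \<phi> A" and c: "c \<in> U"
  shows "tame \<phi> {x\<in>A. \<beta> {i. i < k \<and> \<phi> x (c i)}}"
  unfolding tame_def
proof (intro allI)
  fix m S
  \<comment> \<open>The first \<open>m\<close> slots are the variables; the parameters that define
    the subset follow in the next \<open>k\<close> slots.\<close>
  define \<sigma> where "\<sigma> i = (if i < m then Inl i else Inr (c (i - m)))" for i
  define \<gamma> where "\<gamma> T \<longleftrightarrow> \<beta> {i. i < k \<and> i + m \<in> T} \<and> (\<forall>i<m. i \<in> T \<longleftrightarrow> i \<in> S)" for T
  have "(\<lambda>e. \<exists>x\<in>A. \<gamma> {i. i < m + k \<and> \<phi> x (case_sum e id (\<sigma> i))}) \<in> DD"
    by (rule tame_ex[OF t]) (use c in \<open>auto simp: \<sigma>_def U_iff\<close>)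
  then show "(\<lambda>e. \<exists>x\<in>{x\<in>A. \<beta> {i. i < k \<and> \<phi> x (c i)}}. \<forall>i<m. \<phi> x (e i) \<longleftrightarrow> i \<in> S) \<in> DD"
  proof (rule DD_congU)
    fix e :: "nat \<Rightarrow> 'y"
    have 1: "{i. i < k \<and> i + m \<in> {i. i < m + k \<and> \<phi> x (case_sum e id (\<sigma> i))}} = {i. i < k \<and> \<phi> x (c i)}" for x
      by (auto simp: \<sigma>_def)
    have 2: "i \<in> {i. i < m + k \<and> \<phi> x (case_sum e id (\<sigma> i))} \<longleftrightarrow> \<phi> x (e i)" if "i < m" for i x
      using that by (simp add: \<sigma>_def)
    show "(\<exists>x\<in>{x\<in>A. \<beta> {i. i < k \<and> \<phi> x (c i)}}. \<forall>i<m. \<phi> x (e i) \<longleftrightarrow> i \<in> S) \<longleftrightarrow>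
      (\<exists>x\<in>A. \<gamma> {i. i < m + k \<and> \<phi> x (case_sum e id (\<sigma> i))})"
      unfolding \<gamma>_def 1 using 2 by blast
  qed
qed

end

section \<open>Amplification\<close>

text \<open>The ultrafilter measures all subsets of \<open>Y\<close>, because iterating it produces
  sets that need not be definable; \<open>inP\<close> will single out its definable members.\<close>

locale definable_type = definable Y DD for Y :: "'y set" and DD +
  fixes p :: "('y \<Rightarrow> bool) \<Rightarrow> bool"
  assumes ultra_p: "ultra p" and p_Y: "p (\<lambda>b. b \<in> Y)"
begin

definition inP :: "'y set \<Rightarrow> bool" where
  "inP \<theta> \<longleftrightarrow> dset \<theta> \<and> p (\<lambda>b. b \<in> \<theta>)"

lemma inP_sub: "inP \<theta> \<Longrightarrow> \<theta> \<subseteq> Y"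
  by (simp add: inP_def dset_def)

lemma inP_Y: "inP Y"
  by (simp add: inP_def dset_Y p_Y)

lemma inP_Int: "inP \<theta> \<Longrightarrow> inP \<theta>' \<Longrightarrow> inP (\<theta> \<inter> \<theta>')"
  using ultra_conj[OF ultra_p, of "\<lambda>b. b \<in> \<theta>" "\<lambda>b. b \<in> \<theta>'"] by (simp add: inP_def dset_Int)

lemma inP_INT: "finite T \<Longrightarrow> (\<And>t. t \<in> T \<Longrightarrow> inP (\<theta> t)) \<Longrightarrow> inP (Y \<inter> (\<Inter>t\<in>T. \<theta> t))"
proof (induct rule: finite_induct)
  case empty
  show ?case by (simp add: inP_Y)
next
  case (insert t T)
  have "Y \<inter> (\<Inter>t\<in>insert t T. \<theta> t) = \<theta> t \<inter> (Y \<inter> (\<Inter>t\<in>T. \<theta> t))" by auto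
  then show ?case using insert inP_Int by simp
qed

lemma Y_ne: "\<exists>y. y \<in> Y"
  using ultra_ex[OF ultra_p p_Y] .

lemma inP_ne: "inP \<theta> \<Longrightarrow> \<exists>y. y \<in> \<theta>"
  unfolding inP_def using ultra_ex[OF ultra_p] by blast

text \<open>These are the large sets. Repetitions in \<open>b\<close> are allowed, so consistency to
  order \<open>n\<close> includes the smaller orders.\<close>

definition con :: "('x \<Rightarrow> 'y \<Rightarrow> bool) \<Rightarrow> 'x set \<Rightarrow> bool" where
  "con \<phi> A \<longleftrightarrow> (\<forall>n. \<exists>\<theta>. inP \<theta> \<and> (\<forall>b :: nat \<Rightarrow> 'y. (\<forall>i<n. b i \<in> \<theta>) \<longrightarrow> (\<exists>x\<in>A. \<forall>i<n. \<phi> x (b i))))"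

end

lemma ultra_cong: assumes "ultra F" "F G" "\<And>x. G x \<Longrightarrow> P x \<longleftrightarrow> Q x" shows "F P \<longleftrightarrow> F Q"
  using ultra_mono[OF assms(1), of "\<lambda>x. P x \<and> G x" Q] ultra_mono[OF assms(1), of "\<lambda>x. Q x \<and> G x" P]
    ultra_conj[OF assms(1)] assms(2,3) by blast

lemma length_filter_concat: "length (filter P (concat xss)) = sum_list (map (\<lambda>xs. length (filter P xs)) xss)"
  by (simp add: filter_concat length_concat comp_def)

lemma length_filter_concat_upt:
  "length (filter P (concat (map (\<lambda>e. map (g e) [0..<L]) es))) = (\<Sum>l<L. length (filter (\<lambda>e. P (g e l)) es))"
proof (induct es)
  case Nil
  show ?case by simp
next
  case (Cons e es)
  have "length (filter P (map (g e) [0..<L])) = (\<Sum>l<L. if P (g e l) then 1 else 0)"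
    by (induct L) auto
  then show ?case using Cons by (simp add: sum.distrib[symmetric] cong: if_cong) (rule sum.cong, auto)
qed

lemma length_filter_upt: "length (filter P [0..<L]) = card {l. l < L \<and> P l}"
  by (subst length_filter_conv_card) (rule arg_cong[of _ _ card], auto)

section \<open>Iterated products of ultrafilters\<close>

definition upd :: "nat \<Rightarrow> nat \<Rightarrow> (nat \<Rightarrow> 'y) \<Rightarrow> (nat \<Rightarrow> 'y) \<Rightarrow> nat \<Rightarrow> 'y" where
  "upd N l f e m = (if m div N = l then f (m mod N) else e m)"

text \<open>The \<open>j\<close>-fold product of \<open>F\<close>, with one factor for each block of
  length \<open>N\<close>. Block \<open>j - 1\<close> is drawn outermost, and the entries beyond the
  first \<open>j\<close> blocks come from \<open>e\<close>.\<close>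

primrec fprod :: "(((nat \<Rightarrow> 'y) \<Rightarrow> bool) \<Rightarrow> bool) \<Rightarrow> nat \<Rightarrow> nat \<Rightarrow> ((nat \<Rightarrow> 'y) \<Rightarrow> bool) \<Rightarrow> (nat \<Rightarrow> 'y) \<Rightarrow> bool" where
  "fprod F N 0 E e = E e"
| "fprod F N (Suc j) E e = F (\<lambda>f. fprod F N j E (upd N j f e))"

primrec pw :: "(('y \<Rightarrow> bool) \<Rightarrow> bool) \<Rightarrow> nat \<Rightarrow> ((nat \<Rightarrow> 'y) \<Rightarrow> bool) \<Rightarrow> (nat \<Rightarrow> 'y) \<Rightarrow> bool" where
  "pw p 0 G u = G u"
| "pw p (Suc j) G u = p (\<lambda>a. pw p j G (u(j := a)))"

lemma ultra_fprod: assumes "ultra F" shows "ultra (\<lambda>E. fprod F N j E e)"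
proof (induct j arbitrary: e)
  case 0
  show ?case by (simp add: ultra_def)
next
  case (Suc j)
  show ?case unfolding ultra_def
    by (simp add: ultra_conj[OF Suc] ultra_not[OF Suc] ultra_conj[OF assms] ultra_not[OF assms])
qed

lemma ultra_pw: assumes "ultra p" shows "ultra (\<lambda>G. pw p j G u)"
proof (induct j arbitrary: u)
  case 0
  show ?case by (simp add: ultra_def)
next
  case (Suc j)
  show ?case unfolding ultra_def
    by (simp add: ultra_conj[OF Suc] ultra_not[OF Suc] ultra_conj[OF assms] ultra_not[OF assms] del: fun_upd_apply)
qed

lemma fprod_indep:
  assumes "ultra F" "\<And>f l e. l < j \<Longrightarrow> Q (upd N l f e) \<longleftrightarrow> Q e"
  shows "fprod F N j Q e \<longleftrightarrow> Q e"
  using assms(2)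
proof (induct j arbitrary: e)
  case (Suc j)
  then show ?case by (simp add: ultra_const[OF assms(1)])
qed simp

text \<open>Entries of index greater than \<open>n\<close> are ignored: a block of length \<open>n + 1\<close> is read as an \<open>(n + 1)\<close>-tuple.\<close>

definition blk :: "nat \<Rightarrow> nat \<Rightarrow> (nat \<Rightarrow> 'y) \<Rightarrow> nat \<Rightarrow> 'y" where
  "blk n l e i = e (l * Suc n + min i n)"

lemma blk_upd: "blk n l (upd (Suc n) j f e) = (if l = j then (\<lambda>i. f (min i n)) else blk n l e)"
proof
  fix i
  have "min i n < Suc n" by simp
  then have "(l * Suc n + min i n) div Suc n = l" "(l * Suc n + min i n) mod Suc n = min i n"
    by (simp_all del: mult_Suc_right)
  then show "blk n l (upd (Suc n) j f e) i = (if l = j then (\<lambda>i. f (min i n)) else blk n l e) i"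
    by (simp add: blk_def upd_def del: mult_Suc_right)
qed

context definable_type
begin

lemma pw_Y: "pw p L (\<lambda>u. \<forall>l<L. u l \<in> Y) u"
proof -
  have "pw p j (\<lambda>u. \<forall>l<L. u l \<in> Y) u" if "j \<le> L" "\<forall>l. j \<le> l \<longrightarrow> l < L \<longrightarrow> u l \<in> Y" for j u
    using that
  proof (induct j arbitrary: u)
    case (Suc j)
    have "pw p j (\<lambda>u. \<forall>l<L. u l \<in> Y) (u(j := a))" if "a \<in> Y" for a
    proof (rule Suc(1))
      show "j \<le> L" using Suc(2) by simp
      show "\<forall>l. j \<le> l \<longrightarrow> l < L \<longrightarrow> (u(j := a)) l \<in> Y" using Suc(3) that by (auto simp: Suc_le_eq)
    qed
    then show ?case using ultra_mono[OF ultra_p p_Y] by simp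
  qed simp
  from this[of L u] show ?thesis by simp
qed

text \<open>The order of the quantifiers matters: \<open>w\<close>, the entry at \<open>n\<close>,
  is drawn before \<open>c\<close>, the entry at \<open>k\<close>.\<close>

definition marg :: "(((nat \<Rightarrow> 'y) \<Rightarrow> bool) \<Rightarrow> bool) \<Rightarrow> nat \<Rightarrow> nat \<Rightarrow> bool" where
  "marg F k n \<longleftrightarrow> (\<forall>B. F (\<lambda>f. B (f k) (f n)) \<longleftrightarrow> p (\<lambda>w. p (\<lambda>c. B c w)))"

lemma marg_single:
  assumes "marg F k n"
  shows "F (\<lambda>f. g (f k)) \<longleftrightarrow> p g" "F (\<lambda>f. g (f n)) \<longleftrightarrow> p g"
  using assms[unfolded marg_def, rule_format, of "\<lambda>c w. g c"] assms[unfolded marg_def, rule_format, of "\<lambda>c w. g w"]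
  by (simp_all add: ultra_const[OF ultra_p])

text \<open>Whichever of the two coordinates is read in a block, its distribution is
  \<open>p\<close>. The inner iterate of \<open>p\<close> need not be a definable condition on this
  entry, even for definable \<open>G\<close>; hence the marginals have to agree with
  \<open>p\<close> on all sets.\<close>

lemma fprod_pick:
  assumes m: "marg F k n" and kn: "k < n" and pos: "\<And>l. pos l = k \<or> pos l = n"
  shows "fprod F (Suc n) L (\<lambda>e. G (\<lambda>l. blk n l e (pos l))) e0 \<longleftrightarrow> pw p L G (\<lambda>l. blk n l e0 (pos l))"
proof (induct L arbitrary: e0)
  case (Suc L)
  have eq: "(\<lambda>l. blk n l (upd (Suc n) L f e0) (pos l)) = (\<lambda>l. blk n l e0 (pos l))(L := f (pos L))" for f
  proof
    fix l
    have "min (pos L) n = pos L" using pos[of L] kn by auto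
    then show "blk n l (upd (Suc n) L f e0) (pos l) = ((\<lambda>l. blk n l e0 (pos l))(L := f (pos L))) l"
      by (simp add: blk_upd)
  qed
  have "fprod F (Suc n) (Suc L) (\<lambda>e. G (\<lambda>l. blk n l e (pos l))) e0 \<longleftrightarrow>
      F (\<lambda>f. pw p L G ((\<lambda>l. blk n l e0 (pos l))(L := f (pos L))))"
    by (simp add: Suc eq)
  also have "\<dots> \<longleftrightarrow> p (\<lambda>a. pw p L G ((\<lambda>l. blk n l e0 (pos l))(L := a)))"
    using pos[of L] marg_single[OF m, of "\<lambda>a. pw p L G ((\<lambda>l. blk n l e0 (pos l))(L := a))"] by auto
  finally show ?case by simp
qed simp

text \<open>Otherwise \<open>k0\<close> independent samples from \<open>p\<close> would be shattered, because the projection of \<open>F\<close> to the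
  coordinates \<open>k\<close> and \<open>n\<close> is the product of \<open>p\<close> with itself.\<close>

lemma fprod_alternation:
  fixes \<phi> :: "'x \<Rightarrow> 'y \<Rightarrow> bool"
  assumes F: "ultra F" and m: "marg F k n" and kn: "k < n" and vc: "vcb \<phi> A Y k0"
  shows "fprod F (Suc n) L (\<lambda>e. \<forall>x\<in>A. card {l. l < L \<and> \<phi> x (blk n l e k) \<noteq> \<phi> x (blk n l e n)} < k0) (\<lambda>_. y0)"
proof (rule ccontr)
  note uf = ultra_fprod[OF F, of "Suc n" L "\<lambda>_. y0"]
  note up = ultra_pw[OF ultra_p, of L "\<lambda>_. y0"]
  define G where "G J W u \<longleftrightarrow> (\<exists>x\<in>A. \<forall>l\<in>J. \<phi> x (u l) \<longleftrightarrow> l \<in> W)" for J W and u :: "nat \<Rightarrow> 'y"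
  \<comment> \<open>A failure is witnessed by a set \<open>J\<close> of \<open>k0\<close> blocks on
    which the two truth values differ, together with the set \<open>V\<close> of those blocks where
    \<phi> holds at \<open>k\<close>. There are finitely many such pairs, so one pair occurs almost
    surely.\<close>
  define T where "T = {(J, V). J \<subseteq> {..<L} \<and> card J = k0 \<and> V \<subseteq> J}"
  have "T \<subseteq> Pow {..<L} \<times> Pow {..<L}" unfolding T_def by auto
  then have finT: "finite T" by (rule finite_subset) simp
  define H where "H J V e \<longleftrightarrow>
    (\<exists>x\<in>A. \<forall>l\<in>J. (\<phi> x (blk n l e k) \<longleftrightarrow> l \<in> V) \<and> (\<phi> x (blk n l e n) \<longleftrightarrow> l \<notin> V))" for J V and e :: "nat \<Rightarrow> 'y"
  assume "\<not> ?thesis"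
  then have "fprod F (Suc n) L (\<lambda>e. \<not> (\<forall>x\<in>A. card {l. l < L \<and> \<phi> x (blk n l e k) \<noteq> \<phi> x (blk n l e n)} < k0)) (\<lambda>_. y0)"
    by (simp only: ultra_not[OF uf] not_False_eq_True)
  then have "fprod F (Suc n) L (\<lambda>e. \<exists>t\<in>T. H (fst t) (snd t) e) (\<lambda>_. y0)"
  proof (rule ultra_mono[OF uf])
    fix e :: "nat \<Rightarrow> 'y"
    assume "\<not> (\<forall>x\<in>A. card {l. l < L \<and> \<phi> x (blk n l e k) \<noteq> \<phi> x (blk n l e n)} < k0)"
    then obtain x where x: "x \<in> A" "\<not> card {l. l < L \<and> \<phi> x (blk n l e k) \<noteq> \<phi> x (blk n l e n)} < k0"
      by blast
    obtain J where J: "J \<subseteq> {l. l < L \<and> \<phi> x (blk n l e k) \<noteq> \<phi> x (blk n l e n)}" "card J = k0"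
      by (rule obtain_subset_with_card_n[OF leI[OF x(2)]])
    define V where "V = {l\<in>J. \<phi> x (blk n l e k)}"
    have "J \<subseteq> {..<L}" using J(1) by blast
    then have JT: "(J, V) \<in> T" unfolding T_def V_def using J(2) by simp
    have "(\<phi> x (blk n l e k) \<longleftrightarrow> l \<in> V) \<and> (\<phi> x (blk n l e n) \<longleftrightarrow> l \<notin> V)" if "l \<in> J" for l
    proof -
      have "\<phi> x (blk n l e k) \<noteq> \<phi> x (blk n l e n)" using J(1) that by blast
      then show ?thesis using that by (simp add: V_def)
    qed
    then have "H J V e" unfolding H_def using x(1) by blast
    then show "\<exists>t\<in>T. H (fst t) (snd t) e" by (intro bexI[OF _ JT]) simp
  qed
  then have "\<exists>t\<in>T. fprod F (Suc n) L (\<lambda>e. H (fst t) (snd t) e) (\<lambda>_. y0)"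
    by (simp only: ultra_bex[OF uf finT])
  then obtain J V where JV: "J \<subseteq> {..<L}" "card J = k0" "V \<subseteq> J" "fprod F (Suc n) L (H J V) (\<lambda>_. y0)"
    unfolding T_def by auto
  have finJ: "finite J" using JV(1) finite_subset by blast
  have "pw p L (G J W) (\<lambda>_. y0)" if W: "W \<subseteq> J" for W
  proof -
    \<comment> \<open>On \<open>J\<close>, reading \<open>n\<close> instead of \<open>k\<close>
      flips the truth value. This turns the pattern \<open>V\<close> into an arbitrary pattern
      \<open>W\<close> without changing the distribution of the points read.\<close>
    define pos where "pos l = (if l \<in> V \<longleftrightarrow> l \<in> W then k else n)" for l
    have pos: "pos l = k \<or> pos l = n" for l by (simp add: pos_def)
    have sub: "G J W (\<lambda>l. blk n l e (pos l))" if "H J V e" for e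
    proof -
      obtain x where x: "x \<in> A"
        "\<forall>l\<in>J. (\<phi> x (blk n l e k) \<longleftrightarrow> l \<in> V) \<and> (\<phi> x (blk n l e n) \<longleftrightarrow> l \<notin> V)"
        using \<open>H J V e\<close> unfolding H_def by blast
      show ?thesis
        unfolding G_def
      proof (intro bexI[OF _ x(1)] ballI)
        fix l assume "l \<in> J"
        note h = bspec[OF x(2) this]
        show "\<phi> x (blk n l e (pos l)) \<longleftrightarrow> l \<in> W"
        proof (cases "l \<in> V \<longleftrightarrow> l \<in> W")
          case True
          then show ?thesis using conjunct1[OF h] by (simp add: pos_def)
        next
          case False
          then show ?thesis using conjunct2[OF h] by (simp add: pos_def)
        qed
      qed
    qed
    have h1: "fprod F (Suc n) L (\<lambda>e. G J W (\<lambda>l. blk n l e (pos l))) (\<lambda>_. y0)"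
      by (rule ultra_mono[where F = "\<lambda>E. fprod F (Suc n) L E (\<lambda>_. y0)", OF uf JV(4)]) (rule sub)
    have h2: "(\<lambda>l. blk n l (\<lambda>_. y0) (pos l)) = (\<lambda>_. y0)" by (rule ext) (simp add: blk_def)
    have h3: "fprod F (Suc n) L (\<lambda>e. G J W (\<lambda>l. blk n l e (pos l))) (\<lambda>_. y0) \<longleftrightarrow>
        pw p L (G J W) (\<lambda>l. blk n l (\<lambda>_. y0) (pos l))"
      by (rule fprod_pick[OF m kn]) (rule pos)
    show ?thesis by (rule subst[where P = "pw p L (G J W)", OF h2 iffD1[OF h3 h1]])
  qed
  then have "\<forall>W\<in>Pow J. pw p L (G J W) (\<lambda>_. y0)" by simp
  \<comment> \<open>Every pattern occurs almost surely for the same product of \<open>p\<close>, so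
    a single sample realizes all of them.\<close>
  then have "pw p L (\<lambda>u. \<forall>W\<in>Pow J. G J W u) (\<lambda>_. y0)"
    by (subst ultra_ball[OF up]) (simp_all add: finJ)
  then have "pw p L (\<lambda>u. (\<forall>W\<in>Pow J. G J W u) \<and> (\<forall>l<L. u l \<in> Y)) (\<lambda>_. y0)"
    by (simp only: ultra_conj[OF up] pw_Y simp_thms)
  then obtain u where u: "\<forall>W\<in>Pow J. G J W u" "\<forall>l<L. u l \<in> Y" using ultra_ex[OF up] by blast
  have "shat_at \<phi> A J u" unfolding shat_at_def using u(1) unfolding G_def by blast
  moreover have "u ` J \<subseteq> Y" using u(2) JV(1) by auto
  ultimately show False using vc finJ JV(2) unfolding vcb_def by blast
qed

text \<open>On definable relations the projection of \<open>t\<close> to two coordinates is the product of \<open>p\<close> with itself;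
  the extension makes this true for all relations, which the alternation argument needs.\<close>

lemma ultra_extend:
  assumes t: "ultra t" "t (\<lambda>f. f \<in> U)" and kn: "k < n"
    and tm: "\<And>Q. (\<lambda>e. Q (e 0) (e (Suc 0))) \<in> DD \<Longrightarrow> t (\<lambda>e. Q (e k) (e n)) \<longleftrightarrow> p (\<lambda>w. p (\<lambda>c. Q c w))"
  obtains F where "ultra F" "F (\<lambda>f. f \<in> U)" "\<And>P. P \<in> DD \<Longrightarrow> F P \<longleftrightarrow> t P" "marg F k n"
proof -
  define cond where "cond P B f \<longleftrightarrow> f \<in> U \<and> P f \<and> B (f k) (f n)" for P and B :: "'y \<Rightarrow> 'y \<Rightarrow> bool" and f
  define ok where "ok P B \<longleftrightarrow> P \<in> DD \<and> t P \<and> p (\<lambda>w. p (\<lambda>c. B c w))" for P and B :: "'y \<Rightarrow> 'y \<Rightarrow> bool"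
  define C where "C = {cond P B | P B. ok P B}"
  have ok_conj: "ok (\<lambda>f. P f \<and> P' f) (\<lambda>c w. B c w \<and> B' c w)" if "ok P B" "ok P' B'" for P P' B B'
    using that unfolding ok_def by (simp add: DD_conj ultra_conj[OF t(1)] ultra_conj[OF ultra_p])
  \<comment> \<open>The projection \<open>Q\<close> of \<open>P\<close> to the two coordinates is
    definable and holds almost surely for \<open>t\<close>. By \<open>tm\<close> it holds almost
    surely for the iterated \<open>p\<close> and so meets \<open>B\<close>; a common point lifts to
    \<open>P\<close>.\<close>
  have sat: "\<exists>f. cond P B f" if "ok P B" for P B
  proof -
    have P: "P \<in> DD" "t P" and B: "p (\<lambda>w. p (\<lambda>c. B c w))" using that by (auto simp: ok_def)
    define Q where "Q c w \<longleftrightarrow> (\<exists>h\<in>U. P (h(k := c, n := w)))" for c w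
    have "(\<lambda>e. \<exists>h\<in>U. P (override_on e h (- {k, n}))) \<in> DD" by (rule DD_exs[OF P(1)])
    then have "(\<lambda>e. \<exists>h\<in>U. P (override_on (\<lambda>m. e (if m = k then 0 else Suc 0)) h (- {k, n}))) \<in> DD"
      by (rule DD_reindex)
    moreover have "override_on (\<lambda>m. e (if m = k then 0 else Suc 0)) h (- {k, n}) = h(k := e 0, n := e (Suc 0))"
      for e h :: "nat \<Rightarrow> 'y" using kn by (auto simp: override_on_def)
    ultimately have QD: "(\<lambda>e. Q (e 0) (e (Suc 0))) \<in> DD" by (simp add: Q_def)
    have "t (\<lambda>e. Q (e k) (e n))"
    proof (rule ultra_mono[OF t(1)])
      show "t (\<lambda>f. f \<in> U \<and> P f)" using P t by (simp add: ultra_conj[OF t(1)])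
      fix f assume "f \<in> U \<and> P f"
      then show "Q (f k) (f n)" unfolding Q_def by (intro bexI[of _ f]) auto
    qed
    then have "p (\<lambda>w. p (\<lambda>c. Q c w))" unfolding tm[OF QD] .
    then have "p (\<lambda>w. p (\<lambda>c. Q c w \<and> B c w \<and> c \<in> Y) \<and> w \<in> Y)"
      using B p_Y by (simp add: ultra_conj[OF ultra_p])
    then obtain w where w: "p (\<lambda>c. Q c w \<and> B c w \<and> c \<in> Y)" "w \<in> Y" using ultra_ex[OF ultra_p] by blast
    then obtain c where c: "Q c w" "B c w" "c \<in> Y" using ultra_ex[OF ultra_p] by blast
    then obtain h where "h \<in> U" "P (h(k := c, n := w))" unfolding Q_def by blast
    then have "cond P B (h(k := c, n := w))" unfolding cond_def using c w(2) kn by (auto simp: U_iff)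
    then show ?thesis by (rule exI[of "cond P B"])
  qed
  have okT: "ok (\<lambda>_. True) (\<lambda>_ _. True)"
    by (simp add: ok_def DD_const ultra_True[OF t(1)] ultra_True[OF ultra_p])
  have fin: "\<exists>P B. ok P B \<and> (\<forall>f. cond P B f \<longrightarrow> (\<forall>X\<in>D. X f))" if "finite D" "D \<subseteq> C" for D
    using that
  proof induct
    case empty
    then show ?case using okT by blast
  next
    case (insert X D)
    then obtain P B where PB: "ok P B" "\<And>f. cond P B f \<Longrightarrow> \<forall>X\<in>D. X f" by auto
    obtain P' B' where X: "X = cond P' B'" "ok P' B'" using insert(4) unfolding C_def by auto
    show ?case
    proof (intro exI conjI allI impI)
      show "ok (\<lambda>f. P f \<and> P' f) (\<lambda>c w. B c w \<and> B' c w)" by (rule ok_conj[OF PB(1) X(2)])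
      fix f assume "cond (\<lambda>f. P f \<and> P' f) (\<lambda>c w. B c w \<and> B' c w) f"
      then have "cond P B f" "X f" by (auto simp: cond_def X(1))
      then show "\<forall>X\<in>insert X D. X f" using PB(2)[of f] unfolding ball_simps by blast
    qed
  qed
  have "\<exists>f. \<forall>X\<in>D. X f" if D: "finite D" "D \<subseteq> C" for D
  proof -
    obtain P B where "ok P B" and h: "\<And>f. cond P B f \<Longrightarrow> \<forall>X\<in>D. X f" using fin[OF D] by blast
    then obtain f where "cond P B f" using sat by blast
    from h[OF this] show ?thesis by blast
  qed
  then obtain F where F: "ultra F" "\<And>X. X \<in> C \<Longrightarrow> F X" using ultra_exists[of C] by metis
  have FC: "F (cond P B)" if "ok P B" for P B by (rule F(2)) (use that in \<open>auto simp: C_def\<close>)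
  have FU: "F (\<lambda>f. f \<in> U)"
  proof (rule ultra_mono[OF F(1)])
    show "F (cond (\<lambda>_. True) (\<lambda>_ _. True))" by (rule FC) (rule okT)
  qed (simp add: cond_def)
  have Ft: "F P" if "P \<in> DD" "t P" for P
  proof (rule ultra_mono[OF F(1)])
    show "F (cond P (\<lambda>_ _. True))" by (rule FC) (simp add: ok_def that ultra_True[OF ultra_p])
  qed (simp add: cond_def)
  have Fm: "F (\<lambda>f. B (f k) (f n))" if "p (\<lambda>w. p (\<lambda>c. B c w))" for B
  proof (rule ultra_mono[OF F(1)])
    show "F (cond (\<lambda>_. True) B)" by (rule FC) (simp add: ok_def that DD_const ultra_True[OF t(1)])
  qed (simp add: cond_def)
  show thesis
  proof (rule that[OF F(1) FU])
    show "F P \<longleftrightarrow> t P" if "P \<in> DD" for P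
      using Ft[OF that] Ft[OF DD_not[OF that]] ultra_not[OF F(1), of P] ultra_not[OF t(1), of P] by blast
    show "marg F k n"
      unfolding marg_def
    proof
      fix B
      show "F (\<lambda>f. B (f k) (f n)) \<longleftrightarrow> p (\<lambda>w. p (\<lambda>c. B c w))"
        using Fm[of B] Fm[of "\<lambda>c w. \<not> B c w"]
        by (simp add: ultra_not[OF F(1), of "\<lambda>f. B (f k) (f n)"] ultra_not[OF ultra_p]) blast
    qed
  qed
qed

end

section \<open>Finite samples with few disagreements\<close>

text \<open>\<open>tm\<close> controls the pairs of coordinates on definable relations only; an
  extension of \<open>t\<close> that controls all relations is taken for each \<open>k\<close>
  separately. By \<open>tc\<close> only the first \<open>n + 1\<close> entries count.\<close>

locale amplification = definable_type Y DD p for Y :: "'y set" and DD and p +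
  fixes \<phi> :: "'x \<Rightarrow> 'y \<Rightarrow> bool" and A :: "'x set" and k0 n :: nat and t :: "((nat \<Rightarrow> 'y) \<Rightarrow> bool) \<Rightarrow> bool"
  assumes tame: "tame \<phi> A" and vc: "vcb \<phi> A Y k0"
    and t: "ultra t" and tU: "t (\<lambda>f. f \<in> U)"
    and tm: "\<And>k Q. k < n \<Longrightarrow> (\<lambda>e. Q (e 0) (e (Suc 0))) \<in> DD \<Longrightarrow>
      t (\<lambda>e. Q (e k) (e n)) \<longleftrightarrow> p (\<lambda>w. p (\<lambda>c. Q c w))"
    and tc: "\<And>P. t (\<lambda>f. P (\<lambda>i. f (min i n))) \<longleftrightarrow> t P"
begin

definition bad :: "nat \<Rightarrow> 'x \<Rightarrow> (nat \<Rightarrow> 'y) \<Rightarrow> bool" where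
  "bad k x f \<longleftrightarrow> (\<exists>i<k. \<phi> x (f i) \<noteq> \<phi> x (f n))"

text \<open>The list stands for a finitely supported measure. The same list serves all
  \<open>x\<close>, and below \<open>s\<close> will not depend on \<open>P\<close>, which lets
  samples of the same size be combined.\<close>

definition sampled :: "nat \<Rightarrow> real \<Rightarrow> nat \<Rightarrow> ((nat \<Rightarrow> 'y) \<Rightarrow> bool) \<Rightarrow> bool" where
  "sampled k \<delta> s P \<longleftrightarrow> (\<exists>fs. length fs = s \<and> set fs \<subseteq> U \<and> (\<forall>f\<in>set fs. P f) \<and>
     (\<forall>x\<in>A. real (length (filter (bad k x) fs)) \<le> \<delta> * real s))"

text \<open>Meant for the leaves of a tree that draws the blocks \<open>j - 1, ..., 0\<close>
  successively from samples. Only the leaves are recorded, and their number is fixed, so that the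
  existence of the tree is a definable condition.\<close>

definition paths :: "nat \<Rightarrow> real \<Rightarrow> nat \<Rightarrow> nat \<Rightarrow> ((nat \<Rightarrow> 'y) \<Rightarrow> bool) \<Rightarrow> (nat \<Rightarrow> 'y) \<Rightarrow> (nat \<Rightarrow> 'y) list \<Rightarrow> bool" where
  "paths k \<delta> s j E e es \<longleftrightarrow> length es = s \<and> set es \<subseteq> U \<and>
     (\<forall>e'\<in>set es. E e' \<and> (\<forall>m. j \<le> m div Suc n \<longrightarrow> e' m = e m)) \<and>
     (\<forall>x\<in>A. \<forall>l<j. real (length (filter (\<lambda>e'. bad k x (blk n l e')) es)) \<le> \<delta> * real s)"

lemma upd_U: "f \<in> U \<Longrightarrow> e \<in> U \<Longrightarrow> upd N j f e \<in> U"
  by (auto simp: U_iff upd_def)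

lemma bad_clamp: "k \<le> n \<Longrightarrow> bad k x (\<lambda>i. f (min i n)) \<longleftrightarrow> bad k x f"
  by (auto simp: bad_def min_def)

text \<open>A list of \<kappa> leaves is coded by finitely many further entries, and the bounds for
  all \<open>x\<close> in \<open>A\<close> depend on a finite truth pattern, so tameness applies.
  Definability is what allows the passage from an extension back to \<open>t\<close>.\<close>

lemma paths_definable:
  assumes E: "E \<in> DD" and e: "e \<in> U" and k: "k \<le> n"
  shows "(\<lambda>f. \<exists>es. paths k \<delta> \<kappa> j E (upd (Suc n) j f e) es) \<in> DD"
proof -
  define N where "N = Suc n"
  have N: "N > 0" by (simp add: N_def)
  \<comment> \<open>The first \<open>N\<close> entries of \<open>g\<close> form block
    \<open>j\<close>. They are followed by \<kappa> segments of length \<open>j * N\<close>, the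
    \<open>r\<close>-th of which holds the lower blocks of the \<open>r\<close>-th leaf; the higher
    blocks come from \<open>e\<close>.\<close>
  define er where "er r g m = (if m div N = j then g (m mod N) else if m div N < j then g (N + (r * (j * N) + m)) else e m)"
    for r and g :: "nat \<Rightarrow> 'y" and m
  define c where "c r l i = N + (r * (j * N) + (l * N + i))" for r l i
  define \<beta> where "\<beta> S \<longleftrightarrow> (\<forall>l<j. card {r. r < \<kappa> \<and> (\<exists>i<k. (c r l i \<in> S) \<noteq> (c r l n \<in> S))} \<le> \<delta> * \<kappa>)" for S
  define M where "M g \<longleftrightarrow> (\<forall>r\<in>{..<\<kappa>}. E (er r g)) \<and> (\<forall>x\<in>A. \<beta> {i. i < N + \<kappa> * (j * N) \<and> \<phi> x (g i)})" for g
  have erD: "(\<lambda>g. E (er r g)) \<in> DD" for r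
  proof -
    define \<sigma> where "\<sigma> m = (if m div N = j then Inl (m mod N) else if m div N < j then Inl (N + (r * (j * N) + m)) else Inr (e m))" for m
    have "er r g = (\<lambda>m. case_sum g id (\<sigma> m))" for g by (auto simp: er_def \<sigma>_def)
    moreover have "(\<lambda>g. E (\<lambda>m. case_sum g id (\<sigma> m))) \<in> DD"
      by (rule DD_subst[OF E]) (use e in \<open>auto simp: \<sigma>_def U_iff\<close>)
    ultimately show ?thesis by simp
  qed
  have MD: "M \<in> DD" unfolding M_def by (intro DD_conj DD_ball erD tame_all'[OF tame]) simp
  have blk_er: "blk n l (er r g) i = g (c r l (min i n))" if "l < j" for l r g i
  proof -
    have "min i n < N" by (simp add: N_def)
    then have "(l * N + min i n) div N = l" by simp
    then show ?thesis using that by (simp add: blk_def er_def c_def N_def[symmetric])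
  qed
  have c_bd: "c r l i < N + \<kappa> * (j * N)" if "r < \<kappa>" "l < j" "i < N" for r l i
  proof -
    have "l * N + i < Suc l * N" using that(3) by simp
    also have "\<dots> \<le> j * N" using that(2) by (intro mult_le_mono1) simp
    finally have "r * (j * N) + (l * N + i) < Suc r * (j * N)" by simp
    also have "\<dots> \<le> \<kappa> * (j * N)" using that(1) by (intro mult_le_mono1) simp
    finally show ?thesis by (simp add: c_def)
  qed
  have bad_c: "bad k x (blk n l (er r g)) \<longleftrightarrow>
      (\<exists>i<k. (c r l i \<in> {i. i < N + \<kappa> * (j * N) \<and> \<phi> x (g i)}) \<noteq> (c r l n \<in> {i. i < N + \<kappa> * (j * N) \<and> \<phi> x (g i)}))"
    if "r < \<kappa>" "l < j" for r l x g
  proof -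
    have "c r l n < N + \<kappa> * (j * N)" by (rule c_bd[OF that]) (simp add: N_def)
    moreover have "c r l i < N + \<kappa> * (j * N)" if "i < k" for i
      by (rule c_bd[OF \<open>r < \<kappa>\<close> \<open>l < j\<close>]) (use that k in \<open>simp add: N_def\<close>)
    moreover have "min i n = i" if "i < k" for i using that k by simp
    ultimately show ?thesis unfolding bad_def blk_er[OF that(2)] by auto
  qed
  have \<beta>_iff: "\<beta> {i. i < N + \<kappa> * (j * N) \<and> \<phi> x (g i)} \<longleftrightarrow>
      (\<forall>l<j. length (filter (\<lambda>e'. bad k x (blk n l e')) (map (\<lambda>r. er r g) [0..<\<kappa>])) \<le> \<delta> * \<kappa>)" for x g
  proof -
    have "card {r. r < \<kappa> \<and> (\<exists>i<k. (c r l i \<in> {i. i < N + \<kappa> * (j * N) \<and> \<phi> x (g i)}) \<noteq>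
            (c r l n \<in> {i. i < N + \<kappa> * (j * N) \<and> \<phi> x (g i)}))} =
        length (filter (\<lambda>e'. bad k x (blk n l e')) (map (\<lambda>r. er r g) [0..<\<kappa>]))" if l: "l < j" for l
    proof -
      have "length (filter (\<lambda>e'. bad k x (blk n l e')) (map (\<lambda>r. er r g) [0..<\<kappa>])) =
          card {r. r < \<kappa> \<and> bad k x (blk n l (er r g))}"
        by (simp add: filter_map comp_def length_filter_upt)
      also have "{r. r < \<kappa> \<and> bad k x (blk n l (er r g))} = {r. r < \<kappa> \<and> (\<exists>i<k. (c r l i \<in> {i. i < N + \<kappa> * (j * N) \<and> \<phi> x (g i)}) \<noteq>
            (c r l n \<in> {i. i < N + \<kappa> * (j * N) \<and> \<phi> x (g i)}))}"
        by (intro Collect_cong conj_cong refl bad_c l)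
      finally show ?thesis by simp
    qed
    then show ?thesis unfolding \<beta>_def by simp
  qed
  have "(\<lambda>f. \<exists>h\<in>U. M (override_on f h {N..})) \<in> DD" by (rule DD_exs[OF MD])
  then show ?thesis
  proof (rule DD_congU)
    fix f assume f: "f \<in> U"
    show "(\<exists>es. paths k \<delta> \<kappa> j E (upd (Suc n) j f e) es) \<longleftrightarrow> (\<exists>h\<in>U. M (override_on f h {N..}))"
    proof
      assume "\<exists>es. paths k \<delta> \<kappa> j E (upd (Suc n) j f e) es"
      then obtain es where es: "length es = \<kappa>" "set es \<subseteq> U"
        "\<And>e'. e' \<in> set es \<Longrightarrow> E e'" "\<And>e' m. e' \<in> set es \<Longrightarrow> j \<le> m div N \<Longrightarrow> e' m = upd N j f e m"
        "\<And>x l. x \<in> A \<Longrightarrow> l < j \<Longrightarrow> length (filter (\<lambda>e'. bad k x (blk n l e')) es) \<le> \<delta> * \<kappa>"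
        unfolding paths_def N_def[symmetric] by blast
      define h where "h m = (if (m - N) div (j * N) < \<kappa> then (es ! ((m - N) div (j * N))) ((m - N) mod (j * N)) else e m)" for m
      define g where "g = override_on f h {N..}"
      have esU: "(es ! r) i \<in> Y" if "r < \<kappa>" for r i
      proof -
        have "es ! r \<in> U" using es(1,2) that nth_mem by blast
        then show ?thesis by (simp add: U_iff)
      qed
      have hU: "h \<in> U" unfolding U_iff h_def using e esU by (simp add: U_iff)
      have er: "er r g = es ! r" if r: "r < \<kappa>" for r
      proof
        fix m
        have mem: "es ! r \<in> set es" using es(1) r by simp
        show "er r g m = (es ! r) m"
        proof (cases "m div N < j")
          case True
          then have mj: "m < j * N" using N by (simp add: div_less_iff_less_mult)
          have "er r g m = h (N + (r * (j * N) + m))" using True by (simp add: er_def g_def override_on_def)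
          also have "\<dots> = (es ! r) m"
          proof -
            have "(r * q + m) div q = r" "(r * q + m) mod q = m" if "m < q" for q using that by simp_all
            from this[OF mj] show ?thesis using r by (simp add: h_def)
          qed
          finally show ?thesis .
        next
          case False
          then have "(es ! r) m = upd N j f e m" using es(4)[OF mem] by simp
          moreover have "er r g m = upd N j f e m"
            using False mod_less_divisor[OF N, of m] by (auto simp: er_def upd_def g_def override_on_def not_le)
          ultimately show ?thesis by simp
        qed
      qed
      have map_er: "map (\<lambda>r. er r g) [0..<\<kappa>] = es" using er es(1) by (intro nth_equalityI) auto
      have "M g"
        unfolding M_def \<beta>_iff map_er using es(5) er es(1,3) by auto
      then show "\<exists>h\<in>U. M (override_on f h {N..})" using hU unfolding g_def by blast
    next
      assume "\<exists>h\<in>U. M (override_on f h {N..})"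
      then obtain h where h: "h \<in> U" "M (override_on f h {N..})" by blast
      define g where "g = override_on f h {N..}"
      have gU: "g \<in> U" using h(1) f by (auto simp: g_def U_iff override_on_def)
      have erU: "er r g \<in> U" for r using gU e by (auto simp: er_def U_iff)
      have "er r g m = upd N j f e m" if "j \<le> m div N" for r m
        using that mod_less_divisor[OF N, of m] by (auto simp: er_def upd_def g_def override_on_def not_le)
      then have "paths k \<delta> \<kappa> j E (upd (Suc n) j f e) (map (\<lambda>r. er r g) [0..<\<kappa>])"
        unfolding paths_def N_def[symmetric]
        using h(2) erU unfolding M_def \<beta>_iff g_def[symmetric] by auto
      then show "\<exists>es. paths k \<delta> \<kappa> j E (upd (Suc n) j f e) es" by blast
    qed
  qed
qed

text \<open>The choices of the outermost block that admit a tree below them form a definable set, by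
  induction of full measure for \<open>F\<close>. So it has full measure for \<open>t\<close> and
  contains a sample, and hanging a tree on each sample point multiplies the number of leaves by
  \<open>s\<close>.\<close>

lemma paths_exist:
  assumes F: "ultra F" "F (\<lambda>f. f \<in> U)" "\<And>P. P \<in> DD \<Longrightarrow> F P \<longleftrightarrow> t P" and k: "k \<le> n"
    and s: "\<And>P. P \<in> DD \<Longrightarrow> t P \<Longrightarrow> sampled k \<delta> s P"
  shows "E \<in> DD \<Longrightarrow> e \<in> U \<Longrightarrow> fprod F (Suc n) j E e \<Longrightarrow> \<exists>es. paths k \<delta> (s ^ j) j E e es"
proof (induct j arbitrary: E e)
  case 0
  then have "paths k \<delta> (s ^ 0) 0 E e [e]" by (simp add: paths_def)
  then show ?case by blast
next
  case (Suc j)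
  define D where "D f \<longleftrightarrow> (\<exists>es. paths k \<delta> (s ^ j) j E (upd (Suc n) j f e) es)" for f
  have DD: "D \<in> DD" unfolding D_def by (rule paths_definable[OF Suc(2,3) k])
  have "F D"
  proof (rule ultra_mono[OF F(1)])
    show "F (\<lambda>f. fprod F (Suc n) j E (upd (Suc n) j f e) \<and> f \<in> U)"
      using Suc(4) F(2) by (simp add: ultra_conj[OF F(1)])
    show "D f" if "fprod F (Suc n) j E (upd (Suc n) j f e) \<and> f \<in> U" for f
      unfolding D_def using Suc(1)[OF Suc(2) upd_U[OF _ Suc(3)]] that by blast
  qed
  then have "t D" using F(3)[OF DD] by simp
  from s[OF DD this] obtain fs where fs: "length fs = s" "set fs \<subseteq> U" "\<And>f. f \<in> set fs \<Longrightarrow> D f"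
    "\<And>x. x \<in> A \<Longrightarrow> length (filter (bad k x) fs) \<le> \<delta> * s" unfolding sampled_def by blast
  have "\<forall>f. \<exists>es. D f \<longrightarrow> paths k \<delta> (s ^ j) j E (upd (Suc n) j f e) es" unfolding D_def by blast
  then obtain g where g: "\<And>f. f \<in> set fs \<Longrightarrow> paths k \<delta> (s ^ j) j E (upd (Suc n) j f e) (g f)"
    using fs(3) by metis
  define es where "es = concat (map g fs)"
  have cnt: "length (filter P es) = (\<Sum>f\<leftarrow>fs. length (filter P (g f)))" for P
    unfolding es_def by (simp add: length_filter_concat comp_def)
  have glen: "length (g f) = s ^ j" if "f \<in> set fs" for f using g[OF that] by (simp add: paths_def)
  have len: "length es = s ^ Suc j"
  proof -
    have "length es = (\<Sum>f\<leftarrow>fs. length (g f))" using cnt[of "\<lambda>_. True"] by simp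
    also have "\<dots> = (\<Sum>f\<leftarrow>fs. s ^ j)" by (rule arg_cong[of _ _ sum_list]) (use glen in simp)
    finally show ?thesis by (simp add: sum_list_triv fs(1))
  qed
  have mem: "\<exists>f\<in>set fs. e' \<in> set (g f)" if "e' \<in> set es" for e' using that unfolding es_def by auto
  have p: "set (g f) \<subseteq> U" "\<And>e'. e' \<in> set (g f) \<Longrightarrow> E e'"
    "\<And>e' m. e' \<in> set (g f) \<Longrightarrow> j \<le> m div Suc n \<Longrightarrow> e' m = upd (Suc n) j f e m"
    "\<And>x l. x \<in> A \<Longrightarrow> l < j \<Longrightarrow> length (filter (\<lambda>e'. bad k x (blk n l e')) (g f)) \<le> \<delta> * real (s ^ j)"
    if "f \<in> set fs" for f
    using g[OF that] unfolding paths_def by blast+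
  have "length (filter (\<lambda>e'. bad k x (blk n l e')) es) \<le> \<delta> * s ^ Suc j" if x: "x \<in> A" and l: "l < Suc j" for x l
  proof (cases "l < j")
    case True
    have "real (length (filter (\<lambda>e'. bad k x (blk n l e')) es)) =
        (\<Sum>f\<leftarrow>fs. real (length (filter (\<lambda>e'. bad k x (blk n l e')) (g f))))"
      unfolding cnt by (induct fs) simp_all
    also have "\<dots> \<le> (\<Sum>f\<leftarrow>fs. \<delta> * s ^ j)" using p(4)[OF _ x True] by (intro sum_list_mono) simp
    also have "\<dots> = \<delta> * s ^ Suc j" by (simp add: sum_list_triv fs(1))
    finally show ?thesis .
  next
    case False
    then have lj: "l = j" using l by simp
    \<comment> \<open>Block \<open>j\<close> is constant on the leaves that belong to one sample
      point, so its fraction of bad leaves equals the fraction of bad points in the sample.\<close>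
    have "bad k x (blk n j e') \<longleftrightarrow> bad k x f" if f: "f \<in> set fs" and e': "e' \<in> set (g f)" for f e'
    proof -
      have "blk n j e' = (\<lambda>i. f (min i n))"
      proof
        fix i
        have "min i n < Suc n" by simp
        then have d: "(j * Suc n + min i n) div Suc n = j" "(j * Suc n + min i n) mod Suc n = min i n"
          by (simp_all del: mult_Suc_right)
        then have "e' (j * Suc n + min i n) = upd (Suc n) j f e (j * Suc n + min i n)"
          by (intro p(3)[OF f e']) simp
        then show "blk n j e' i = f (min i n)" unfolding blk_def upd_def d by simp
      qed
      then show ?thesis using bad_clamp[OF k] by simp
    qed
    then have "filter (\<lambda>e'. bad k x (blk n j e')) (g f) = (if bad k x f then g f else [])" if "f \<in> set fs" for f
      using that by (simp add: filter_True filter_False cong: filter_cong)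
    then have "(\<Sum>f\<leftarrow>fs. length (filter (\<lambda>e'. bad k x (blk n j e')) (g f))) = (\<Sum>f\<leftarrow>fs. if bad k x f then s ^ j else 0)"
      using glen by (intro arg_cong[of _ _ sum_list] map_cong) auto
    also have "\<dots> = length (filter (bad k x) fs) * s ^ j" by (induct fs) simp_all
    finally have "length (filter (\<lambda>e'. bad k x (blk n j e')) es) = length (filter (bad k x) fs) * s ^ j"
      unfolding cnt .
    then have "real (length (filter (\<lambda>e'. bad k x (blk n j e')) es)) = real (length (filter (bad k x) fs)) * s ^ j"
      by simp
    also have "\<dots> \<le> \<delta> * s * s ^ j" using fs(4)[OF x] by (intro mult_right_mono) auto
    finally show ?thesis by (simp add: lj)
  qed
  moreover have "e' m = e m" if e': "e' \<in> set es" and m: "Suc j \<le> m div Suc n" for e' m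
  proof -
    obtain f where f: "f \<in> set fs" "e' \<in> set (g f)" using mem[OF e'] by blast
    have "e' m = upd (Suc n) j f e m" by (rule p(3)[OF f]) (use m in simp)
    then show ?thesis using m by (simp add: upd_def)
  qed
  moreover have "E e'" "e' \<in> U" if "e' \<in> set es" for e' using mem[OF that] p(1,2) by blast+
  ultimately have "paths k \<delta> (s ^ Suc j) (Suc j) E e es" unfolding paths_def using len by (simp add: subset_iff)
  then show ?case by blast
qed

text \<open>The new sample lists all blocks of all leaves. On every level a fraction of at most
  \<delta> is bad before \<open>k\<close>; on a single leaf fewer than \<open>k0\<close> of the
  \<open>L\<close> blocks separate \<open>k\<close> from \<open>n\<close>, which costs at most
  \<eta> when \<open>L\<close> is large.\<close>

lemma sampled_step:
  assumes k: "k < n" and s: "0 < s" "\<And>P. P \<in> DD \<Longrightarrow> t P \<Longrightarrow> sampled k \<delta> s P" and \<eta>: "0 < \<eta>"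
  shows "\<exists>s'>0. \<forall>P\<in>DD. t P \<longrightarrow> sampled (Suc k) (\<delta> + \<eta>) s' P"
proof -
  obtain L0 :: nat where "k0 / \<eta> < L0" using reals_Archimedean2 by blast
  then have "k0 / \<eta> < Suc L0" by simp
  then obtain L :: nat where L: "L > 0" "real k0 < \<eta> * L" using \<eta> by (metis mult.commute pos_divide_less_eq zero_less_Suc)
  obtain F where F: "ultra F" "F (\<lambda>f. f \<in> U)" "\<And>P. P \<in> DD \<Longrightarrow> F P \<longleftrightarrow> t P" "marg F k n"
    using ultra_extend[OF t tU k tm[OF k]] by metis
  obtain y0 where y0: "y0 \<in> Y" using Y_ne by blast
  define e0 where "e0 = (\<lambda>_::nat. y0)"
  have e0: "e0 \<in> U" using y0 by (simp add: e0_def U_iff)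
  note uf = ultra_fprod[OF F(1), of "Suc n" L e0]
  define alt where "alt e \<longleftrightarrow> (\<forall>x\<in>A. card {l. l < L \<and> \<phi> x (blk n l e k) \<noteq> \<phi> x (blk n l e n)} < k0)" for e
  have altD: "alt \<in> DD"
  proof -
    define \<beta> where "\<beta> S \<longleftrightarrow> card {l. l < L \<and> (l * Suc n + k \<in> S) \<noteq> (l * Suc n + n \<in> S)} < k0" for S
    have "(\<lambda>e. \<forall>x\<in>A. \<beta> {i. i < L * Suc n \<and> \<phi> x (e i)}) \<in> DD" by (rule tame_all'[OF tame])
    moreover have "\<beta> {i. i < L * Suc n \<and> \<phi> x (e i)} \<longleftrightarrow>
        card {l. l < L \<and> \<phi> x (blk n l e k) \<noteq> \<phi> x (blk n l e n)} < k0" for x e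
    proof -
      have "l * Suc n + i < L * Suc n" if "l < L" "i \<le> n" for l i
      proof -
        have "l * Suc n + i < Suc l * Suc n" using that(2) by simp
        also have "\<dots> \<le> L * Suc n" using that(1) by (intro mult_le_mono1) simp
        finally show ?thesis .
      qed
      then have "{l. l < L \<and> (l * Suc n + k \<in> {i. i < L * Suc n \<and> \<phi> x (e i)}) \<noteq> (l * Suc n + n \<in> {i. i < L * Suc n \<and> \<phi> x (e i)})}
         = {l. l < L \<and> \<phi> x (blk n l e k) \<noteq> \<phi> x (blk n l e n)}"
        using k by (intro Collect_cong conj_cong refl) (simp add: blk_def del: mult_Suc_right)
      then show ?thesis by (simp add: \<beta>_def del: mult_Suc_right)
    qed
    ultimately show ?thesis by (simp add: alt_def[abs_def])
  qed
  show ?thesis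
  proof (intro exI[of _ "s ^ L * L"] conjI ballI impI)
    show "0 < s ^ L * L" using s(1) L(1) by simp
    fix P assume P: "P \<in> DD" "t P"
    define E where "E e \<longleftrightarrow> (\<forall>l\<in>{..<L}. P (blk n l e)) \<and> alt e" for e
    have blkD: "(\<lambda>e. P (blk n l e)) \<in> DD" for l
      unfolding blk_def[abs_def] by (rule DD_reindex[OF P(1)])
    have ED: "E \<in> DD" unfolding E_def by (intro DD_conj DD_ball blkD altD) simp
    have PF: "F (\<lambda>f. P (\<lambda>i. f (min i n)))"
      using F(3)[OF DD_reindex[OF P(1)], of "\<lambda>i. min i n"] P(2) tc by simp
    have fP: "fprod F (Suc n) j (\<lambda>e. P (blk n l e)) e" if "l < j" for l j e
      using that
    proof (induct j arbitrary: e)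
      case (Suc j e)
      show ?case
      proof (cases "l = j")
        case True
        have "fprod F (Suc n) j (\<lambda>e. P (blk n l e)) (upd (Suc n) j f e) \<longleftrightarrow> P (\<lambda>i. f (min i n))" for f
        proof -
          have "fprod F (Suc n) j (\<lambda>e. P (blk n l e)) (upd (Suc n) j f e) \<longleftrightarrow> P (blk n l (upd (Suc n) j f e))"
            by (rule fprod_indep[OF F(1)]) (simp add: blk_upd True)
          then show ?thesis by (simp add: blk_upd True)
        qed
        then have "(\<lambda>f. fprod F (Suc n) j (\<lambda>e. P (blk n l e)) (upd (Suc n) j f e)) = (\<lambda>f. P (\<lambda>i. f (min i n)))"
          by (rule ext)
        then show ?thesis using PF by simp
      next
        case False
        then have "l < j" using Suc(2) by simp
        then show ?thesis using Suc(1) by (simp add: ultra_const[OF F(1)])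
      qed
    qed simp
    have "fprod F (Suc n) L E e0"
    proof -
      have "fprod F (Suc n) L alt e0"
        unfolding alt_def[abs_def] e0_def by (rule fprod_alternation[OF F(1,4) k vc])
      moreover have "fprod F (Suc n) L (\<lambda>e. \<forall>l\<in>{..<L}. P (blk n l e)) e0"
        using ultra_ball[OF uf, of "{..<L}" "\<lambda>l e. P (blk n l e)"] fP by simp
      ultimately show ?thesis
        unfolding E_def[abs_def] using ultra_conj[OF uf, of "\<lambda>e. \<forall>l\<in>{..<L}. P (blk n l e)" alt] by simp
    qed
    then obtain es where es: "paths k \<delta> (s ^ L) L E e0 es"
      using paths_exist[OF F(1,2,3) _ s(2) ED e0] k by (metis less_imp_le)
    define fs where "fs = concat (map (\<lambda>e. map (\<lambda>l. blk n l e) [0..<L]) es)"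
    have len: "length es = s ^ L" and esU: "set es \<subseteq> U" and esE: "\<And>e. e \<in> set es \<Longrightarrow> E e"
      and esb: "\<And>x l. x \<in> A \<Longrightarrow> l < L \<Longrightarrow> length (filter (\<lambda>e'. bad k x (blk n l e')) es) \<le> \<delta> * real (s ^ L)"
      using es unfolding paths_def by blast+
    have cnt: "length (filter Q fs) = (\<Sum>l<L. length (filter (\<lambda>e. Q (blk n l e)) es))" for Q
      unfolding fs_def by (rule length_filter_concat_upt)
    have "length fs = s ^ L * L" using cnt[of "\<lambda>_. True"] len by simp
    moreover have "set fs \<subseteq> U" using esU unfolding fs_def by (auto simp: U_iff blk_def)
    moreover have "\<forall>f\<in>set fs. P f" using esE unfolding fs_def E_def by auto
    moreover have "length (filter (bad (Suc k) x) fs) \<le> (\<delta> + \<eta>) * real (s ^ L * L)" if x: "x \<in> A" for x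
    proof -
      define df where "df f \<longleftrightarrow> \<phi> x (f k) \<noteq> \<phi> x (f n)" for f :: "nat \<Rightarrow> 'y"
      have bS: "bad (Suc k) x f \<longleftrightarrow> bad k x f \<or> df f" for f
        by (auto simp: bad_def df_def less_Suc_eq)
      have "length (filter (bad (Suc k) x) fs) \<le> length (filter (bad k x) fs) + length (filter df fs)"
        unfolding bS by (induct fs) auto
      then have "real (length (filter (bad (Suc k) x) fs)) \<le> real (length (filter (bad k x) fs)) + real (length (filter df fs))"
        by linarith
      also have "real (length (filter (bad k x) fs)) \<le> (\<Sum>l<L. \<delta> * real (s ^ L))"
        unfolding cnt of_nat_sum using esb[OF x] by (intro sum_mono) simp
      also have "(\<Sum>l<L. \<delta> * real (s ^ L)) = \<delta> * real (s ^ L * L)" by simp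
      also have "real (length (filter df fs)) \<le> \<eta> * real (s ^ L * L)"
      proof -
        have "length (filter df fs) = sum_list (map (\<lambda>e. card {l. l < L \<and> df (blk n l e)}) es)"
          unfolding fs_def by (simp add: length_filter_concat comp_def filter_map length_filter_upt)
        also have "\<dots> \<le> (\<Sum>e\<leftarrow>es. k0)"
        proof (rule sum_list_mono)
          fix e assume "e \<in> set es"
          then have "alt e" using esE by (simp add: E_def)
          then show "card {l. l < L \<and> df (blk n l e)} \<le> k0" using x unfolding alt_def df_def by (meson less_imp_le)
        qed
        also have "\<dots> = k0 * s ^ L" by (simp add: sum_list_triv len)
        finally have "real (length (filter df fs)) \<le> real k0 * real (s ^ L)" by (metis of_nat_mono of_nat_mult)
        also have "\<dots> \<le> (\<eta> * L) * real (s ^ L)" using L(2) by (intro mult_right_mono) auto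
        finally show ?thesis by (simp add: algebra_simps)
      qed
      finally show ?thesis by (simp add: algebra_simps)
    qed
    ultimately show "sampled (Suc k) (\<delta> + \<eta>) (s ^ L * L) P" unfolding sampled_def by blast
  qed
qed

lemma sampled_all:
  fixes \<eta> :: real
  assumes \<eta>: "0 < \<eta>" and "k \<le> n"
  shows "\<exists>s>0. \<forall>P\<in>DD. t P \<longrightarrow> sampled k (k * \<eta>) s P"
  using assms(2)
proof (induct k)
  case 0
  have "sampled 0 0 1 P" if "t P" for P
  proof -
    have "t (\<lambda>f. f \<in> U \<and> P f)" using that tU by (simp add: ultra_conj[OF t])
    then obtain f where "f \<in> U" "P f" using ultra_ex[OF t] by blast
    then show ?thesis unfolding sampled_def by (intro exI[of _ "[f]"]) (simp add: bad_def)
  qed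
  then show ?case by (intro exI[of _ 1]) simp
next
  case (Suc k)
  then obtain s where "0 < s" "\<And>P. P \<in> DD \<Longrightarrow> t P \<Longrightarrow> sampled k (k * \<eta>) s P" by auto
  from sampled_step[OF _ this \<eta>] Suc(2) show ?case by (simp add: algebra_simps)
qed

end

section \<open>Largeness from a (p,q)-property\<close>

text \<open>A sequence of points with distinct fibres replaces the set of sets, so that Ramsey's
  theorem can be applied to sets of indices.\<close>

definition pq :: "('x \<Rightarrow> 'y \<Rightarrow> bool) \<Rightarrow> 'x set \<Rightarrow> 'y set \<Rightarrow> nat \<Rightarrow> nat \<Rightarrow> bool" where
  "pq \<phi> A \<theta> P q \<longleftrightarrow> (\<forall>b :: nat \<Rightarrow> 'y. (\<forall>i<P. b i \<in> \<theta>) \<longrightarrow>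
     (\<forall>i<P. \<forall>j<P. i \<noteq> j \<longrightarrow> {x\<in>A. \<phi> x (b i)} \<noteq> {x\<in>A. \<phi> x (b j)}) \<longrightarrow>
     (\<exists>K\<subseteq>{..<P}. card K = q \<and> (\<exists>x\<in>A. \<forall>i\<in>K. \<phi> x (b i))))"

context definable_type
begin

text \<open>\<open>t\<close> combines an inconsistent tuple \<open>d\<close>, each entry of which
  looks like \<open>p\<close> on definable sets, with a point \<open>w\<close> of \<open>p\<close>
  in position \<open>n\<close>. In a sample from \<open>t\<close>, an \<open>x\<close> satisfying
  \<phi> at \<open>n\<close> must fail at an earlier entry, because those are inconsistent, yet
  disagreements of this kind are rare. So the entries at \<open>n\<close> form the list.\<close>

lemma amplify:
  fixes \<phi> :: "'x \<Rightarrow> 'y \<Rightarrow> bool" and \<eta> :: real and n :: nat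
  assumes tame: "tame \<phi> A" and vc: "vcb \<phi> A Y k0"
    and inc: "\<And>\<theta>. inP \<theta> \<Longrightarrow> \<exists>b. (\<forall>i<n. b i \<in> \<theta>) \<and> \<not> (\<exists>x\<in>A. \<forall>i<n. \<phi> x (b i))"
    and \<theta>0: "inP \<theta>0" and \<eta>: "0 < \<eta>"
  shows "\<exists>ys. ys \<noteq> [] \<and> set ys \<subseteq> \<theta>0 \<and> (\<forall>x\<in>A. real (length (filter (\<phi> x) ys)) \<le> \<eta> * real (length ys))"
proof -
  define Inc where "Inc d \<longleftrightarrow> \<not> (\<exists>x\<in>A. \<forall>i<n. \<phi> x (d i))" for d
  define c where "c \<theta> d \<longleftrightarrow> d \<in> U \<and> Inc d \<and> (\<forall>i<n. d i \<in> \<theta>)" for \<theta> and d :: "nat \<Rightarrow> 'y"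
  obtain y0 where y0: "y0 \<in> Y" using Y_ne by blast
  have "\<exists>d. \<forall>X\<in>D. X d" if D: "finite D" "D \<subseteq> c ` {\<theta>. inP \<theta>}" for D
  proof -
    obtain T where T: "T \<subseteq> {\<theta>. inP \<theta>}" "finite T" "D = c ` T" using finite_subset_image[OF D] by blast
    have "inP (Y \<inter> (\<Inter>\<theta>\<in>T. \<theta>))" using T by (intro inP_INT) auto
    from inc[OF this] obtain b where b: "\<forall>i<n. b i \<in> Y \<inter> (\<Inter>\<theta>\<in>T. \<theta>)" "\<not> (\<exists>x\<in>A. \<forall>i<n. \<phi> x (b i))" by blast
    define d where "d i = (if i < n then b i else y0)" for i
    have "d \<in> U" using b(1) y0 by (simp add: U_iff d_def)
    moreover have "Inc d" using b(2) by (simp add: Inc_def d_def)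
    moreover have "\<forall>i<n. d i \<in> \<theta>" if "\<theta> \<in> T" for \<theta> using b(1) that by (simp add: d_def)
    ultimately have "\<forall>\<theta>\<in>T. c \<theta> d" by (simp add: c_def)
    then have "\<forall>X\<in>D. X d" unfolding T(3) by simp
    then show ?thesis by (rule exI[of "\<lambda>d. \<forall>X\<in>D. X d" d])
  qed
  then obtain s where s: "ultra s" "\<And>X. X \<in> c ` {\<theta>. inP \<theta>} \<Longrightarrow> s X"
    using ultra_exists[of "c ` {\<theta>. inP \<theta>}"] by metis
  have sc: "s (c \<theta>)" if "inP \<theta>" for \<theta> using s(2) that by simp
  have sm: "s Q" if \<theta>: "inP \<theta>" and Q: "\<And>d. c \<theta> d \<Longrightarrow> Q d" for \<theta> Q
  proof (rule ultra_mono[OF s(1)])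
    show "s (c \<theta>)" by (rule sc[OF \<theta>])
    show "Q d" if "c \<theta> d" for d by (rule Q[OF that])
  qed
  have sU: "s (\<lambda>d. d \<in> U)" by (rule sm[OF inP_Y]) (simp add: c_def)
  have sInc: "s Inc" by (rule sm[OF inP_Y]) (simp add: c_def)
  have s\<theta>: "s (\<lambda>d. d k \<in> \<theta>)" if \<theta>: "inP \<theta>" and k: "k < n" for \<theta> k
    by (rule sm[OF \<theta>]) (simp add: c_def k)
  \<comment> \<open>Applying the previous fact to complements as well shows that each entry of
    \<open>s\<close> agrees with \<open>p\<close> on definable sets.\<close>
  have s\<theta>_iff: "s (\<lambda>d. d k \<in> \<theta>) \<longleftrightarrow> p (\<lambda>b. b \<in> \<theta>)" if \<theta>: "dset \<theta>" and k: "k < n" for \<theta> k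
  proof (cases "p (\<lambda>b. b \<in> \<theta>)")
    case True
    then show ?thesis using s\<theta>[OF _ k] \<theta> by (simp add: inP_def)
  next
    case False
    then have "p (\<lambda>b. b \<in> Y \<and> b \<notin> \<theta>)" using p_Y by (simp add: ultra_conj[OF ultra_p] ultra_not[OF ultra_p])
    then have "inP (Y - \<theta>)" using dset_Diff[OF \<theta>] by (simp add: inP_def)
    from s\<theta>[OF this k] have "s (\<lambda>d. d k \<in> Y \<and> \<not> d k \<in> \<theta>)" by simp
    then show ?thesis using False by (simp add: ultra_conj[OF s(1)] ultra_not[OF s(1)])
  qed
  define t where "t P \<longleftrightarrow> p (\<lambda>w. s (\<lambda>d. P (\<lambda>i. if i < n then d i else w)))" for P :: "(nat \<Rightarrow> 'y) \<Rightarrow> bool"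
  have t: "ultra t" unfolding ultra_def t_def
    by (simp add: ultra_conj[OF s(1)] ultra_not[OF s(1)] ultra_conj[OF ultra_p] ultra_not[OF ultra_p])
  have tU: "t (\<lambda>f. f \<in> U)"
    unfolding t_def
  proof (rule ultra_mono[OF ultra_p])
    show "p (\<lambda>w. w \<in> Y)" by (rule p_Y)
    show "s (\<lambda>d. (\<lambda>i. if i < n then d i else w) \<in> U)" if w: "w \<in> Y" for w
    proof (rule ultra_mono[OF s(1)])
      show "s (\<lambda>d. d \<in> U)" by (rule sU)
    qed (use w in \<open>simp add: U_iff\<close>)
  qed
  have tm: "t (\<lambda>e. Q (e k) (e n)) \<longleftrightarrow> p (\<lambda>w. p (\<lambda>c. Q c w))"
    if k: "k < n" and Q: "(\<lambda>e. Q (e 0) (e (Suc 0))) \<in> DD" for k and Q :: "'y \<Rightarrow> 'y \<Rightarrow> bool"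
  proof -
    have "t (\<lambda>e. Q (e k) (e n)) \<longleftrightarrow> p (\<lambda>w. s (\<lambda>d. Q (d k) w))" using k by (simp add: t_def)
    also have "\<dots> \<longleftrightarrow> p (\<lambda>w. p (\<lambda>c. Q c w))"
    proof (rule ultra_cong[OF ultra_p p_Y])
      fix w assume w: "w \<in> Y"
      have "dset {c\<in>Y. Q c w}" using dset_section[OF Q, of "\<lambda>_. w" 0] w by (simp add: U_iff)
      from s\<theta>_iff[OF this k] have "s (\<lambda>d. d k \<in> Y \<and> Q (d k) w) \<longleftrightarrow> p (\<lambda>b. b \<in> Y \<and> Q b w)" by simp
      moreover have "s (\<lambda>d. d k \<in> Y)" by (rule s\<theta>[OF inP_Y k])
      ultimately show "s (\<lambda>d. Q (d k) w) \<longleftrightarrow> p (\<lambda>c. Q c w)"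
        using p_Y by (simp add: ultra_conj[OF s(1)] ultra_conj[OF ultra_p])
    qed
    finally show ?thesis .
  qed
  have tc: "t (\<lambda>f. P (\<lambda>i. f (min i n))) \<longleftrightarrow> t P" for P
  proof -
    have "(\<lambda>i. if min i n < n then d (min i n) else w) = (\<lambda>i. if i < n then d i else w)" for d :: "nat \<Rightarrow> 'y" and w
      by (auto simp: min_def)
    then show ?thesis by (simp add: t_def)
  qed
  interpret amplification Y DD p \<phi> A k0 n t
    by unfold_locales (fact tame vc t tU tm tc)+
  \<comment> \<open>Each of the \<open>n\<close> coordinates adds an error of
    \<open>\<eta>'\<close>; dividing by \<open>n + 1\<close> also covers the case that
    \<open>n\<close> is 0.\<close>
  define \<eta>' where "\<eta>' = \<eta> / (n + 1)"
  have \<eta>': "0 < \<eta>'" "n * \<eta>' \<le> \<eta>" using \<eta> by (auto simp: \<eta>'_def field_simps)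
  obtain s0 where s0: "0 < s0" "\<And>P. P \<in> DD \<Longrightarrow> t P \<Longrightarrow> sampled n (n * \<eta>') s0 P"
    using sampled_all[OF \<eta>'(1), of n] by auto
  define P where "P f \<longleftrightarrow> f n \<in> \<theta>0 \<and> Inc f" for f
  have "(\<lambda>e. \<exists>x\<in>A. {i. i < n \<and> \<phi> x (case_sum e id (Inl i))} = {..<n}) \<in> DD"
    by (rule tame_ex[OF tame]) simp
  from DD_not[OF this] have "(\<lambda>e. \<not> (\<exists>x\<in>A. {i. i < n \<and> \<phi> x (e i)} = {..<n})) \<in> DD" by simp
  moreover have "(\<lambda>e. \<not> (\<exists>x\<in>A. {i. i < n \<and> \<phi> x (e i)} = {..<n})) = Inc"
    by (intro ext) (auto simp: Inc_def)
  ultimately have IncD: "Inc \<in> DD" by simp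
  have PD: "P \<in> DD" unfolding P_def
    using IncD dset_coord[of \<theta>0 n] \<theta>0 by (intro DD_conj) (simp_all add: inP_def)
  have tInc: "t Inc"
  proof -
    have "Inc (\<lambda>i. if i < n then d i else w) \<longleftrightarrow> Inc d" for d w by (simp add: Inc_def)
    then show ?thesis using sInc by (simp add: t_def ultra_const[OF ultra_p])
  qed
  have "t (\<lambda>f. f n \<in> \<theta>0)" using \<theta>0 by (simp add: t_def ultra_const[OF s(1)] inP_def)
  then have "t P" unfolding P_def using tInc by (simp add: ultra_conj[OF t])
  from s0(2)[OF PD this] obtain fs where fs: "length fs = s0" "\<And>f. f \<in> set fs \<Longrightarrow> P f"
    "\<And>x. x \<in> A \<Longrightarrow> real (length (filter (bad n x) fs)) \<le> n * \<eta>' * real s0"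
    unfolding sampled_def by blast
  show ?thesis
  proof (intro exI[of _ "map (\<lambda>f. f n) fs"] conjI ballI)
    show "map (\<lambda>f. f n) fs \<noteq> []" using fs(1) s0(1) by auto
    show "set (map (\<lambda>f. f n) fs) \<subseteq> \<theta>0" using fs(2) by (auto simp: P_def)
    fix x assume x: "x \<in> A"
    have "bad n x f" if "f \<in> set fs" "\<phi> x (f n)" for f
    proof -
      have "Inc f" using fs(2)[OF that(1)] by (simp add: P_def)
      then show ?thesis using that(2) x unfolding Inc_def bad_def by blast
    qed
    then have "length (filter (\<lambda>f. \<phi> x (f n)) fs) \<le> length (filter (bad n x) fs)"
      by (induct fs) auto
    then have "real (length (filter (\<phi> x) (map (\<lambda>f. f n) fs))) \<le> real (length (filter (bad n x) fs))"
      by (simp add: filter_map comp_def)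
    also have "\<dots> \<le> n * \<eta>' * real s0" by (rule fs(3)[OF x])
    also have "\<dots> \<le> \<eta> * real s0" using \<eta>'(2) by (intro mult_right_mono) auto
    finally show "real (length (filter (\<phi> x) (map (\<lambda>f. f n) fs))) \<le> \<eta> * real (length (map (\<lambda>f. f n) fs))"
      by (simp add: fs(1))
  qed
qed

lemma not_conD:
  assumes "\<not> con \<phi> A"
  shows "\<exists>n::nat. \<forall>\<theta>. inP \<theta> \<longrightarrow> (\<exists>b. (\<forall>i<n. b i \<in> \<theta>) \<and> \<not> (\<exists>x\<in>A. \<forall>i<n. \<phi> x (b i)))"
proof -
  from assms obtain n :: nat where
    n: "\<not> (\<exists>\<theta>. inP \<theta> \<and> (\<forall>b :: nat \<Rightarrow> 'y. (\<forall>i<n. b i \<in> \<theta>) \<longrightarrow> (\<exists>x\<in>A. \<forall>i<n. \<phi> x (b i))))"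
    unfolding con_def by blast
  show ?thesis
  proof (intro exI[of _ n] allI impI)
    fix \<theta> assume "inP \<theta>"
    then have "\<not> (\<forall>b :: nat \<Rightarrow> 'y. (\<forall>i<n. b i \<in> \<theta>) \<longrightarrow> (\<exists>x\<in>A. \<forall>i<n. \<phi> x (b i)))" using n by blast
    then show "\<exists>b. (\<forall>i<n. b i \<in> \<theta>) \<and> \<not> (\<exists>x\<in>A. \<forall>i<n. \<phi> x (b i))" by blast
  qed
qed

text \<open>If no small fraction of a sample can be satisfied, one may assume that each consistent subset of a
  sample is cut out exactly. Ramsey's theorem then turns the \<open>(p, q)\<close>-property into a shattered set.\<close>

lemma pq_con:
  fixes \<phi> :: "'x \<Rightarrow> 'y \<Rightarrow> bool"
  assumes tame: "tame \<phi> A" and vc: "vcb \<phi> A Y q" and \<theta>: "inP \<theta>"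
    and ne: "\<And>b. b \<in> \<theta> \<Longrightarrow> \<exists>x\<in>A. \<phi> x b" and pq: "pq \<phi> A \<theta> P q"
  shows "con \<phi> A"
proof (rule ccontr)
  assume "\<not> con \<phi> A"
  from not_conD[OF this] obtain n :: nat where
    "\<forall>\<theta>. inP \<theta> \<longrightarrow> (\<exists>b. (\<forall>i<n. b i \<in> \<theta>) \<and> \<not> (\<exists>x\<in>A. \<forall>i<n. \<phi> x (b i)))" ..
  note n = this[rule_format]
  \<comment> \<open>The \<open>q\<close>-subsets of the indices are coloured by consistency. The
    consistent colour is wanted on \<open>2 * q\<close> indices, as \<open>exact_shatter\<close>
    requires, and the other one on \<open>P\<close> indices, to contradict
    \<open>pq\<close>.\<close>
  obtain N :: nat where N: "partn_lst {..<N} [2 * q, P] q" using ramsey_full by blast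
  define \<delta> :: real where "\<delta> = 1 / (2 ^ N * N + 1)"
  have \<delta>: "0 < \<delta>" "2 ^ N * real N * \<delta> < 1" unfolding \<delta>_def by (auto simp: field_simps add_pos_nonneg)
  obtain ys where ys: "ys \<noteq> []" "set ys \<subseteq> \<theta>"
    "\<And>x. x \<in> A \<Longrightarrow> real (length (filter (\<phi> x) ys)) \<le> \<delta> * real (length ys)"
    using amplify[OF tame vc n \<theta> \<delta>(1)] by blast
  have "\<exists>b. (\<forall>i. b i \<in> set ys) \<and>
    (\<forall>K\<subseteq>{..<N}. (\<exists>x\<in>A. \<forall>i\<in>K. \<phi> x (b i)) \<longrightarrow> (\<exists>x\<in>A. \<forall>i<N. \<phi> x (b i) \<longleftrightarrow> i \<in> K))"
    by (rule sample_exact[OF ys(1) _ \<delta>(2)]) (rule ys(3))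
  then obtain b where b: "\<And>i. b i \<in> set ys"
    and ex: "\<And>K. K \<subseteq> {..<N} \<Longrightarrow> \<exists>x\<in>A. \<forall>i\<in>K. \<phi> x (b i) \<Longrightarrow> \<exists>x\<in>A. \<forall>i<N. \<phi> x (b i) \<longleftrightarrow> i \<in> K"
    by blast
  have b\<theta>: "b i \<in> \<theta>" for i using b ys(2) by blast
  have bY: "b i \<in> Y" for i using b\<theta> inP_sub[OF \<theta>] by blast
  define f where "f K = (if \<exists>x\<in>A. \<forall>i\<in>K. \<phi> x (b i) then 0 else 1 :: nat)" for K
  have "f \<in> [{..<N}]\<^bsup>q\<^esup> \<rightarrow> {..<length [2 * q, P]}" by (auto simp: f_def)
  then obtain i H where i: "i < length [2 * q, P]" and H: "H \<in> [{..<N}]\<^bsup>([2 * q, P] ! i)\<^esup>" "f ` [H]\<^bsup>q\<^esup> \<subseteq> {i}"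
    using N unfolding partn_lst_def monochromatic_def by blast
  have HN: "H \<subseteq> {..<N}" "finite H" "card H = [2 * q, P] ! i" using H(1) by (auto simp: nsets_def)
  have fK: "f K = i" if "K \<subseteq> H" "card K = q" for K
    using H(2) that HN(2) finite_subset[OF that(1)] by (auto simp: nsets_def image_subset_iff)
  show False
  proof (cases "i = 0")
    case True
    have "\<exists>I\<subseteq>H. card I = q \<and> shat_at \<phi> A I b"
    proof (rule exact_shatter)
      show "\<exists>x\<in>A. \<forall>i<N. \<phi> x (b i) \<longleftrightarrow> i \<in> K" if "K \<subseteq> {..<N}" "\<exists>x\<in>A. \<forall>i\<in>K. \<phi> x (b i)" for K
        by (rule ex[OF that])
      show "H \<subseteq> {..<N}" by (rule HN)
      show "card H = 2 * q" using HN(3) True by simp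
      show "\<exists>x\<in>A. \<forall>i\<in>K. \<phi> x (b i)" if "K \<subseteq> H" "card K = q" for K
        using fK[OF that] True by (simp add: f_def split: if_split_asm)
    qed
    then obtain I where I: "I \<subseteq> H" "card I = q" "shat_at \<phi> A I b" by blast
    have "finite I" using I(1) HN(2) finite_subset by blast
    moreover have "b ` I \<subseteq> Y" using bY by blast
    ultimately show False using vc I unfolding vcb_def by blast
  next
    case False
    then have i1: "i = 1" using i by simp
    then have cH: "card H = P" using HN(3) by simp
    obtain h where h: "bij_betw h {0..<P} H" using ex_bij_betw_nat_finite[OF HN(2)] cH by blast
    have hH: "h i \<in> H" if "i < P" for i using h that by (auto simp: bij_betw_def)
    have inj: "inj_on h {..<P}" using h by (simp add: bij_betw_def atLeast0LessThan)
    have "\<exists>K\<subseteq>{..<P}. card K = q \<and> (\<exists>x\<in>A. \<forall>i\<in>K. \<phi> x (b (h i)))"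
    proof (rule pq[unfolded pq_def, rule_format, of "\<lambda>i. b (h i)"])
      show "b (h i) \<in> \<theta>" for i by (rule b\<theta>)
      fix i j assume ij: "i < P" "j < P" "i \<noteq> j"
      have hi: "h i < N" "h j < N" "h i \<noteq> h j"
        using hH[OF ij(1)] hH[OF ij(2)] HN(1) inj ij by (auto simp: inj_on_def)
      \<comment> \<open>Singletons are consistent and hence cut out exactly, which makes the fibres
        distinct as \<open>pq\<close> demands.\<close>
      have "\<exists>x\<in>A. \<forall>i\<in>{h i}. \<phi> x (b i)" using ne[OF b\<theta>] by simp
      then obtain x where "x \<in> A" "\<forall>l<N. \<phi> x (b l) \<longleftrightarrow> l \<in> {h i}" using ex[of "{h i}"] hi(1) by auto
      then have "x \<in> {x\<in>A. \<phi> x (b (h i))}" "x \<notin> {x\<in>A. \<phi> x (b (h j))}" using hi by auto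
      then show "{x\<in>A. \<phi> x (b (h i))} \<noteq> {x\<in>A. \<phi> x (b (h j))}" by blast
    qed
    then obtain K x where K: "K \<subseteq> {..<P}" "card K = q" "x \<in> A" "\<forall>i\<in>K. \<phi> x (b (h i))" by blast
    have "h ` K \<subseteq> H" using K(1) hH by auto
    moreover have "card (h ` K) = q" using K(1,2) inj by (metis card_image inj_on_subset)
    ultimately have "f (h ` K) = 1" using fK i1 by simp
    then show False using K(3,4) by (auto simp: f_def split: if_split_asm)
  qed
qed

text \<open>Consistency to order \<open>q\<close> is the \<open>(q, q)\<close>-property, so above
  the VC-dimension it improves to every finite order, at the price of a smaller \<theta>.\<close>

lemma consistent_con:
  fixes \<phi> :: "'x \<Rightarrow> 'y \<Rightarrow> bool"
  assumes tame: "tame \<phi> A" and vc: "vcb \<phi> A Y q" and \<theta>: "inP \<theta>"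
    and cons: "\<And>b. (\<forall>i<q. b i \<in> \<theta>) \<Longrightarrow> \<exists>x\<in>A. \<forall>i<q. \<phi> x (b i)"
  shows "con \<phi> A"
proof -
  have "q \<noteq> 0"
  proof
    assume "q = 0"
    then have "shat_at \<phi> A {} (\<lambda>_. undefined)" using cons[of "\<lambda>_. undefined"] by (auto simp: shat_at_def)
    then show False using vc \<open>q = 0\<close> unfolding vcb_def by (metis card.empty empty_subsetI finite.emptyI image_empty)
  qed
  show ?thesis
  proof (rule pq_con[OF tame vc \<theta>])
    show "\<exists>x\<in>A. \<phi> x b" if "b \<in> \<theta>" for b using cons[of "\<lambda>_. b"] that \<open>q \<noteq> 0\<close> by auto
    show "pq \<phi> A \<theta> q q"
      unfolding pq_def using cons by (metis card_lessThan lessThan_iff order_refl)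
  qed
qed

lemma not_con:
  fixes \<phi> :: "'x \<Rightarrow> 'y \<Rightarrow> bool"
  assumes "tame \<phi> A" "vcb \<phi> A Y q" "inP \<theta>" "\<not> con \<phi> A"
  shows "\<exists>b. (\<forall>i<q. b i \<in> \<theta>) \<and> \<not> (\<exists>x\<in>A. \<forall>i<q. \<phi> x (b i))"
  using consistent_con[OF assms(1-3)] assms(4) by blast

text \<open>An inconsistent tuple for \<open>A\<close> followed by one for \<open>B\<close> is
  inconsistent for the union, and both can be found in any \<theta>. So the sets that are not large
  form an ideal.\<close>

lemma con_Un:
  assumes "con \<phi> (A \<union> B)" shows "con \<phi> A \<or> con \<phi> B"
proof (rule ccontr)
  assume "\<not> ?thesis"
  then have nA: "\<not> con \<phi> A" and nB: "\<not> con \<phi> B" by blast+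
  from not_conD[OF nA] obtain n :: nat where
    "\<forall>\<theta>. inP \<theta> \<longrightarrow> (\<exists>b. (\<forall>i<n. b i \<in> \<theta>) \<and> \<not> (\<exists>x\<in>A. \<forall>i<n. \<phi> x (b i)))" ..
  note n = this[rule_format]
  from not_conD[OF nB] obtain m :: nat where
    "\<forall>\<theta>. inP \<theta> \<longrightarrow> (\<exists>b. (\<forall>i<m. b i \<in> \<theta>) \<and> \<not> (\<exists>x\<in>B. \<forall>i<m. \<phi> x (b i)))" ..
  note m = this[rule_format]
  obtain \<theta> where \<theta>: "inP \<theta>" "\<And>b. (\<forall>i<n + m. b i \<in> \<theta>) \<Longrightarrow> \<exists>x\<in>A \<union> B. \<forall>i<n + m. \<phi> x (b i)"
    using assms unfolding con_def by blast
  obtain b where b: "\<forall>i<n. b i \<in> \<theta>" "\<not> (\<exists>x\<in>A. \<forall>i<n. \<phi> x (b i))" using n[OF \<theta>(1)] by blast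
  obtain c where c: "\<forall>i<m. c i \<in> \<theta>" "\<not> (\<exists>x\<in>B. \<forall>i<m. \<phi> x (c i))" using m[OF \<theta>(1)] by blast
  define d where "d i = (if i < n then b i else c (i - n))" for i
  have "\<forall>i<n + m. d i \<in> \<theta>" using b(1) c(1) by (auto simp: d_def)
  then obtain x where x: "x \<in> A \<union> B" "\<forall>i<n + m. \<phi> x (d i)" using \<theta>(2) by blast
  have "\<phi> x (b i)" if "i < n" for i
  proof -
    have "\<phi> x (d i)" using x(2) that by simp
    then show ?thesis using that by (simp add: d_def)
  qed
  moreover have "\<phi> x (c i)" if "i < m" for i
  proof -
    have "\<phi> x (d (n + i))" using x(2) that by simp
    then show ?thesis by (simp add: d_def)
  qed
  ultimately show False using x(1) b(2) c(2) by blast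
qed

lemma con_empty: "\<not> con \<phi> {}"
  unfolding con_def using inP_ne by (auto intro!: exI[of _ 0])

lemma con_UN: "finite T \<Longrightarrow> con \<phi> (\<Union>t\<in>T. A t) \<Longrightarrow> \<exists>t\<in>T. con \<phi> (A t)"
proof (induct rule: finite_induct)
  case empty
  then show ?case by (simp add: con_empty)
next
  case (insert t T)
  then have "con \<phi> (A t \<union> (\<Union>t\<in>T. A t))" by simp
  then show ?case using con_Un insert(3) by blast
qed

end

section \<open>Consistent sets in a type\<close>

lemma vcb_transfer:
  assumes "vcb R D Y k" "\<And>z. z \<in> D' \<Longrightarrow> \<exists>d\<in>D. \<forall>b\<in>Y. R' z b \<longleftrightarrow> R d b"
  shows "vcb R' D' Y k"
  unfolding vcb_def
proof (intro allI impI notI)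
  fix I and b :: "nat \<Rightarrow> 'b" assume I: "finite I \<and> card I = k \<and> b ` I \<subseteq> Y" and s: "shat_at R' D' I b"
  have "shat_at R D I b"
    unfolding shat_at_def
  proof (intro allI impI)
    fix W assume "W \<subseteq> I"
    then obtain z where z: "z \<in> D'" "\<forall>i\<in>I. R' z (b i) \<longleftrightarrow> i \<in> W" using s unfolding shat_at_def by blast
    obtain d where d: "d \<in> D" "\<forall>b\<in>Y. R' z b \<longleftrightarrow> R d b" using assms(2)[OF z(1)] by blast
    have "\<forall>i\<in>I. R d (b i) \<longleftrightarrow> i \<in> W" using z(2) d(2) I by blast
    then show "\<exists>d\<in>D. \<forall>i\<in>I. R d (b i) \<longleftrightarrow> i \<in> W" using d(1) by blast
  qed
  then show False using assms(1) I unfolding vcb_def by blast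
qed

text \<open>The epsilon-net has to meet the sets of points where \<phi> fails; complementing the
  traces does not affect shattering.\<close>

lemma vcb_shat:
  assumes vc: "vcb \<phi> X Y q" and q: "q > 0" and B: "B \<subseteq> Y" "card B = q" and A: "A \<subseteq> X"
  shows "\<not> shat ((\<lambda>x. {y. \<not> \<phi> x y}) ` A) B"
proof
  assume s: "shat ((\<lambda>x. {y. \<not> \<phi> x y}) ` A) B"
  have fB: "finite B" using B(2) q card_gt_0_iff by metis
  obtain h where h: "bij_betw h {0..<q} B" using ex_bij_betw_nat_finite[OF fB] B(2) by blast
  have hB: "h i \<in> B" if "i < q" for i using h that by (auto simp: bij_betw_def)
  have inj: "inj_on h {0..<q}" using h by (simp add: bij_betw_def)
  have "shat_at \<phi> X {0..<q} h"
    unfolding shat_at_def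
  proof (intro allI impI)
    fix W assume W: "W \<subseteq> {0..<q}"
    have "B - h ` W \<subseteq> B" by blast
    then obtain x where x: "x \<in> A" "{y. \<not> \<phi> x y} \<inter> B = B - h ` W" using s unfolding shat_def by blast
    have "\<phi> x (h i) \<longleftrightarrow> i \<in> W" if i: "i \<in> {0..<q}" for i
    proof -
      have "\<phi> x (h i) \<longleftrightarrow> h i \<in> h ` W" using x(2) hB i by auto
      also have "\<dots> \<longleftrightarrow> i \<in> W" by (rule inj_on_image_mem_iff[OF inj i W])
      finally show ?thesis .
    qed
    then show "\<exists>d\<in>X. \<forall>i\<in>{0..<q}. \<phi> d (h i) \<longleftrightarrow> i \<in> W" using x(1) A by blast
  qed
  moreover have "finite {0..<q} \<and> card {0..<q} = q \<and> h ` {0..<q} \<subseteq> Y" using hB B(1) by auto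
  ultimately show False using vc unfolding vcb_def by blast
qed

lemma pigeonhole_fibre:
  assumes "finite T" "T \<noteq> {}" "\<And>i. i < card T * Q \<Longrightarrow> f i \<in> T"
  shows "\<exists>t\<in>T. \<exists>K\<subseteq>{..<card T * Q}. card K = Q \<and> (\<forall>i\<in>K. f i = t)"
proof (cases "Q = 0")
  case True
  then show ?thesis using assms(2) by (intro bexI[of _ "SOME t. t \<in> T"] exI[of _ "{}"]) (auto simp: some_in_eq)
next
  case False
  have "\<exists>t\<in>T. Q \<le> card {i\<in>{..<card T * Q}. f i = t}"
  proof (rule ccontr)
    assume neg: "\<not> ?thesis"
    have "{..<card T * Q} = (\<Union>t\<in>T. {i\<in>{..<card T * Q}. f i = t})" using assms(3) by blast
    then have "card T * Q \<le> (\<Sum>t\<in>T. card {i\<in>{..<card T * Q}. f i = t})"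
      using card_UN_le[OF assms(1), of "\<lambda>t. {i\<in>{..<card T * Q}. f i = t}"] by (metis card_lessThan)
    also have "\<dots> < (\<Sum>t\<in>T. Q)" using neg assms(1,2) by (intro sum_strict_mono) (auto simp: not_le)
    finally show False by simp
  qed
  then obtain t K where "t \<in> T" "K \<subseteq> {i\<in>{..<card T * Q}. f i = t}" "card K = Q"
    by (meson obtain_subset_with_card_n)
  then show ?thesis by blast
qed

lemma (in definable) tame_UN:
  assumes "finite T" "\<And>t. t \<in> T \<Longrightarrow> tame \<phi> (A t)"
  shows "tame \<phi> (\<Union>t\<in>T. A t)"
  unfolding tame_def
proof (intro allI)
  fix m S
  have "(\<lambda>e. \<exists>t\<in>T. \<exists>x\<in>A t. \<forall>i<m. \<phi> x (e i) \<longleftrightarrow> i \<in> S) \<in> DD"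
    by (rule DD_bex[OF assms(1)]) (use assms(2) in \<open>simp add: tame_def\<close>)
  then show "(\<lambda>e. \<exists>x\<in>\<Union>t\<in>T. A t. \<forall>i<m. \<phi> x (e i) \<longleftrightarrow> i \<in> S) \<in> DD" by simp
qed

text \<open>One \<theta> serves all finite orders here, in contrast to \<open>con\<close>.\<close>

definition good :: "('x \<Rightarrow> 'y \<Rightarrow> bool) \<Rightarrow> 'x set \<Rightarrow> 'y set \<Rightarrow> bool" where
  "good \<phi> X \<theta> \<longleftrightarrow> (\<forall>F. finite F \<longrightarrow> F \<subseteq> \<theta> \<longrightarrow> (\<exists>x\<in>X. \<forall>b\<in>F. \<phi> x b))"

section \<open>Cells of a maximal sequence and the implication relation\<close>

text \<open>Entry 0 is the point and the other entries are parameters. Since \<open>P\<close>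
  depends on finitely many entries, this is NIP for one definable family at a time.\<close>

locale nip_type = definable_type Y DD p for Y :: "'y set" and DD and p +
  assumes nip: "P \<in> DD \<Longrightarrow> \<exists>k. vcb (\<lambda>e b. P (e(0 := b))) U Y k"

locale nip_relation = nip_type Y DD p for Y :: "'y set" and DD and p +
  fixes \<phi> :: "'x \<Rightarrow> 'y \<Rightarrow> bool" and X :: "'x set" and q :: nat
  assumes tame: "tame \<phi> X" and vc: "vcb \<phi> X Y q" and conX: "con \<phi> X"
begin

definition piece :: "(nat \<Rightarrow> 'y) \<Rightarrow> nat \<Rightarrow> nat set \<Rightarrow> 'x set" where
  "piece b j S = {x\<in>X. \<forall>i<j. \<phi> x (b i) \<longleftrightarrow> i \<in> S}"

text \<open>Large sets are nonempty, so a stage is in particular a shattered sequence; this bounds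
  its length below \<open>q\<close>.\<close>

definition stage :: "(nat \<Rightarrow> 'y) \<Rightarrow> nat \<Rightarrow> bool" where
  "stage b j \<longleftrightarrow> b \<in> U \<and> (\<forall>S\<subseteq>{..<j}. con \<phi> (piece b j S))"

lemma q_pos: "q > 0"
proof (rule ccontr)
  assume "\<not> q > 0"
  then have "\<not> shat_at \<phi> X {} (\<lambda>_. undefined)" using vc unfolding vcb_def by simp
  then have "X = {}" by (auto simp: shat_at_def)
  have "\<not> con \<phi> ({} :: 'x set)" by (rule con_empty)
  then show False using conX unfolding \<open>X = {}\<close> by blast
qed

lemma piece_sub: "piece b j S \<subseteq> X"
  by (auto simp: piece_def)

lemma tame_piece: "b \<in> U \<Longrightarrow> tame \<phi> (piece b j S)"
proof -
  assume b: "b \<in> U"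
  have "piece b j S = {x\<in>X. (\<lambda>T. \<forall>i<j. i \<in> T \<longleftrightarrow> i \<in> S) {i. i < j \<and> \<phi> x (b i)}}"
    by (auto simp: piece_def)
  then show ?thesis using tame_sub[OF tame b, of "\<lambda>T. \<forall>i<j. i \<in> T \<longleftrightarrow> i \<in> S" j] by simp
qed

lemma no_stage_q: "\<not> stage b q"
proof
  assume s: "stage b q"
  have "shat_at \<phi> X {..<q} b"
    unfolding shat_at_def
  proof (intro allI impI)
    fix W assume "W \<subseteq> {..<q}"
    then have "con \<phi> (piece b q W)" using s by (simp add: stage_def)
    then have "piece b q W \<noteq> {}" using con_empty by metis
    then show "\<exists>d\<in>X. \<forall>i\<in>{..<q}. \<phi> d (b i) \<longleftrightarrow> i \<in> W" by (auto simp: piece_def)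
  qed
  moreover have "b ` {..<q} \<subseteq> Y" using s by (auto simp: stage_def U_iff)
  ultimately show False using vc unfolding vcb_def by (metis card_lessThan finite_lessThan)
qed

lemma maximal_stage: "\<exists>b j. stage b j \<and> (\<forall>c\<in>Y. \<not> stage (b(j := c)) (Suc j))"
proof (rule ccontr)
  assume "\<not> ?thesis"
  then have step: "\<exists>b. stage b (Suc j)" if "\<exists>b. stage b j" for j using that by blast
  have "\<exists>b. stage b j" for j
  proof (induct j)
    case 0
    obtain y where "y \<in> Y" using Y_ne by blast
    moreover have "piece (\<lambda>_. y) 0 S = X" for S by (simp add: piece_def)
    ultimately have "stage (\<lambda>_. y) 0" using conX by (simp add: stage_def U_iff)
    then show ?case by (rule exI[of "\<lambda>b. stage b 0"])
  qed (rule step)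
  then show False using no_stage_q by blast
qed

text \<open>The index of the cell is part of \<open>z\<close>, so that implications on different
  cells can be united into one relation. Only the first \<open>q\<close> entries of the sequence
  count.\<close>

definition rel :: "(nat \<Rightarrow> 'y) \<Rightarrow> nat \<Rightarrow> nat set \<times> (nat \<Rightarrow> 'y) \<Rightarrow> 'y \<Rightarrow> bool" where
  "rel b j z c \<longleftrightarrow> (\<forall>x\<in>piece b j (fst z). (\<forall>i<q. \<phi> x (snd z i)) \<longrightarrow> \<phi> x c)"

definition Z :: "'y set \<Rightarrow> nat set \<Rightarrow> (nat set \<times> (nat \<Rightarrow> 'y)) set" where
  "Z \<theta> S = {S} \<times> {d\<in>U. \<forall>i<q. d i \<in> \<theta>}"

lemma rel_definable:
  assumes "b \<in> U"
  shows "(\<lambda>e. rel b j (S, \<lambda>i. e (Suc i)) (e 0)) \<in> DD"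
proof -
  define \<beta> where "\<beta> T \<longleftrightarrow> ((\<forall>i<q. Suc i \<in> T) \<longrightarrow> 0 \<in> T)" for T :: "nat set"
  have "(\<lambda>e. \<forall>x\<in>piece b j S. \<beta> {i. i < Suc q \<and> \<phi> x (e i)}) \<in> DD"
    by (rule tame_all'[OF tame_piece[OF assms]])
  then show ?thesis by (simp add: \<beta>_def rel_def)
qed

text \<open>The sequences occurring in \<open>Z \<theta> S\<close> all lie in \<open>U\<close>, so
  one bound serves every \<theta>. The order of quantifiers matters, because \<theta> will be chosen
  depending on \<open>k\<close>.\<close>

lemma vcb_rel:
  assumes b: "b \<in> U"
  shows "\<exists>k. \<forall>\<theta>. vcb (rel b j) (Z \<theta> S) Y k"
proof -
  obtain k where k: "vcb (\<lambda>e c. rel b j (S, \<lambda>i. (e(0 := c)) (Suc i)) ((e(0 := c)) 0)) U Y k"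
    using nip[OF rel_definable[OF b]] by blast
  have "vcb (rel b j) (Z \<theta> S) Y k" for \<theta>
  proof (rule vcb_transfer[OF k])
    fix z assume z: "z \<in> Z \<theta> S"
    then obtain d where d: "z = (S, d)" "d \<in> U" by (auto simp: Z_def)
    show "\<exists>e\<in>U. \<forall>c\<in>Y. rel b j z c \<longleftrightarrow> rel b j (S, \<lambda>i. (e(0 := c)) (Suc i)) ((e(0 := c)) 0)"
      \<comment> \<open>Entry 0 is reserved for the point, so the parameters are shifted by one; the
        value at 0 is overwritten.\<close>
      by (rule bexI[of _ "\<lambda>i. d (i - 1)"]) (use d in \<open>auto simp: U_iff\<close>)
  qed
  then show ?thesis by blast
qed

text \<open>A quantifier over \<open>Z \<theta> S\<close> is one over sequences from
  \<open>Y\<close>. The points occupy the first \<open>m\<close> entries, and the quantified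
  sequence is placed from \<open>m\<close> on.\<close>

lemma tame_rel:
  assumes b: "b \<in> U" and \<theta>: "dset \<theta>"
  shows "tame (rel b j) (Z \<theta> S)"
  unfolding tame_def
proof (intro allI)
  fix m W
  define G where "G g \<longleftrightarrow> (\<forall>i\<in>{..<q}. g (m + i) \<in> \<theta>) \<and>
    (\<forall>i\<in>{..<m}. rel b j (S, \<lambda>l. g (m + l)) (g i) \<longleftrightarrow> i \<in> W)" for g
  have r: "(\<lambda>g. rel b j (S, \<lambda>l. g (m + l)) (g i)) \<in> DD" for i
    using DD_reindex[OF rel_definable[OF b, of j S], of "case_nat i (\<lambda>l. m + l)"] by simp
  have "G \<in> DD"
    unfolding G_def by (intro DD_conj DD_ball DD_iff_const r dset_coord[OF \<theta>]) simp_all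
  then have "(\<lambda>e. \<exists>h\<in>U. G (override_on e h {m..})) \<in> DD" by (rule DD_exs)
  then show "(\<lambda>e. \<exists>z\<in>Z \<theta> S. \<forall>i<m. rel b j z (e i) \<longleftrightarrow> i \<in> W) \<in> DD"
  proof (rule DD_congU)
    fix e
    have G: "G (override_on e h {m..}) \<longleftrightarrow> (\<forall>i<q. h (m + i) \<in> \<theta>) \<and>
        (\<forall>i<m. rel b j (S, \<lambda>l. h (m + l)) (e i) \<longleftrightarrow> i \<in> W)" for h
      by (auto simp: G_def override_on_def)
    show "(\<exists>z\<in>Z \<theta> S. \<forall>i<m. rel b j z (e i) \<longleftrightarrow> i \<in> W) \<longleftrightarrow> (\<exists>h\<in>U. G (override_on e h {m..}))"
    proof
      assume "\<exists>z\<in>Z \<theta> S. \<forall>i<m. rel b j z (e i) \<longleftrightarrow> i \<in> W"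
      then obtain d where d: "d \<in> U" "\<forall>i<q. d i \<in> \<theta>" "\<forall>i<m. rel b j (S, d) (e i) \<longleftrightarrow> i \<in> W"
        by (auto simp: Z_def)
      show "\<exists>h\<in>U. G (override_on e h {m..})"
      proof (rule bexI[of _ "\<lambda>l. d (l - m)"])
        show "G (override_on e (\<lambda>l. d (l - m)) {m..})" unfolding G using d(2,3) by simp
        show "(\<lambda>l. d (l - m)) \<in> U" using d(1) by (simp add: U_iff)
      qed
    next
      assume "\<exists>h\<in>U. G (override_on e h {m..})"
      then obtain h where h: "h \<in> U" "\<forall>i<q. h (m + i) \<in> \<theta>"
        "\<forall>i<m. rel b j (S, \<lambda>l. h (m + l)) (e i) \<longleftrightarrow> i \<in> W" unfolding G by blast
      have "(S, \<lambda>l. h (m + l)) \<in> Z \<theta> S" using h(1,2) by (simp add: Z_def U_iff)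
      then show "\<exists>z\<in>Z \<theta> S. \<forall>i<m. rel b j z (e i) \<longleftrightarrow> i \<in> W" using h(3) by blast
    qed
  qed
qed

text \<open>The number \<open>q\<close> of elements of \<open>\<theta>\<close> that imply \<open>\<phi> x c\<close> on a piece does not grow with the number of
  elements \<open>c\<close>, because the inconsistent sets form an ideal.\<close>

lemma shared_bound:
  assumes b: "b \<in> U" and \<theta>: "inP \<theta>" and c: "c \<in> U"
    and nc: "\<And>i. i < k \<Longrightarrow> \<not> con \<phi> {x\<in>piece b j S. \<not> \<phi> x (c i)}"
  shows "\<exists>z\<in>Z \<theta> S. \<forall>i<k. rel b j z (c i)"
proof -
  \<comment> \<open>The part of the cell where at least one of the instances fails. It is not large,
    so some \<open>q\<close> points of \<theta> have instances that are inconsistent on it; these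
    imply all of the given instances on the cell.\<close>
  define A where "A = {x\<in>piece b j S. (\<lambda>T. \<not> {..<k} \<subseteq> T) {i. i < k \<and> \<phi> x (c i)}}"
  have tA: "tame \<phi> A" unfolding A_def by (rule tame_sub[OF tame_piece[OF b] c])
  have A: "A = (\<Union>i\<in>{..<k}. {x\<in>piece b j S. \<not> \<phi> x (c i)})" by (auto simp: A_def)
  have "\<not> con \<phi> A"
  proof
    assume "con \<phi> A"
    then have "\<exists>i\<in>{..<k}. con \<phi> {x\<in>piece b j S. \<not> \<phi> x (c i)}" unfolding A by (rule con_UN[rotated]) simp
    then show False using nc by blast
  qed
  moreover have "vcb \<phi> A Y q" by (rule vcb_mono[OF vc]) (auto simp: A_def piece_def)
  ultimately obtain d where d: "\<forall>i<q. d i \<in> \<theta>" "\<not> (\<exists>x\<in>A. \<forall>i<q. \<phi> x (d i))"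
    using not_con[OF tA _ \<theta>] by blast
  obtain y where y: "y \<in> \<theta>" using inP_ne[OF \<theta>] by blast
  define d' where "d' i = (if i < q then d i else y)" for i
  have "d' i \<in> \<theta>" for i using d(1) y by (simp add: d'_def)
  then have "(S, d') \<in> Z \<theta> S" using inP_sub[OF \<theta>] by (auto simp: Z_def U_iff)
  moreover have "rel b j (S, d') (c i)" if i: "i < k" for i
    unfolding rel_def
  proof (intro ballI impI)
    fix x assume x: "x \<in> piece b j (fst (S, d'))" "\<forall>i<q. \<phi> x (snd (S, d') i)"
    show "\<phi> x (c i)"
    proof (rule ccontr)
      assume "\<not> \<phi> x (c i)"
      then have "x \<in> A" unfolding A using x(1) i by auto
      moreover have "\<forall>i<q. \<phi> x (d i)" using x(2) by (simp add: d'_def)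
      ultimately show False using d(2) by blast
    qed
  qed
  ultimately show ?thesis by blast
qed

end

lemma enumerate_padded:
  assumes "finite Q" "card Q \<le> m" "y \<in> \<theta>" "Q \<subseteq> \<theta>"
  shows "\<exists>b :: nat \<Rightarrow> 'y. (\<forall>i. b i \<in> \<theta>) \<and> (\<forall>y\<in>Q. \<exists>i<m. b i = y)"
proof -
  obtain h where h: "bij_betw h {0..<card Q} Q" using ex_bij_betw_nat_finite[OF assms(1)] by blast
  define b where "b i = (if i < card Q then h i else y)" for i
  have hQ: "h i \<in> Q" if "i < card Q" for i using h that by (auto simp: bij_betw_def)
  have "b i \<in> \<theta>" for i using hQ[of i] assms(3,4) by (auto simp: b_def)
  moreover have "\<exists>i<m. b i = z" if z: "z \<in> Q" for z
  proof -
    have "z \<in> h ` {0..<card Q}" using h z by (simp add: bij_betw_def)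
    then obtain i where "i < card Q" "z = h i" by auto
    then show ?thesis using assms(2) by (intro exI[of _ i]) (simp add: b_def)
  qed
  ultimately show ?thesis by blast
qed

text \<open>Every tuple with a failing entry contributes at least one failing entry to the
  concatenation.\<close>

lemma count_bad_blocks:
  "length (filter (\<lambda>z. \<exists>i<q. \<not> R (f z i)) ds) \<le> length (filter (\<lambda>y. \<not> R y) (concat (map (\<lambda>z. map (f z) [0..<q]) ds)))"
proof (induct ds)
  case (Cons z ds)
  have "filter (\<lambda>y. \<not> R y) (map (f z) [0..<q]) \<noteq> []" if i: "i < q" "\<not> R (f z i)" for i
    using i by (auto simp: filter_empty_conv intro!: bexI[of _ i])
  then have 1: "1 \<le> length (filter (\<lambda>y. \<not> R y) (map (f z) [0..<q]))" if "\<exists>i<q. \<not> R (f z i)"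
    using that by (metis One_nat_def Suc_leI length_greater_0_conv)
  show ?case
  proof (cases "\<exists>i<q. \<not> R (f z i)")
    case True
    show ?thesis using add_mono[OF 1[OF True] Cons] True by simp
  next
    case False
    then have "\<not> (\<exists>i<q. \<not> R (f z i))" .
    then show ?thesis using Cons by auto
  qed
qed simp

section \<open>From implications on a cell to a consistent set\<close>

context nip_relation
begin

text \<open>The net consists of at most \<open>m\<close> points of \<open>\<theta>'\<close>, so some
  \<open>x\<close> in the cell realizes all its instances. Such an \<open>x\<close> fails at less
  than a fraction \<open>frac_const q1 / (4 * q)\<close> of the entries, hence violates less than a
  fraction \<open>frac_const q1 / 4\<close> of the tuples, as each has \<open>q\<close> entries. At
  least that fraction implies a given \<open>c\<close>, so a satisfied tuple does.\<close>

lemma good_if_con_rel: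
  assumes \<theta>': "inP \<theta>'"
    and m_net: "\<forall>(F :: 'y set set) ys. (\<forall>B\<subseteq>set ys. card B = q \<longrightarrow> \<not> shat F B) \<longrightarrow> ys \<noteq> [] \<longrightarrow>
      (\<exists>Q\<subseteq>set ys. card Q \<le> m \<and> (\<forall>S\<in>F. S \<inter> Q = {} \<longrightarrow>
        length (filter (\<lambda>y. y \<in> S) ys) < frac_const q1 / (4 * real q) * length ys))"
    and m_cons: "\<And>d :: nat \<Rightarrow> 'y. (\<forall>i<m. d i \<in> \<theta>') \<Longrightarrow> \<exists>x\<in>piece b j S. \<forall>i<m. \<phi> x (d i)"
    and vcr: "vcb (rel b j) (Z \<theta>' S) Y q1"
    and \<theta>'': "\<theta>'' \<subseteq> Y"
    and cons: "\<And>c :: nat \<Rightarrow> 'y. (\<forall>i<q1. c i \<in> \<theta>'') \<Longrightarrow> \<exists>z\<in>Z \<theta>' S. \<forall>i<q1. rel b j z (c i)"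
  shows "good \<phi> X \<theta>''"
  unfolding good_def
proof (intro allI impI)
  fix F assume F: "finite F" "F \<subseteq> \<theta>''"
  obtain y0 where y0: "y0 \<in> \<theta>'" using inP_ne[OF \<theta>'] by blast
  define \<beta> where "\<beta> = frac_const q1"
  have \<beta>: "0 < \<beta>" "\<beta> \<le> 1" by (simp_all add: \<beta>_def frac_const_pos)
  show "\<exists>x\<in>X. \<forall>c\<in>F. \<phi> x c"
  proof (cases "F = {}")
    case True
    obtain x where "x \<in> piece b j S" using m_cons[of "\<lambda>_. y0"] y0 by blast
    then show ?thesis using piece_sub True by blast
  next
    case False
    \<comment> \<open>For every list of points there is a tuple implying a fraction of them; the
      weights exchange the roles and give one list of tuples, a fraction of which implies each
      point.\<close>
    have "\<exists>ds. ds \<noteq> [] \<and> set ds \<subseteq> Z \<theta>' S \<and> (\<forall>c\<in>F. \<beta> / 4 * length ds \<le> length (filter (\<lambda>d. rel b j d c) ds))"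
    proof (rule weights_majority[OF F(1) False \<beta>])
      fix cs assume cs: "cs \<noteq> []" "set cs \<subseteq> F"
      show "\<exists>d\<in>Z \<theta>' S. \<beta> * real (length cs) \<le> real (length (filter (rel b j d) cs))"
        unfolding \<beta>_def
      proof (rule consistent_fraction)
        show "\<exists>d\<in>Z \<theta>' S. \<forall>i<q1. rel b j d (c i)" if "\<And>i. c i \<in> \<theta>''" for c
          by (rule cons) (simp add: that)
        show "vcb (rel b j) (Z \<theta>' S) \<theta>'' q1" by (rule vcb_mono[OF vcr order_refl \<theta>'' order_refl])
        show "cs \<noteq> []" "set cs \<subseteq> \<theta>''" using cs F(2) by auto
      qed
    qed
    then obtain ds where ds: "ds \<noteq> []" "set ds \<subseteq> Z \<theta>' S"
      "\<And>c. c \<in> F \<Longrightarrow> \<beta> / 4 * length ds \<le> length (filter (\<lambda>d. rel b j d c) ds)" by blast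
    define ys where "ys = concat (map (\<lambda>z. map (snd z) [0..<q]) ds)"
    have len: "length ys = q * length ds"
      unfolding ys_def by (induct ds) simp_all
    have ys\<theta>: "set ys \<subseteq> \<theta>'" using ds(2) by (auto simp: ys_def Z_def)
    then have ysY: "set ys \<subseteq> Y" using inP_sub[OF \<theta>'] by blast
    have ysne: "ys \<noteq> []" using len ds(1) q_pos by auto
    have nosh: "\<forall>B\<subseteq>set ys. card B = q \<longrightarrow> \<not> shat ((\<lambda>x. {y. \<not> \<phi> x y}) ` piece b j S) B"
    proof (intro allI impI)
      fix B assume "B \<subseteq> set ys" "card B = q"
      with ysY have "B \<subseteq> Y" "card B = q" by simp_all
      then show "\<not> shat ((\<lambda>x. {y. \<not> \<phi> x y}) ` piece b j S) B"
        by (rule vcb_shat[OF vc q_pos _ _ piece_sub])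
    qed
    from m_net[THEN spec, THEN spec, THEN mp, THEN mp, OF nosh ysne]
    obtain Q where Q: "Q \<subseteq> set ys" "card Q \<le> m"
      "\<forall>V\<in>(\<lambda>x. {y. \<not> \<phi> x y}) ` piece b j S. V \<inter> Q = {} \<longrightarrow>
        length (filter (\<lambda>y. y \<in> V) ys) < frac_const q1 / (4 * real q) * length ys"
      by (elim exE conjE)
    have fQ: "finite Q" using Q(1) finite_subset by blast
    have "Q \<subseteq> \<theta>'" using Q(1) ys\<theta> by (rule subset_trans)
    from enumerate_padded[OF fQ Q(2) y0 this]
    obtain d where d: "\<forall>i. d i \<in> \<theta>'" "\<forall>y\<in>Q. \<exists>i<m. d i = y" by (elim exE conjE)
    have "\<forall>i<m. d i \<in> \<theta>'" using d(1) by simp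
    from m_cons[OF this] obtain x where x: "x \<in> piece b j S" "\<forall>i<m. \<phi> x (d i)" by (elim bexE)
    have "\<phi> x y" if y: "y \<in> Q" for y
    proof -
      from bspec[OF d(2) y] obtain i where "i < m" "d i = y" by (elim exE conjE)
      then show ?thesis using x(2) by (elim allE[of _ i]) simp
    qed
    then have "{y. \<not> \<phi> x y} \<inter> Q = {}" by (auto simp only: Int_iff mem_Collect_eq)
    then have "length (filter (\<lambda>y. \<not> \<phi> x y) ys) < \<beta> / (4 * real q) * length ys"
      using Q(3) x(1) by (simp add: \<beta>_def)
    also have "\<dots> = \<beta> / 4 * length ds" using q_pos by (simp add: len)
    finally have bad: "length (filter (\<lambda>z. \<exists>i<q. \<not> \<phi> x (snd z i)) ds) < \<beta> / 4 * length ds"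
      using count_bad_blocks[where R = "\<phi> x" and f = snd and q = q and ds = ds]
      unfolding ys_def by linarith
    have "\<phi> x c" if c: "c \<in> F" for c
    proof (rule ccontr)
      assume n: "\<not> \<phi> x c"
      have i: "\<exists>i<q. \<not> \<phi> x (snd z i)" if z: "z \<in> set ds" "rel b j z c" for z
      proof -
        have "fst z = S" using z(1) ds(2) by (auto simp: Z_def)
        then show ?thesis using z(2) x(1) n unfolding rel_def by blast
      qed
      have le: "length (filter P zs) \<le> length (filter P' zs)" if "\<And>z. z \<in> set zs \<Longrightarrow> P z \<Longrightarrow> P' z"
        for P P' and zs :: "(nat set \<times> (nat \<Rightarrow> 'y)) list" using that by (induct zs) auto
      have "length (filter (\<lambda>z. rel b j z c) ds) \<le> length (filter (\<lambda>z. \<exists>i<q. \<not> \<phi> x (snd z i)) ds)"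
        by (rule le) (rule i)
      then show False using bad ds(3)[OF c] by linarith
    qed
    then show ?thesis using x(1) piece_sub by blast
  qed
qed

lemma piece_Suc:
  "piece (b(j := c)) (Suc j) S =
    (if j \<in> S then {x\<in>piece b j (S - {j}). \<phi> x c} else {x\<in>piece b j S. \<not> \<phi> x c})"
  by (auto simp: piece_def less_Suc_eq)

lemma tame_piece_half:
  assumes "b \<in> U" "c \<in> Y"
  shows "tame \<phi> {x\<in>piece b j S. \<phi> x c}"
proof -
  have "{x\<in>piece b j S. (\<lambda>T. 0 \<in> T) {i. i < Suc 0 \<and> \<phi> x ((\<lambda>_::nat. c) i)}} = {x\<in>piece b j S. \<phi> x c}" by simp
  then show ?thesis
    using tame_sub[OF tame_piece[OF assms(1)], of "\<lambda>_. c" j S "\<lambda>T. 0 \<in> T" "Suc 0"] assms(2)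
    by (simp add: U_iff)
qed

text \<open>If both halves of every cell were large, \<open>c\<close> would prolong the stage. For
  \<open>c\<close> in \<theta> all positive halves are large, so some negative half is not.\<close>

lemma inconsistent_half:
  assumes stage: "stage b j" and max: "\<And>c. c \<in> Y \<Longrightarrow> \<not> stage (b(j := c)) (Suc j)"
  shows "\<exists>\<theta>. inP \<theta> \<and> (\<forall>c\<in>\<theta>. \<exists>S\<in>Pow {..<j}. \<not> con \<phi> {x\<in>piece b j S. \<not> \<phi> x c})"
proof -
  have bU: "b \<in> U" using stage by (simp add: stage_def)
  \<comment> \<open>One of the \<open>Suc q\<close> points will be \<open>c\<close>; the remaining
    order \<open>q\<close> on the positive half is what \<open>consistent_con\<close> needs.\<close>
  have "\<forall>S\<in>Pow {..<j}. \<exists>\<theta>. inP \<theta> \<and>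
    (\<forall>d :: nat \<Rightarrow> 'y. (\<forall>i<Suc q. d i \<in> \<theta>) \<longrightarrow> (\<exists>x\<in>piece b j S. \<forall>i<Suc q. \<phi> x (d i)))"
  proof
    fix S assume "S \<in> Pow {..<j}"
    then have "con \<phi> (piece b j S)" using stage by (simp add: stage_def)
    then show "\<exists>\<theta>. inP \<theta> \<and>
      (\<forall>d :: nat \<Rightarrow> 'y. (\<forall>i<Suc q. d i \<in> \<theta>) \<longrightarrow> (\<exists>x\<in>piece b j S. \<forall>i<Suc q. \<phi> x (d i)))"
      unfolding con_def by (rule spec)
  qed
  from bchoice[OF this] obtain \<theta>S where \<theta>S: "\<And>S. S \<in> Pow {..<j} \<Longrightarrow> inP (\<theta>S S)"
    "\<And>S d. S \<in> Pow {..<j} \<Longrightarrow> (\<forall>i<Suc q. d i \<in> \<theta>S S) \<Longrightarrow> \<exists>x\<in>piece b j S. \<forall>i<Suc q. \<phi> x (d i)" by blast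
  define \<theta> where "\<theta> = Y \<inter> (\<Inter>S\<in>Pow {..<j}. \<theta>S S)"
  have \<theta>: "inP \<theta>" unfolding \<theta>_def by (rule inP_INT) (simp_all add: \<theta>S(1))
  have \<theta>sub: "\<theta> \<subseteq> \<theta>S S" if "S \<in> Pow {..<j}" for S using that by (auto simp: \<theta>_def)
  have "\<exists>S\<in>Pow {..<j}. \<not> con \<phi> {x\<in>piece b j S. \<not> \<phi> x c}" if c: "c \<in> \<theta>" for c
  proof (rule ccontr)
    assume neg: "\<not> ?thesis"
    have cY: "c \<in> Y" using c by (simp add: \<theta>_def)
    have pos: "con \<phi> {x\<in>piece b j S. \<phi> x c}" if S: "S \<in> Pow {..<j}" for S
    proof (rule consistent_con[OF tame_piece_half[OF bU cY] _ \<theta>])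
      show "vcb \<phi> {x \<in> piece b j S. \<phi> x c} Y q"
        by (rule vcb_mono[OF vc]) (auto simp: piece_def)
      fix d :: "nat \<Rightarrow> 'y" assume d: "\<forall>i<q. d i \<in> \<theta>"
      have "\<forall>i<Suc q. (d(q := c)) i \<in> \<theta>S S" using d c \<theta>sub[OF S] by (auto simp: less_Suc_eq)
      from \<theta>S(2)[OF S this] obtain x where "x \<in> piece b j S" "\<forall>i<Suc q. \<phi> x ((d(q := c)) i)" by blast
      then show "\<exists>x\<in>{x \<in> piece b j S. \<phi> x c}. \<forall>i<q. \<phi> x (d i)"
        by (intro bexI[of _ x]) (auto simp: less_Suc_eq)
    qed
    have "con \<phi> (piece (b(j := c)) (Suc j) S)" if S: "S \<subseteq> {..<Suc j}" for S
    proof (cases "j \<in> S")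
      case True
      have "S - {j} \<in> Pow {..<j}" using S by (auto simp: less_Suc_eq)
      then show ?thesis using pos True by (simp add: piece_Suc)
    next
      case False
      then have "S \<in> Pow {..<j}" using S by (auto simp: less_Suc_eq)
      then show ?thesis using neg False by (simp add: piece_Suc)
    qed
    moreover have "b(j := c) \<in> U" using bU cY by (simp add: U_iff)
    ultimately show False using max[OF cY] by (simp add: stage_def)
  qed
  then show ?thesis using \<theta> by blast
qed

text \<open>Among \<open>card T * ?Q\<close> points, \<open>?Q\<close> share a cell on which their
  negative halves are not large, and then a single tuple implies all of them. This is a
  \<open>(p, q)\<close>-property for the union over the cells, and largeness of the union passes to
  one of them.\<close>

lemma con_rel:
  assumes bU: "b \<in> U" and \<theta>: "inP \<theta>" and \<theta>': "inP \<theta>'"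
    and T: "finite T" "T \<noteq> {}" and half: "\<And>c. c \<in> \<theta> \<Longrightarrow> \<exists>S\<in>T. \<not> con \<phi> {x\<in>piece b j S. \<not> \<phi> x c}"
    and vcr: "\<And>S. S \<in> T \<Longrightarrow> vcb (rel b j) (Z \<theta>' S) Y k"
  shows "\<exists>S\<in>T. con (rel b j) (Z \<theta>' S)"
proof (rule con_UN[OF T(1)])
  \<comment> \<open>The VC-bound of a union of \<open>card T\<close> families with bound
    \<open>k\<close>; it takes the place of \<open>q\<close> in the
    \<open>(p, q)\<close>-property.\<close>
  let ?Q = "card T * k"
  show "con (rel b j) (\<Union>S\<in>T. Z \<theta>' S)"
  proof (rule pq_con)
    show "tame (rel b j) (\<Union>S\<in>T. Z \<theta>' S)"
    proof (rule tame_UN[OF T(1)])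
      show "tame (rel b j) (Z \<theta>' S)" for S
        by (rule tame_rel[OF bU]) (use \<theta>' in \<open>simp add: inP_def\<close>)
    qed
    show "vcb (rel b j) (\<Union>S\<in>T. Z \<theta>' S) Y ?Q" by (rule vcb_UN[OF T(1) vcr])
    show "inP \<theta>" by (rule \<theta>)
    show "\<exists>z\<in>\<Union>S\<in>T. Z \<theta>' S. rel b j z c" if c: "c \<in> \<theta>" for c
    proof -
      obtain S where S: "S \<in> T" "\<not> con \<phi> {x\<in>piece b j S. \<not> \<phi> x c}" using half[OF c] by blast
      have "c \<in> Y" using c inP_sub[OF \<theta>] by blast
      then have "(\<lambda>_. c) \<in> U" by (simp add: U_iff)
      then have "\<exists>z\<in>Z \<theta>' S. \<forall>i<Suc 0. rel b j z ((\<lambda>_::nat. c) i)"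
        by (rule shared_bound[OF bU \<theta>']) (rule S(2))
      then show ?thesis using S(1) by blast
    qed
    show "pq (rel b j) (\<Union>S\<in>T. Z \<theta>' S) \<theta> (card T * ?Q) ?Q"
      unfolding pq_def
    proof (intro allI impI)
      fix c :: "nat \<Rightarrow> 'y" assume c: "\<forall>i<card T * ?Q. c i \<in> \<theta>"
      have "\<forall>i\<in>{i. i < card T * ?Q}. \<exists>S. S \<in> T \<and> \<not> con \<phi> {x\<in>piece b j S. \<not> \<phi> x (c i)}" using half c by blast
      from bchoice[OF this] obtain f where f: "\<And>i. i < card T * ?Q \<Longrightarrow> f i \<in> T"
        "\<And>i. i < card T * ?Q \<Longrightarrow> \<not> con \<phi> {x\<in>piece b j (f i). \<not> \<phi> x (c i)}" by blast
      obtain S K where SK: "S \<in> T" "K \<subseteq> {..<card T * ?Q}" "card K = ?Q" "\<forall>i\<in>K. f i = S"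
        using pigeonhole_fibre[where f = f and Q = ?Q and T = T, OF T f(1)] by blast
      have fK: "finite K" using SK(2) finite_subset by blast
      obtain h where h: "bij_betw h {0..<?Q} K" using ex_bij_betw_nat_finite[OF fK] SK(3) by metis
      have hK: "h i \<in> K" if "i < ?Q" for i using h that by (auto simp: bij_betw_def)
      obtain y where y: "y \<in> Y" using Y_ne by blast
      define c' where "c' i = (if i < ?Q then c (h i) else y)" for i
      have cY: "c i \<in> Y" if "i \<in> K" for i using that c SK(2) inP_sub[OF \<theta>] by blast
      have "c' i \<in> Y" for i using y cY[OF hK] by (simp add: c'_def)
      then have "c' \<in> U" by (simp add: U_iff)
      then have "\<exists>z\<in>Z \<theta>' S. \<forall>i<?Q. rel b j z (c' i)"
      proof (rule shared_bound[OF bU \<theta>'])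
        fix i assume i: "i < ?Q"
        have "h i < card T * ?Q" "f (h i) = S" using hK[OF i] SK(2,4) by blast+
        then show "\<not> con \<phi> {x \<in> piece b j S. \<not> \<phi> x (c' i)}" using f(2)[of "h i"] i by (simp add: c'_def)
      qed
      then obtain z where z: "z \<in> Z \<theta>' S" "\<forall>i<?Q. rel b j z (c' i)" by blast
      have "rel b j z (c i)" if i: "i \<in> K" for i
      proof -
        have "i \<in> h ` {0..<?Q}" using h i by (simp add: bij_betw_def)
        then obtain l where "l < ?Q" "i = h l" by auto
        then show ?thesis using z(2) by (auto simp: c'_def)
      qed
      then have "\<exists>z\<in>\<Union>S\<in>T. Z \<theta>' S. \<forall>i\<in>K. rel b j z (c i)" using z(1) SK(1) by blast
      then show "\<exists>K\<subseteq>{..<card T * ?Q}. card K = ?Q \<and> (\<exists>z\<in>\<Union>S\<in>T. Z \<theta>' S. \<forall>i\<in>K. rel b j z (c i))"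
        using SK(2,3) by blast
    qed
  qed
qed

text \<open>The choices depend on each other in one direction only: \<open>q1\<close> bounds the
  implication relation for every \<theta>, \<open>m\<close> depends on \<open>q1\<close> and
  \<open>q\<close>, \<open>\<theta>'\<close> is consistent to order \<open>m\<close> on every cell,
  and \<open>\<theta>''\<close> consists of points implied from \<open>\<theta>'\<close>.\<close>

lemma good_inP: "\<exists>\<theta>. inP \<theta> \<and> good \<phi> X \<theta>"
proof -
  obtain b j where stage: "stage b j" and max: "\<And>c. c \<in> Y \<Longrightarrow> \<not> stage (b(j := c)) (Suc j)"
    using maximal_stage by blast
  have bU: "b \<in> U" using stage by (simp add: stage_def)
  let ?T = "Pow {..<j}"
  obtain \<theta> where \<theta>: "inP \<theta>" "\<And>c. c \<in> \<theta> \<Longrightarrow> \<exists>S\<in>?T. \<not> con \<phi> {x\<in>piece b j S. \<not> \<phi> x c}"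
    using inconsistent_half[OF stage max] by blast
  have "\<forall>S\<in>?T. \<exists>k. \<forall>\<theta>. vcb (rel b j) (Z \<theta> S) Y k" using vcb_rel[OF bU] by blast
  from bchoice[OF this] obtain k where k: "\<And>S \<theta>. S \<in> ?T \<Longrightarrow> vcb (rel b j) (Z \<theta> S) Y (k S)" by blast
  define q1 where "q1 = (\<Sum>S\<in>?T. k S)"
  have q1: "vcb (rel b j) (Z \<theta> S) Y q1" if S: "S \<in> ?T" for \<theta> S
  proof (rule vcb_mono[OF k[OF S] order_refl order_refl])
    show "k S \<le> q1" unfolding q1_def using S by (intro member_le_sum) auto
  qed
  have "0 < frac_const q1 / (4 * real q)" using frac_const_pos q_pos by simp
  from eps_net[OF this, of q] obtain m where m: "\<forall>(F :: 'y set set) ys. (\<forall>B\<subseteq>set ys. card B = q \<longrightarrow> \<not> shat F B) \<longrightarrow> ys \<noteq> [] \<longrightarrow>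
      (\<exists>Q\<subseteq>set ys. card Q \<le> m \<and> (\<forall>S\<in>F. S \<inter> Q = {} \<longrightarrow>
        length (filter (\<lambda>y. y \<in> S) ys) < frac_const q1 / (4 * real q) * length ys))"
    by (elim exE)
  have "\<forall>S\<in>?T. \<exists>\<theta>. inP \<theta> \<and> (\<forall>d :: nat \<Rightarrow> 'y. (\<forall>i<m. d i \<in> \<theta>) \<longrightarrow> (\<exists>x\<in>piece b j S. \<forall>i<m. \<phi> x (d i)))"
  proof
    fix S assume "S \<in> ?T"
    then have "con \<phi> (piece b j S)" using stage by (simp add: stage_def)
    then show "\<exists>\<theta>. inP \<theta> \<and>
      (\<forall>d :: nat \<Rightarrow> 'y. (\<forall>i<m. d i \<in> \<theta>) \<longrightarrow> (\<exists>x\<in>piece b j S. \<forall>i<m. \<phi> x (d i)))"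
      unfolding con_def by (rule spec)
  qed
  from bchoice[OF this] obtain \<theta>S where \<theta>S: "\<And>S. S \<in> ?T \<Longrightarrow> inP (\<theta>S S)"
    "\<And>S d. S \<in> ?T \<Longrightarrow> (\<forall>i<m. d i \<in> \<theta>S S) \<Longrightarrow> \<exists>x\<in>piece b j S. \<forall>i<m. \<phi> x (d i)" by blast
  define \<theta>' where "\<theta>' = Y \<inter> (\<Inter>S\<in>?T. \<theta>S S)"
  have \<theta>': "inP \<theta>'" unfolding \<theta>'_def by (rule inP_INT) (simp_all add: \<theta>S(1))
  have \<theta>sub: "\<theta>' \<subseteq> \<theta>S S" if "S \<in> ?T" for S using that by (auto simp: \<theta>'_def)
  have "\<exists>S\<in>?T. con (rel b j) (Z \<theta>' S)"
  proof (rule con_rel[OF bU \<theta>(1) \<theta>' _ _ \<theta>(2)])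
    show "finite ?T" "?T \<noteq> {}" by auto
    show "vcb (rel b j) (Z \<theta>' S) Y q1" if "S \<in> ?T" for S by (rule q1[OF that])
  qed
  then obtain S where S: "S \<in> ?T" "con (rel b j) (Z \<theta>' S)" by blast
  from S(2)[unfolded con_def, THEN spec[of _ q1]] obtain \<theta>'' where \<theta>'': "inP \<theta>''"
    "\<forall>c :: nat \<Rightarrow> 'y. (\<forall>i<q1. c i \<in> \<theta>'') \<longrightarrow> (\<exists>z\<in>Z \<theta>' S. \<forall>i<q1. rel b j z (c i))"
    by (elim exE conjE)
  have "good \<phi> X \<theta>''"
  proof (rule good_if_con_rel[OF \<theta>' m])
    show "\<exists>x\<in>piece b j S. \<forall>i<m. \<phi> x (d i)" if "\<forall>i<m. d i \<in> \<theta>'" for d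
      by (rule \<theta>S(2)[OF S(1)]) (use that \<theta>sub[OF S(1)] in blast)
    show "vcb (rel b j) (Z \<theta>' S) Y q1" by (rule q1[OF S(1)])
    show "\<theta>'' \<subseteq> Y" by (rule inP_sub[OF \<theta>''(1)])
    show "\<exists>z\<in>Z \<theta>' S. \<forall>i<q1. rel b j z (c i)" if "\<forall>i<q1. c i \<in> \<theta>''" for c
      using \<theta>''(2)[THEN spec[of _ c]] that by (rule mp)
  qed
  then show ?thesis using \<theta>''(1) by blast
qed

end

section \<open>A finite cover by compactness\<close>

lemma (in definable) good_cover:
  fixes \<phi> :: "'x \<Rightarrow> 'y \<Rightarrow> bool"
  assumes nip: "\<And>P. P \<in> DD \<Longrightarrow> \<exists>k. vcb (\<lambda>e b. P (e(0 := b))) U Y k"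
    and tame: "tame \<phi> X" and vc: "vcb \<phi> X Y q" and \<psi>: "dset \<psi>"
    and ne: "\<And>b. b \<in> \<psi> \<Longrightarrow> \<exists>x\<in>X. \<phi> x b" and pq: "pq \<phi> X \<psi> P q"
  shows "\<exists>\<Theta>. finite \<Theta> \<and> (\<forall>\<theta>\<in>\<Theta>. dset \<theta> \<and> good \<phi> X \<theta>) \<and> \<psi> \<subseteq> \<Union>\<Theta>"
proof (rule ccontr)
  assume neg: "\<not> ?thesis"
  define C where "C = insert (\<lambda>b. b \<in> \<psi>) ((\<lambda>\<theta> b. b \<notin> \<theta>) ` {\<theta>. dset \<theta> \<and> good \<phi> X \<theta>})"
  have "\<exists>x. \<forall>Q\<in>D. Q x" if D: "finite D" "D \<subseteq> C" for D
  proof -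
    have "finite (D - {\<lambda>b. b \<in> \<psi>})" "D - {\<lambda>b. b \<in> \<psi>} \<subseteq> (\<lambda>\<theta> b. b \<notin> \<theta>) ` {\<theta>. dset \<theta> \<and> good \<phi> X \<theta>}"
      using D by (auto simp: C_def)
    from finite_subset_image[OF this] obtain \<Theta> where \<Theta>: "\<Theta> \<subseteq> {\<theta>. dset \<theta> \<and> good \<phi> X \<theta>}" "finite \<Theta>"
      "D - {\<lambda>b. b \<in> \<psi>} = (\<lambda>\<theta> b. b \<notin> \<theta>) ` \<Theta>" by blast
    have "\<not> \<psi> \<subseteq> \<Union>\<Theta>" using neg \<Theta>(1,2) by blast
    then obtain b where b: "b \<in> \<psi>" "\<forall>\<theta>\<in>\<Theta>. b \<notin> \<theta>" by blast
    have "Q b" if Q: "Q \<in> D" for Q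
    proof (cases "Q = (\<lambda>b. b \<in> \<psi>)")
      case True
      then show ?thesis using b(1) by simp
    next
      case False
      then have "Q \<in> (\<lambda>\<theta> b. b \<notin> \<theta>) ` \<Theta>" using \<Theta>(3) Q by blast
      then show ?thesis using b(2) by auto
    qed
    then have "\<forall>Q\<in>D. Q b" by (intro ballI)
    then show ?thesis by (rule exI[of "\<lambda>b. \<forall>Q\<in>D. Q b" b])
  qed
  then obtain p where p: "ultra p" "\<And>Q. Q \<in> C \<Longrightarrow> p Q" using ultra_exists[of C] by metis
  have p\<psi>: "p (\<lambda>b. b \<in> \<psi>)" by (rule p(2)) (simp add: C_def)
  have pY: "p (\<lambda>b. b \<in> Y)"
  proof (rule ultra_mono[OF p(1) p\<psi>])
    show "b \<in> Y" if "b \<in> \<psi>" for b using that \<psi> by (auto simp: dset_def)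
  qed
  interpret nip_type Y DD p
    by unfold_locales (fact p(1) pY nip)+
  have in\<psi>: "inP \<psi>" using \<psi> p\<psi> by (simp add: inP_def)
  have con: "con \<phi> X" by (rule pq_con[OF tame vc in\<psi> ne pq])
  interpret nip_relation Y DD p \<phi> X q
    by unfold_locales (fact tame vc con)+
  obtain \<theta> where \<theta>: "inP \<theta>" "good \<phi> X \<theta>" using good_inP by blast
  have "p (\<lambda>b. b \<notin> \<theta>)" by (rule p(2)) (use \<theta> in \<open>auto simp: C_def inP_def\<close>)
  then show False using \<theta>(1) by (simp add: inP_def ultra_not[OF p(1)])
qed

section \<open>Formulas and parameters\<close>

lemma eval_cong:
  "(\<And>v. v \<in> fv_trm t \<Longrightarrow> e v = e' v) \<Longrightarrow> eval N e t = eval N e' t"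
proof (induct t)
  case (Fun f ts)
  have "eval N e t = eval N e' t" if t: "t \<in> set ts" for t
    by (rule Fun.hyps[OF t]) (use Fun.prems t in auto)
  then have "map (eval N e) ts = map (eval N e') ts" by simp
  then show ?case by (simp only: eval.simps)
qed simp

lemma sat_cong:
  "(\<And>v. v \<in> fv \<chi> \<Longrightarrow> e v = e' v) \<Longrightarrow> sat N e \<chi> \<longleftrightarrow> sat N e' \<chi>"
proof (induct \<chi> arbitrary: e e')
  case (Exists v \<chi>)
  have "sat N (e(v := a)) \<chi> \<longleftrightarrow> sat N (e'(v := a)) \<chi>" for a
    by (rule Exists.hyps) (use Exists.prems in simp)
  then show ?case by simp
next
  case (Rel r ts)
  have "map (eval N e) ts = map (eval N e') ts" using Rel by (auto intro!: eval_cong)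
  then show ?case by (simp only: sat.simps)
next
  case (Eq t u)
  have "eval N e t = eval N e' t" "eval N e u = eval N e' u" using Eq by (auto intro!: eval_cong)
  then show ?case by simp
next
  case (Neg \<chi>)
  have "sat N e \<chi> \<longleftrightarrow> sat N e' \<chi>" by (rule Neg.hyps) (use Neg.prems in simp)
  then show ?case by simp
next
  case (Conj \<chi> \<chi>')
  have "sat N e \<chi> \<longleftrightarrow> sat N e' \<chi>" by (rule Conj.hyps) (use Conj.prems in simp)
  moreover have "sat N e \<chi>' \<longleftrightarrow> sat N e' \<chi>'" by (rule Conj.hyps) (use Conj.prems in simp)
  ultimately show ?case by simp
qed

lemma finite_fv_trm: "finite (fv_trm t)"
  by (induct t) auto

lemma finite_fv: "finite (fv \<chi>)"
  by (induct \<chi>) (auto simp: finite_fv_trm)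

lemma fresh_var:
  fixes V :: "'s var set"
  assumes "finite V" shows "\<exists>n. (s, n) \<notin> V"
proof -
  have "\<not> range (Pair s) \<subseteq> V"
    using finite_subset[OF _ assms] range_inj_infinite[of "Pair s :: nat \<Rightarrow> _"] by (metis Pair_inject injI)
  then show ?thesis by blast
qed

lemma eval_subst_trm: "eval N e (subst_trm \<theta> t) = eval N (\<lambda>v. eval N e (\<theta> v)) t"
  by (induct t) (auto intro!: arg_cong[where f = "fint N _"])

lemma fv_subst_trm: "fv_trm (subst_trm \<theta> t) = (\<Union>v\<in>fv_trm t. fv_trm (\<theta> v))"
  by (induct t) auto

lemma has_sort_subst_trm:
  assumes "has_sort L t s" "\<And>v. has_sort L (\<theta> v) (fst v)"
  shows "has_sort L (subst_trm \<theta> t) s"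
  using assms(1)
proof (induct rule: has_sort.induct)
  case (var v)
  show ?case using assms(2) by simp
next
  case (app f ts)
  have "list_all2 (has_sort L) (map (subst_trm \<theta>) ts) (fdom L f)"
    using app(2) by (auto simp: list_all2_conv_all_nth)
  then show ?case using app(1) by (simp add: has_sort.app)
qed

text \<open>Capture-avoiding substitution: \<^const>\<open>subst\<close> does not rename bound variables.\<close>

lemma subst_exists:
  assumes "wf_fm L \<chi>" "\<And>v. has_sort L (\<theta> v) (fst v)"
  shows "\<exists>\<chi>'. wf_fm L \<chi>' \<and> fv \<chi>' \<subseteq> (\<Union>v\<in>fv \<chi>. fv_trm (\<theta> v)) \<and>
    (\<forall>e. sat N e \<chi>' \<longleftrightarrow> sat N (\<lambda>v. eval N e (\<theta> v)) \<chi>)"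
  using assms
proof (induct \<chi> arbitrary: \<theta>)
  case (Eq t u)
  have "wf_fm L (Eq (subst_trm \<theta> t) (subst_trm \<theta> u))"
    using Eq by (auto intro!: has_sort_subst_trm)
  then show ?case
    by (intro exI[of _ "Eq (subst_trm \<theta> t) (subst_trm \<theta> u)"]) (auto simp: eval_subst_trm fv_subst_trm)
next
  case (Rel r ts)
  have "wf_fm L (Rel r (map (subst_trm \<theta>) ts))"
    using Rel by (auto simp: list_all2_conv_all_nth intro!: has_sort_subst_trm)
  moreover have "map (eval N e \<circ> subst_trm \<theta>) ts = map (eval N (\<lambda>v. eval N e (\<theta> v))) ts" for e
    by (simp add: eval_subst_trm)
  then have "sat N e (Rel r (map (subst_trm \<theta>) ts)) \<longleftrightarrow> sat N (\<lambda>v. eval N e (\<theta> v)) (Rel r ts)" for e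
    by (simp only: sat.simps list.map_comp)
  ultimately show ?case
    by (intro exI[of _ "Rel r (map (subst_trm \<theta>) ts)"]) (auto simp: fv_subst_trm simp del: sat.simps)
next
  case (Neg \<chi>)
  then obtain \<chi>' where "wf_fm L \<chi>'" "fv \<chi>' \<subseteq> (\<Union>v\<in>fv \<chi>. fv_trm (\<theta> v))"
    "\<forall>e. sat N e \<chi>' \<longleftrightarrow> sat N (\<lambda>v. eval N e (\<theta> v)) \<chi>" by (metis wf_fm.simps(3))
  then show ?case by (intro exI[of _ "Neg \<chi>'"]) simp
next
  case (Conj \<chi>1 \<chi>2)
  obtain \<chi>1' where 1: "wf_fm L \<chi>1'" "fv \<chi>1' \<subseteq> (\<Union>v\<in>fv \<chi>1. fv_trm (\<theta> v))"
    "\<forall>e. sat N e \<chi>1' \<longleftrightarrow> sat N (\<lambda>v. eval N e (\<theta> v)) \<chi>1" using Conj by (metis wf_fm.simps(4))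
  obtain \<chi>2' where 2: "wf_fm L \<chi>2'" "fv \<chi>2' \<subseteq> (\<Union>v\<in>fv \<chi>2. fv_trm (\<theta> v))"
    "\<forall>e. sat N e \<chi>2' \<longleftrightarrow> sat N (\<lambda>v. eval N e (\<theta> v)) \<chi>2" using Conj by (metis wf_fm.simps(4))
  show ?case using 1 2 by (intro exI[of _ "Conj \<chi>1' \<chi>2'"]) auto
next
  case (Exists v \<chi>)
  let ?V = "\<Union>u\<in>fv \<chi>. fv_trm (\<theta> u)"
  obtain n where n: "(fst v, n) \<notin> ?V"
    using fresh_var[of ?V "fst v"] finite_fv finite_fv_trm by blast
  define w where "w = (fst v, n)"
  define \<theta>' where "\<theta>' = \<theta>(v := Var w)"
  have "has_sort L (\<theta>' u) (fst u)" for u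
    using Exists.prems(2) has_sort.var[of L w] by (simp add: \<theta>'_def w_def)
  then obtain \<chi>' where 1: "wf_fm L \<chi>'" "fv \<chi>' \<subseteq> (\<Union>v\<in>fv \<chi>. fv_trm (\<theta>' v))"
    "\<forall>e. sat N e \<chi>' \<longleftrightarrow> sat N (\<lambda>v. eval N e (\<theta>' v)) \<chi>" using Exists by (metis wf_fm.simps(5))
  have "sat N (e(w := a)) \<chi>' \<longleftrightarrow> sat N ((\<lambda>u. eval N e (\<theta> u))(v := a)) \<chi>" for e a
  proof -
    have "eval N (e(w := a)) (\<theta>' u) = ((\<lambda>u. eval N e (\<theta> u))(v := a)) u" if u: "u \<in> fv \<chi>" for u
    proof (cases "u = v")
      case False
      have "eval N (e(w := a)) (\<theta> u) = eval N e (\<theta> u)"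
        by (rule eval_cong) (use n u in \<open>auto simp: w_def\<close>)
      then show ?thesis using False by (simp add: \<theta>'_def)
    qed (simp add: \<theta>'_def)
    then show ?thesis unfolding 1(3)[rule_format] by (rule sat_cong)
  qed
  moreover have "fv \<chi>' - {w} \<subseteq> (\<Union>u\<in>fv \<chi> - {v}. fv_trm (\<theta> u))"
    using 1(2) by (auto simp: \<theta>'_def split: if_split_asm)
  moreover have "fst w = fst v" by (simp add: w_def)
  ultimately show ?case using 1(1) by (intro exI[of _ "Exists w \<chi>'"]) simp
qed

text \<open>A variant of \<open>assign\<close> with default values. It also describes simultaneous
  substitutions, with \<open>Var\<close> as the default.\<close>

definition override :: "('v \<Rightarrow> 'a) \<Rightarrow> 'v list \<Rightarrow> 'a list \<Rightarrow> 'v \<Rightarrow> 'a" where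
  "override e vs as v = (case map_of (zip vs as) v of Some c \<Rightarrow> c | None \<Rightarrow> e v)"

lemma assign_override: "assign vs as = override (\<lambda>_. undefined) vs as"
  by (simp add: fun_eq_iff assign_def override_def)

lemma override_nth:
  assumes "distinct vs" "length as = length vs" "k < length vs"
  shows "override e vs as (vs ! k) = as ! k"
  using assms by (simp add: override_def map_of_zip_nth)

lemma override_notin: "v \<notin> set vs \<Longrightarrow> override e vs as v = e v"
  unfolding override_def by (metis in_set_zip map_of_SomeD nth_mem option.case_eq_if option.collapse fst_conv)

primrec Exs :: "'s var list \<Rightarrow> ('s, 'f, 'r) fm \<Rightarrow> ('s, 'f, 'r) fm" where
  "Exs [] \<chi> = \<chi>"
| "Exs (v # vs) \<chi> = Exists v (Exs vs \<chi>)"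

lemma wf_Exs: "wf_fm L (Exs vs \<chi>) \<longleftrightarrow> wf_fm L \<chi>"
  by (induct vs) simp_all

lemma sat_Exs:
  "distinct vs \<Longrightarrow> sat N e (Exs vs \<chi>) \<longleftrightarrow> (\<exists>as\<in>var_space N vs. sat N (override e vs as) \<chi>)"
proof (induct vs arbitrary: e)
  case Nil
  then show ?case by (simp add: var_space_def tuples_def override_def)
next
  case (Cons v vs)
  have o: "override (e(v := a)) vs as = override e (v # vs) (a # as)" for a as
  proof
    fix u
    show "override (e(v := a)) vs as u = override e (v # vs) (a # as) u"
      using Cons.prems override_notin[of v vs "e(v := a)" as]
      by (cases "u = v") (simp_all add: override_def split: option.split)
  qed
  have "sat N e (Exs (v # vs) \<chi>) \<longleftrightarrow>
      (\<exists>a\<in>univ N (fst v). \<exists>as\<in>var_space N vs. sat N (override e (v # vs) (a # as)) \<chi>)"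
    using Cons by (simp add: o)
  also have "\<dots> \<longleftrightarrow> (\<exists>as\<in>var_space N (v # vs). sat N (override e (v # vs) as) \<chi>)"
    by (fastforce simp: var_space_def tuples_def list_all2_Cons2)
  finally show ?case .
qed

lemma var_space_iff:
  "b \<in> var_space N vs \<longleftrightarrow> length b = length vs \<and> (\<forall>k<length vs. b ! k \<in> univ N (fst (vs ! k)))"
  by (auto simp: var_space_def tuples_def list_all2_conv_all_nth)

section \<open>Parameters replaced by variables\<close>

primrec bv :: "('s, 'f, 'r) fm \<Rightarrow> 's var set" where
  "bv (Eq t u) = {}"
| "bv (Rel r ts) = {}"
| "bv (Neg \<phi>) = bv \<phi>"
| "bv (Conj \<phi> \<chi>) = bv \<phi> \<union> bv \<chi>"
| "bv (Exists v \<phi>) = insert v (bv \<phi>)"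

lemma finite_bv: "finite (bv \<chi>)"
  by (induct \<chi>) auto

primrec params_trm :: "('s, 'f + 'c) trm \<Rightarrow> 'c set" where
  "params_trm (Var v) = {}"
| "params_trm (Fun f ts) = (case f of Inl g \<Rightarrow> \<Union> (set (map params_trm ts)) | Inr c \<Rightarrow> {c})"

primrec params :: "('s, 'f + 'c, 'r) fm \<Rightarrow> 'c set" where
  "params (Eq t u) = params_trm t \<union> params_trm u"
| "params (Rel r ts) = \<Union> (set (map params_trm ts))"
| "params (Neg \<phi>) = params \<phi>"
| "params (Conj \<phi> \<chi>) = params \<phi> \<union> params \<chi>"
| "params (Exists v \<phi>) = params \<phi>"

lemma finite_params_trm: "finite (params_trm t)"
  by (induct t) (auto split: sum.split)

lemma finite_params: "finite (params \<chi>)"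
  by (induct \<chi>) (auto simp: finite_params_trm)

primrec unparam_trm :: "('c \<Rightarrow> 's var) \<Rightarrow> ('s, 'f + 'c) trm \<Rightarrow> ('s, 'f) trm" where
  "unparam_trm \<kappa> (Var v) = Var v"
| "unparam_trm \<kappa> (Fun f ts) = (case f of Inl g \<Rightarrow> Fun g (map (unparam_trm \<kappa>) ts) | Inr c \<Rightarrow> Var (\<kappa> c))"

primrec unparam :: "('c \<Rightarrow> 's var) \<Rightarrow> ('s, 'f + 'c, 'r) fm \<Rightarrow> ('s, 'f, 'r) fm" where
  "unparam \<kappa> (Eq t u) = Eq (unparam_trm \<kappa> t) (unparam_trm \<kappa> u)"
| "unparam \<kappa> (Rel r ts) = Rel r (map (unparam_trm \<kappa>) ts)"
| "unparam \<kappa> (Neg \<phi>) = Neg (unparam \<kappa> \<phi>)"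
| "unparam \<kappa> (Conj \<phi> \<chi>) = Conj (unparam \<kappa> \<phi>) (unparam \<kappa> \<chi>)"
| "unparam \<kappa> (Exists v \<phi>) = Exists v (unparam \<kappa> \<phi>)"

lemma expansion_simps [simp]:
  "univ (expansion M) = univ M" "rint (expansion M) = rint M"
  "fint (expansion M) (Inl g) = fint M g" "fint (expansion M) (Inr c) as = snd c"
  by (simp_all add: expansion_def split: prod.split)

lemma eval_unparam_trm:
  "(\<And>c. c \<in> params_trm t \<Longrightarrow> e (\<kappa> c) = snd c) \<Longrightarrow> eval M e (unparam_trm \<kappa> t) = eval (expansion M) e t"
proof (induct t)
  case (Fun f ts)
  show ?case
  proof (cases f)
    case (Inl g)
    have "eval M e (unparam_trm \<kappa> t) = eval (expansion M) e t" if t: "t \<in> set ts" for t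
      by (rule Fun.hyps[OF t]) (use Fun.prems t Inl in auto)
    then have "map (eval M e \<circ> unparam_trm \<kappa>) ts = map (eval (expansion M) e) ts" by simp
    then show ?thesis unfolding Inl by (simp only: unparam_trm.simps sum.case eval.simps list.map_comp expansion_simps)
  next
    case (Inr c)
    then show ?thesis using Fun.prems by simp
  qed
qed simp

text \<open>A quantifier must not capture a variable that stands for a parameter, hence the
  condition on \<open>bv\<close>.\<close>

lemma sat_unparam:
  "(\<And>c. c \<in> params \<chi> \<Longrightarrow> e (\<kappa> c) = snd c) \<Longrightarrow> bv \<chi> \<inter> \<kappa> ` params \<chi> = {} \<Longrightarrow>
    sat M e (unparam \<kappa> \<chi>) \<longleftrightarrow> sat (expansion M) e \<chi>"
proof (induct \<chi> arbitrary: e)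
  case (Rel r ts)
  have "map (eval M e \<circ> unparam_trm \<kappa>) ts = map (eval (expansion M) e) ts"
    using Rel by (auto intro!: eval_unparam_trm)
  then show ?case by (simp only: unparam.simps sat.simps list.map_comp expansion_simps)
next
  case (Eq t u)
  have "eval M e (unparam_trm \<kappa> t) = eval (expansion M) e t" "eval M e (unparam_trm \<kappa> u) = eval (expansion M) e u"
    using Eq by (auto intro!: eval_unparam_trm)
  then show ?case by simp
next
  case (Conj \<chi>1 \<chi>2)
  have "sat M e (unparam \<kappa> \<chi>1) \<longleftrightarrow> sat (expansion M) e \<chi>1"
    by (rule Conj.hyps(1)) (use Conj.prems in auto)
  moreover have "sat M e (unparam \<kappa> \<chi>2) \<longleftrightarrow> sat (expansion M) e \<chi>2"
    by (rule Conj.hyps(2)) (use Conj.prems in auto)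
  ultimately show ?case by simp
next
  case (Exists v \<chi>)
  have "sat M (e(v := a)) (unparam \<kappa> \<chi>) \<longleftrightarrow> sat (expansion M) (e(v := a)) \<chi>" for a
    by (rule Exists.hyps) (use Exists.prems in auto)
  then show ?case by simp
qed simp

lemma has_sort_unparam_trm:
  assumes "has_sort (lang_over L M) t s" "\<And>c. fst (\<kappa> c) = fst c"
  shows "has_sort L (unparam_trm \<kappa> t) s"
  using assms(1)
proof (induct rule: has_sort.induct)
  case (var v)
  show ?case by (simp add: has_sort.var)
next
  case (app f ts)
  show ?case
  proof (cases f)
    case (Inl g)
    have "list_all2 (has_sort L) (map (unparam_trm \<kappa>) ts) (fdom L g)"
      using app(2) Inl by (auto simp: list_all2_conv_all_nth lang_over_def)
    moreover have "g \<in> funs L" using app(1) Inl by (auto simp: lang_over_def)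
    ultimately have "has_sort L (Fun g (map (unparam_trm \<kappa>) ts)) (fcod L g)" by (simp add: has_sort.app)
    then show ?thesis using Inl by (simp add: lang_over_def)
  next
    case (Inr c)
    then show ?thesis using has_sort.var[of L "\<kappa> c"] assms(2) by (simp add: lang_over_def)
  qed
qed

lemma wf_unparam:
  assumes "wf_fm (lang_over L M) \<chi>" "\<And>c. fst (\<kappa> c) = fst c"
  shows "wf_fm L (unparam \<kappa> \<chi>)"
  using assms(1)
proof (induct \<chi>)
  case (Eq t u)
  then show ?case using has_sort_unparam_trm[OF _ assms(2)] by (auto intro: has_sort_unparam_trm[OF _ assms(2)])
next
  case (Rel r ts)
  then show ?case
    by (auto simp: list_all2_conv_all_nth lang_over_def intro: has_sort_unparam_trm[OF _ assms(2), unfolded lang_over_def])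
qed simp_all

text \<open>A sort has only countably many variables while parameters may be more numerous, so
  injectivity is confined to the finite set \<open>C\<close>.\<close>

lemma fresh_param_vars:
  assumes "finite C" "finite V"
  shows "\<exists>\<kappa> :: 's \<times> 'a \<Rightarrow> 's var. inj_on \<kappa> C \<and> (\<forall>c. fst (\<kappa> c) = fst c) \<and> (\<forall>c. \<kappa> c \<notin> V)"
proof -
  obtain h :: "'s \<times> 'a \<Rightarrow> nat" where h: "inj_on h C" using finite_imp_inj_to_nat_seg[OF assms(1)] by metis
  obtain B where B: "\<forall>n\<in>snd ` V. n < B" using assms(2) finite_nat_set_iff_bounded by blast
  show ?thesis
  proof (intro exI[of _ "\<lambda>c. (fst c, B + h c)"] conjI allI)
    show "inj_on (\<lambda>c. (fst c, B + h c)) C" using h by (auto simp: inj_on_def)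
    show "(fst c, B + h c) \<notin> V" for c using B by force
  qed simp
qed

text \<open>Each variable is either kept or replaced by a closed term, so nothing can be captured
  although \<open>subst\<close> does not rename.\<close>

lemma sat_subst_closed:
  assumes "\<And>v. \<theta> v = Var v \<or> fv_trm (\<theta> v) = {}"
  shows "sat N e (subst \<theta> \<chi>) \<longleftrightarrow> sat N (\<lambda>v. eval N e (\<theta> v)) \<chi>"
  using assms
proof (induct \<chi> arbitrary: \<theta> e)
  case (Rel r ts)
  have "map (eval N e \<circ> subst_trm \<theta>) ts = map (eval N (\<lambda>v. eval N e (\<theta> v))) ts" by (simp add: eval_subst_trm)
  then show ?case by (simp only: subst.simps sat.simps list.map_comp)
next
  case (Exists v \<chi>)
  have "sat N (e(v := a)) (subst (\<theta>(v := Var v)) \<chi>) \<longleftrightarrow> sat N ((\<lambda>u. eval N e (\<theta> u))(v := a)) \<chi>" for a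
  proof -
    have "(\<lambda>u. eval N (e(v := a)) ((\<theta>(v := Var v)) u)) = (\<lambda>u. eval N e (\<theta> u))(v := a)"
    proof
      fix u
      show "eval N (e(v := a)) ((\<theta>(v := Var v)) u) = ((\<lambda>u. eval N e (\<theta> u))(v := a)) u"
      proof (cases "u = v")
        case False
        have "eval N (e(v := a)) (\<theta> u) = eval N e (\<theta> u)"
          by (rule eval_cong) (use Exists.prems[of u] False in auto)
        then show ?thesis using False by simp
      qed simp
    qed
    moreover have "sat N (e(v := a)) (subst (\<theta>(v := Var v)) \<chi>) \<longleftrightarrow>
        sat N (\<lambda>u. eval N (e(v := a)) ((\<theta>(v := Var v)) u)) \<chi>"
    proof (rule Exists.hyps)
      show "(\<theta>(v := Var v)) u = Var u \<or> fv_trm ((\<theta>(v := Var v)) u) = {}" for u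
        using Exists.prems[of u] by simp
    qed
    ultimately show ?thesis by (simp only:)
  qed
  then show ?case by simp
qed (simp_all add: eval_subst_trm)

lemma var_space_expansion [simp]: "var_space (expansion M) vs = var_space M vs"
  by (simp add: var_space_def tuples_def)

lemma has_sort_param: "a \<in> univ M s \<Longrightarrow> has_sort (lang_over L M) (Fun (Inr (s, a)) []) s"
  using has_sort.app[of "Inr (s, a)" "lang_over L M" "[]"] by (simp add: lang_over_def)

lemma params_trm_sorted: "has_sort (lang_over L M) t s \<Longrightarrow> params_trm t \<subseteq> {(s, a). a \<in> univ M s}"
proof (induct rule: has_sort.induct)
  case (app f ts)
  show ?case
  proof (cases f)
    case (Inl g)
    have "params_trm t \<subseteq> {(s, a). a \<in> univ M s}" if t: "t \<in> set ts" for t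
    proof -
      obtain i where "i < length ts" "t = ts ! i" using t unfolding in_set_conv_nth by blast
      then show ?thesis using app(2) unfolding list_all2_conv_all_nth by blast
    qed
    then show ?thesis using Inl by auto
  next
    case (Inr c)
    then show ?thesis using app(1) by (auto simp: lang_over_def)
  qed
qed simp

lemma params_sorted: "wf_fm (lang_over L M) \<chi> \<Longrightarrow> params \<chi> \<subseteq> {(s, a). a \<in> univ M s}"
proof (induct \<chi>)
  case (Eq t u)
  then show ?case using params_trm_sorted by fastforce
next
  case (Rel r ts)
  have "params_trm t \<subseteq> {(s, a). a \<in> univ M s}" if t: "t \<in> set ts" for t
  proof -
    obtain i where "i < length ts" "t = ts ! i" using t unfolding in_set_conv_nth by blast
    then have "has_sort (lang_over L M) t (rdom (lang_over L M) r ! i)"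
      using Rel by (simp add: list_all2_conv_all_nth)
    then show ?thesis by (rule params_trm_sorted)
  qed
  then show ?case by auto
qed auto

lemma subst_tuple:
  assumes "distinct vs" "length ts = length vs"
    and "\<And>k. k < length vs \<Longrightarrow> has_sort L (ts ! k) (fst (vs ! k))"
    and \<chi>: "formula_in L vs \<chi>"
  shows "\<exists>\<chi>'. wf_fm L \<chi>' \<and> (\<forall>e. sat N e \<chi>' \<longleftrightarrow> holds N \<chi> vs (map (eval N e) ts))"
proof -
  define \<theta> where "\<theta> = override Var vs ts"
  have "has_sort L (\<theta> v) (fst v)" for v
  proof (cases "v \<in> set vs")
    case True
    then obtain k where "k < length vs" "v = vs ! k" by (auto simp: in_set_conv_nth)
    then show ?thesis using assms by (simp add: \<theta>_def override_nth)
  qed (simp add: \<theta>_def override_notin has_sort.var)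
  with subst_exists[of L \<chi> \<theta> N] \<chi> obtain \<chi>' where \<chi>': "wf_fm L \<chi>'"
    "\<And>e. sat N e \<chi>' \<longleftrightarrow> sat N (\<lambda>v. eval N e (\<theta> v)) \<chi>" by (auto simp: formula_in_def)
  have "sat N (\<lambda>v. eval N e (\<theta> v)) \<chi> \<longleftrightarrow> holds N \<chi> vs (map (eval N e) ts)" for e
    unfolding holds_def
  proof (rule sat_cong)
    fix v assume "v \<in> fv \<chi>"
    then have "v \<in> set vs" using \<chi> by (auto simp: formula_in_def)
    then obtain k where "k < length vs" "v = vs ! k" unfolding in_set_conv_nth by blast
    then show "eval N e (\<theta> v) = assign vs (map (eval N e) ts) v"
      using assms(1,2) by (simp add: \<theta>_def assign_override override_nth)
  qed
  then show ?thesis using \<chi>' by blast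
qed

text \<open>A value of the infimum below \<open>d\<close> is attained at some \<open>n\<close>
  without shattered sets of size \<open>n + 1\<close>. Indexed shattering forces \<open>b\<close> to
  be injective on \<open>I\<close>, so it yields a shattered set of the same size.\<close>

lemma vc_dim_less:
  assumes "vc_dim Y ((\<lambda>a. {b\<in>Y. R a b}) ` X) < d"
  shows "\<exists>n. enat n < d \<and> vcb R X Y (n + 1)"
proof -
  let ?F = "(\<lambda>a. {b\<in>Y. R a b}) ` X"
  have "\<exists>n\<in>{n. \<not> (\<exists>A\<subseteq>Y. finite A \<and> card A = n + 1 \<and> shatters ?F A)}. enat n < d"
    using assms unfolding vc_dim_def Inf_less_iff bex_simps .
  then obtain n where n: "enat n < d" "\<not> (\<exists>A\<subseteq>Y. finite A \<and> card A = n + 1 \<and> shatters ?F A)"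
    by (elim bexE CollectE)
  have "vcb R X Y (n + 1)"
    unfolding vcb_def
  proof (intro allI impI notI)
    fix I and b :: "nat \<Rightarrow> 'a" assume I: "finite I \<and> card I = n + 1 \<and> b ` I \<subseteq> Y" and s: "shat_at R X I b"
    have "inj_on b I"
    proof
      fix i j assume ij: "i \<in> I" "j \<in> I" "b i = b j"
      then have "{i} \<subseteq> I" by simp
      from s[unfolded shat_at_def, THEN spec, THEN mp, OF this]
      obtain a where a: "\<forall>l\<in>I. R a (b l) \<longleftrightarrow> l \<in> {i}" by (elim bexE)
      have "R a (b i)" using bspec[OF a ij(1)] by (rule iffD2) (rule singletonI)
      then have "R a (b j)" unfolding ij(3) .
      with bspec[OF a ij(2)] have "j \<in> {i}" by (rule iffD1)
      then show "i = j" by (elim singletonE) (rule sym)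
    qed
    then have "card (b ` I) = n + 1" using I by (simp only: card_image)
    moreover have "finite (b ` I)" using I by (elim conjE) (rule finite_imageI)
    moreover have "shatters ?F (b ` I)"
      unfolding shatters_def
    proof (intro allI impI)
      fix S assume S: "S \<subseteq> b ` I"
      have "{i\<in>I. b i \<in> S} \<subseteq> I" by blast
      from s[unfolded shat_at_def, THEN spec, THEN mp, OF this]
      obtain a where a: "a \<in> X" "\<forall>i\<in>I. R a (b i) \<longleftrightarrow> i \<in> {i\<in>I. b i \<in> S}" by (elim bexE)
      have Rb: "R a (b i) \<longleftrightarrow> b i \<in> S" if "i \<in> I" for i using bspec[OF a(2) that] that by simp
      have "S = {b\<in>Y. R a b} \<inter> b ` I"
      proof (intro equalityI subsetI)
        fix z assume z: "z \<in> S"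
        obtain i where i: "i \<in> I" "z = b i" using subsetD[OF S z] by (rule imageE)
        have "z \<in> Y" using I i by blast
        then show "z \<in> {b\<in>Y. R a b} \<inter> b ` I" using i Rb[OF i(1)] z by simp
      next
        fix z assume "z \<in> {b\<in>Y. R a b} \<inter> b ` I"
        then obtain i where "i \<in> I" "z = b i" "R a (b i)" by auto
        then show "z \<in> S" using Rb by simp
      qed
      moreover have "{b\<in>Y. R a b} \<in> ?F" using a(1) by (rule imageI)
      ultimately show "\<exists>B\<in>?F. S = B \<inter> b ` I" by (rule bexI)
    qed
    moreover have "b ` I \<subseteq> Y" using I by (elim conjE)
    ultimately have "\<exists>A\<subseteq>Y. finite A \<and> card A = n + 1 \<and> shatters ?F A"
      by (intro exI[of _ "b ` I"] conjI)
    with n(2) show False by (rule notE)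
  qed
  then show ?thesis using n(1) by blast
qed

section \<open>The definable relations of a structure\<close>

locale fo_structure =
  fixes L :: "('s, 'f, 'r) lang" and M :: "('s, 'f, 'r, 'a) struct" and y :: "'s var list"
  assumes univ_ne: "univ M s \<noteq> {}" and distinct_y: "distinct y"
begin

abbreviation N where "N \<equiv> expansion M"
abbreviation LM where "LM \<equiv> lang_over L M"
abbreviation Y where "Y \<equiv> var_space M y"

text \<open>Coding by \<open>prod_encode\<close> makes all copies different even for equal sorts,
  and leaves numbers whose second component is at least \<open>length y\<close> free for other
  variables.\<close>

definition copy :: "nat \<Rightarrow> nat \<Rightarrow> 's var" where
  "copy i k = (fst (y ! k), prod_encode (i, k))"

definition cidx :: "'s var \<Rightarrow> nat \<times> nat" where
  "cidx v = prod_decode (snd v)"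

definition is_copy :: "'s var \<Rightarrow> bool" where
  "is_copy v \<longleftrightarrow> snd (cidx v) < length y \<and> v = copy (fst (cidx v)) (snd (cidx v))"

abbreviation copies :: "nat \<Rightarrow> 's var list" where
  "copies i \<equiv> map (copy i) [0..<length y]"

text \<open>A sequence of tuples is a valuation of the variables \<open>copy i k\<close>, where \<open>i\<close> is the index of the
  tuple and \<open>k\<close> is the coordinate; all other variables get fixed values.\<close>

definition val :: "(nat \<Rightarrow> 'a list) \<Rightarrow> 's var \<Rightarrow> 'a" where
  "val e v = (if is_copy v then e (fst (cidx v)) ! snd (cidx v) else SOME a. a \<in> univ M (fst v))"

text \<open>The formula may have arbitrary free variables: those that are not copies have fixed
  values under \<open>val\<close> and act as further parameters.\<close>

definition DD :: "((nat \<Rightarrow> 'a list) \<Rightarrow> bool) set" where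
  "DD = {P. \<exists>\<chi>. wf_fm LM \<chi> \<and> (\<forall>e. range e \<subseteq> Y \<longrightarrow> (P e \<longleftrightarrow> sat N (val e) \<chi>))}"

lemma copy_eq [simp]: "copy i k = copy i' k' \<longleftrightarrow> i = i' \<and> k = k'"
  by (auto simp: copy_def)

lemma cidx_copy [simp]: "cidx (copy i k) = (i, k)"
  by (simp add: cidx_def copy_def)

lemma is_copy_copy [simp]: "is_copy (copy i k) \<longleftrightarrow> k < length y"
  by (simp add: is_copy_def)

lemma is_copyE: "is_copy v \<Longrightarrow> \<exists>i k. k < length y \<and> v = copy i k"
  unfolding is_copy_def by blast

lemma fst_copy [simp]: "fst (copy i k) = fst (y ! k)"
  by (simp add: copy_def)

lemma distinct_copies: "distinct (copies i)"
  by (simp add: distinct_map inj_on_def)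

lemma val_copy [simp]: "k < length y \<Longrightarrow> val e (copy i k) = e i ! k"
  by (simp add: val_def)

lemma Y_iff: "b \<in> Y \<longleftrightarrow> length b = length y \<and> (\<forall>k<length y. b ! k \<in> univ M (fst (y ! k)))"
  by (rule var_space_iff)

lemma val_sorted:
  assumes "range e \<subseteq> Y" shows "val e v \<in> univ M (fst v)"
proof (cases "is_copy v")
  case True
  then obtain i k where v: "k < length y" "v = copy i k" using is_copyE by blast
  have "e i \<in> Y" using assms by blast
  then show ?thesis using v by (simp add: Y_iff)
next
  case False
  then show ?thesis using univ_ne[of "fst v"] by (simp add: val_def some_in_eq)
qed

lemma val_upd_notin: "v \<notin> set (copies i) \<Longrightarrow> val (e(i := b)) v = val e v"
  by (cases "is_copy v") (auto dest!: is_copyE simp: val_def)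

lemma override_val:
  assumes "b \<in> Y" shows "override (val e) (copies i) b = val (e(i := b))"
proof
  fix v
  show "override (val e) (copies i) b v = val (e(i := b)) v"
  proof (cases "v \<in> set (copies i)")
    case True
    then obtain k where k: "k < length y" "v = copies i ! k" by auto
    then have "override (val e) (copies i) b v = b ! k"
      using override_nth[OF distinct_copies, of b i k "val e"] assms by (simp add: Y_iff)
    then show ?thesis using k by simp
  next
    case False
    show ?thesis unfolding override_notin[OF False] val_upd_notin[OF False] by (rule refl)
  qed
qed

lemma Y_copies: "var_space M (copies i) = Y"
  by (auto simp: var_space_iff)

lemma Y_ne: "\<exists>b. b \<in> Y"
  by (rule exI[of _ "map (\<lambda>k. SOME a. a \<in> univ M (fst (y ! k))) [0..<length y]"])
    (simp add: Y_iff some_in_eq univ_ne)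

lemma DD_substI:
  assumes "wf_fm LM \<chi>" "\<And>v. has_sort LM (\<theta> v) (fst v)"
    and "\<And>e. range e \<subseteq> Y \<Longrightarrow> P e \<longleftrightarrow> sat N (\<lambda>v. eval N (val e) (\<theta> v)) \<chi>"
  shows "P \<in> DD"
proof -
  obtain \<chi>' where "wf_fm LM \<chi>'" "\<forall>e. sat N e \<chi>' \<longleftrightarrow> sat N (\<lambda>v. eval N e (\<theta> v)) \<chi>"
    using subst_exists[of LM \<chi> \<theta> N] assms(1,2) by blast
  then show ?thesis unfolding DD_def using assms(3) by (intro CollectI exI[of _ \<chi>']) simp
qed

lemma true_wf: "wf_fm LM (Eq (Var v) (Var v))"
  using has_sort.var[of LM v] by auto

lemma DD_E:
  assumes "P \<in> DD"
  shows "\<exists>\<chi>. wf_fm LM \<chi> \<and> (\<forall>e. range e \<subseteq> Y \<longrightarrow> (P e \<longleftrightarrow> sat N (val e) \<chi>))"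
  using assms unfolding DD_def by (rule CollectD)

lemma DD_I:
  assumes "wf_fm LM \<chi>" "\<And>e. range e \<subseteq> Y \<Longrightarrow> P e \<longleftrightarrow> sat N (val e) \<chi>"
  shows "P \<in> DD"
  unfolding DD_def using assms by (intro CollectI exI[of _ \<chi>] conjI allI impI)

lemma DD_exists:
  assumes P: "P \<in> DD"
  shows "(\<lambda>e. \<exists>b\<in>Y. P (e(i := b))) \<in> DD"
proof -
  obtain \<chi> where \<chi>: "wf_fm LM \<chi>" "\<And>e. range e \<subseteq> Y \<Longrightarrow> P e \<longleftrightarrow> sat N (val e) \<chi>"
    using DD_E[OF P] by (elim exE conjE) blast
  have "(\<exists>b\<in>Y. P (e(i := b))) \<longleftrightarrow> sat N (val e) (Exs (copies i) \<chi>)" if e: "range e \<subseteq> Y" for e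
  proof -
    have "P (e(i := b)) \<longleftrightarrow> sat N (override (val e) (copies i) b) \<chi>" if b: "b \<in> Y" for b
    proof -
      have "range (e(i := b)) \<subseteq> Y" using e b by auto
      then show ?thesis using \<chi>(2) override_val[OF b] by simp
    qed
    then show ?thesis by (simp add: sat_Exs[OF distinct_copies] Y_copies)
  qed
  moreover have "wf_fm LM (Exs (copies i) \<chi>)" using \<chi>(1) by (simp add: wf_Exs)
  ultimately show ?thesis by (rule DD_I[rotated])
qed

lemma DD_substitute:
  fixes \<sigma> :: "nat \<Rightarrow> nat + 'a list"
  assumes P: "P \<in> DD" and \<sigma>: "\<And>m. \<sigma> m \<in> range Inl \<union> Inr ` Y"
  shows "(\<lambda>e. P (\<lambda>m. case_sum e id (\<sigma> m))) \<in> DD"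
proof -
  obtain \<chi> where \<chi>: "wf_fm LM \<chi>" "\<And>e. range e \<subseteq> Y \<Longrightarrow> P e \<longleftrightarrow> sat N (val e) \<chi>"
    using DD_E[OF P] by (elim exE conjE) blast
  define \<theta> :: "'s var \<Rightarrow> ('s, 'f + 's \<times> 'a) trm" where
    "\<theta> v = (if is_copy v then
       (case \<sigma> (fst (cidx v)) of Inl j \<Rightarrow> Var (copy j (snd (cidx v)))
        | Inr b \<Rightarrow> Fun (Inr (fst v, b ! snd (cidx v))) []) else Var v)" for v
  show ?thesis
  proof (rule DD_substI[OF \<chi>(1)])
    show "has_sort LM (\<theta> v) (fst v)" for v
    proof (cases "is_copy v")
      case True
      then obtain i k where v: "k < length y" "v = copy i k" using is_copyE by blast
      show ?thesis
      proof (cases "\<sigma> i")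
        case (Inl j)
        then show ?thesis using v has_sort.var[of LM "copy j k"] by (simp add: \<theta>_def)
      next
        case (Inr b)
        then have "b \<in> Y" using \<sigma>[of i] by auto
        then show ?thesis using v Inr by (simp add: \<theta>_def has_sort_param Y_iff)
      qed
    qed (simp add: \<theta>_def has_sort.var)
    fix e :: "nat \<Rightarrow> 'a list" assume e: "range e \<subseteq> Y"
    have "case_sum e id (\<sigma> m) \<in> Y" for m using \<sigma>[of m] e by auto
    then have "range (\<lambda>m. case_sum e id (\<sigma> m)) \<subseteq> Y" by blast
    moreover have "eval N (val e) (\<theta> v) = val (\<lambda>m. case_sum e id (\<sigma> m)) v" for v
    proof (cases "is_copy v")
      case True
      then obtain i k where v: "k < length y" "v = copy i k" using is_copyE by blast
      then show ?thesis by (simp add: \<theta>_def split: sum.split)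
    qed (simp add: \<theta>_def val_def)
    ultimately show "P (\<lambda>m. case_sum e id (\<sigma> m)) \<longleftrightarrow> sat N (\<lambda>v. eval N (val e) (\<theta> v)) \<chi>"
      using \<chi>(2) by simp
  qed
qed

lemma DD_finite:
  assumes P: "P \<in> DD"
  shows "\<exists>n. \<forall>e e'. range e \<subseteq> Y \<longrightarrow> range e' \<subseteq> Y \<longrightarrow> (\<forall>i<n. e i = e' i) \<longrightarrow> P e \<longrightarrow> P e'"
proof -
  obtain \<chi> where \<chi>: "wf_fm LM \<chi>" "\<And>e. range e \<subseteq> Y \<Longrightarrow> P e \<longleftrightarrow> sat N (val e) \<chi>"
    using DD_E[OF P] by (elim exE conjE) blast
  have "finite ((\<lambda>v. fst (cidx v)) ` fv \<chi>)" using finite_fv by blast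
  then obtain n where n: "\<And>v. v \<in> fv \<chi> \<Longrightarrow> fst (cidx v) < n" unfolding finite_nat_set_iff_bounded by blast
  have "P e'" if e: "range e \<subseteq> Y" "range e' \<subseteq> Y" "\<forall>i<n. e i = e' i" "P e" for e e'
  proof -
    have "sat N (val e) \<chi> \<longleftrightarrow> sat N (val e') \<chi>"
      by (rule sat_cong) (use n e(3) in \<open>simp add: val_def\<close>)
    then show ?thesis using \<chi>(2) e by simp
  qed
  then show ?thesis by (intro exI[of _ n] allI impI)
qed

lemma DD_neg:
  assumes "P \<in> DD" shows "(\<lambda>e. \<not> P e) \<in> DD"
proof -
  from DD_E[OF assms] obtain \<chi> where \<chi>: "wf_fm LM \<chi>" "\<forall>e. range e \<subseteq> Y \<longrightarrow> (P e \<longleftrightarrow> sat N (val e) \<chi>)"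
    by (elim exE conjE)
  show ?thesis by (rule DD_I[of "Neg \<chi>"]) (use \<chi> in simp_all)
qed

lemma DD_and:
  assumes "P \<in> DD" "Q \<in> DD" shows "(\<lambda>e. P e \<and> Q e) \<in> DD"
proof -
  from DD_E[OF assms(1)] obtain \<chi> where \<chi>: "wf_fm LM \<chi>" "\<forall>e. range e \<subseteq> Y \<longrightarrow> (P e \<longleftrightarrow> sat N (val e) \<chi>)"
    by (elim exE conjE)
  from DD_E[OF assms(2)] obtain \<zeta> where \<zeta>: "wf_fm LM \<zeta>" "\<forall>e. range e \<subseteq> Y \<longrightarrow> (Q e \<longleftrightarrow> sat N (val e) \<zeta>)"
    by (elim exE conjE)
  show ?thesis by (rule DD_I[of "Conj \<chi> \<zeta>"]) (use \<chi> \<zeta> in simp_all)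
qed

lemma DD_equiv:
  assumes "P \<in> DD" "\<And>e. range e \<subseteq> Y \<Longrightarrow> Q e \<longleftrightarrow> P e" shows "Q \<in> DD"
proof -
  from DD_E[OF assms(1)] obtain \<chi> where \<chi>: "wf_fm LM \<chi>" "\<forall>e. range e \<subseteq> Y \<longrightarrow> (P e \<longleftrightarrow> sat N (val e) \<chi>)"
    by (elim exE conjE)
  show ?thesis by (rule DD_I[OF \<chi>(1)]) (use \<chi>(2) assms(2) in simp)
qed

lemma DD_nonempty: "DD \<noteq> {}"
proof -
  have "(\<lambda>e. True) \<in> DD" by (rule DD_I[OF true_wf]) simp
  then show ?thesis by blast
qed

sublocale definable Y DD
  by unfold_locales (rule DD_nonempty DD_equiv DD_neg DD_and DD_exists DD_substitute DD_finite; assumption)+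

lemma dset_defset:
  assumes "formula_in LM y \<psi>"
  shows "dset (defset N \<psi> y)"
proof -
  have "\<exists>\<chi>. wf_fm LM \<chi> \<and> (\<forall>e. sat N e \<chi> \<longleftrightarrow> holds N \<psi> y (map (eval N e) (map Var (copies 0))))"
  proof (rule subst_tuple[OF distinct_y _ _ assms])
    show "has_sort LM (map Var (copies 0) ! k) (fst (y ! k))" if "k < length y" for k
      using has_sort.var[of LM "copy 0 k"] that by simp
  qed simp
  then obtain \<chi> where \<chi>: "wf_fm LM \<chi>" "\<And>e. sat N e \<chi> \<longleftrightarrow> holds N \<psi> y (map (eval N e) (map Var (copies 0)))"
    by blast
  have "e 0 \<in> defset N \<psi> y \<longleftrightarrow> sat N (val e) \<chi>" if e: "range e \<subseteq> Y" for e
  proof -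
    have e0: "e 0 \<in> Y" using e by blast
    have "map (eval N (val e)) (map Var (copies 0)) = e 0"
      by (rule nth_equalityI) (use e0 in \<open>auto simp: Y_iff\<close>)
    then show ?thesis unfolding \<chi>(2) using e0 by (simp add: defset_def)
  qed
  then have "(\<lambda>e. e 0 \<in> defset N \<psi> y) \<in> DD" unfolding DD_def using \<chi>(1) by blast
  then show ?thesis by (auto simp: dset_def defset_def)
qed

text \<open>Copies with index 0 are renamed to the variables \<open>y\<close>, and all other
  variables become constants naming their values under a fixed valuation, which leaves a formula in
  \<open>y\<close> alone.\<close>

lemma dset_formula:
  assumes "dset \<theta>"
  shows "\<exists>\<chi>. formula_in LM y \<chi> \<and> (\<forall>b\<in>Y. holds N \<chi> y b \<longleftrightarrow> b \<in> \<theta>)"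
proof -
  obtain \<chi> where \<chi>: "wf_fm LM \<chi>" "\<And>e. range e \<subseteq> Y \<Longrightarrow> e 0 \<in> \<theta> \<longleftrightarrow> sat N (val e) \<chi>"
  proof -
    have "(\<lambda>e. e 0 \<in> \<theta>) \<in> DD" using assms by (simp add: dset_def)
    then show thesis using that unfolding DD_def by blast
  qed
  obtain b0 where b0: "b0 \<in> Y" using Y_ne by blast
  define \<tau> :: "'s var \<Rightarrow> ('s, 'f + 's \<times> 'a) trm" where
    "\<tau> v = (if is_copy v \<and> fst (cidx v) = 0 then Var (y ! snd (cidx v))
      else Fun (Inr (fst v, val (\<lambda>_. b0) v)) [])" for v
  have c0: "is_copy v \<and> fst (cidx v) = 0 \<Longrightarrow> \<exists>k. k < length y \<and> v = copy 0 k" for v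
    using is_copyE[of v] by auto
  have s: "has_sort LM (\<tau> v) (fst v)" for v
  proof (cases "is_copy v \<and> fst (cidx v) = 0")
    case True
    then obtain k where "k < length y" "v = copy 0 k" using c0 by blast
    then show ?thesis using has_sort.var[of LM "y ! k"] by (simp add: \<tau>_def)
  next
    case False
    have "val (\<lambda>_. b0) v \<in> univ M (fst v)" by (rule val_sorted) (use b0 in auto)
    then have "has_sort LM (Fun (Inr (fst v, val (\<lambda>_. b0) v)) []) (fst v)" by (rule has_sort_param)
    moreover have "\<tau> v = Fun (Inr (fst v, val (\<lambda>_. b0) v)) []" unfolding \<tau>_def using False by (rule if_not_P)
    ultimately show ?thesis by (simp only:)
  qed
  have "\<exists>\<chi>'. wf_fm LM \<chi>' \<and> fv \<chi>' \<subseteq> (\<Union>v\<in>fv \<chi>. fv_trm (\<tau> v)) \<and>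
    (\<forall>e. sat N e \<chi>' \<longleftrightarrow> sat N (\<lambda>v. eval N e (\<tau> v)) \<chi>)" by (rule subst_exists[OF \<chi>(1) s])
  then obtain \<chi>' where \<chi>': "wf_fm LM \<chi>'" "fv \<chi>' \<subseteq> (\<Union>v\<in>fv \<chi>. fv_trm (\<tau> v))"
    "\<And>e. sat N e \<chi>' \<longleftrightarrow> sat N (\<lambda>v. eval N e (\<tau> v)) \<chi>" by blast
  have "fv_trm (\<tau> v) \<subseteq> set y" for v by (auto simp: \<tau>_def is_copy_def)
  then have "formula_in LM y \<chi>'" using \<chi>'(1,2) unfolding formula_in_def by blast
  moreover have "holds N \<chi>' y b \<longleftrightarrow> b \<in> \<theta>" if b: "b \<in> Y" for b
  proof -
    have "eval N (assign y b) (\<tau> v) = val ((\<lambda>_. b0)(0 := b)) v" for v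
    proof (cases "is_copy v \<and> fst (cidx v) = 0")
      case True
      then obtain k where "k < length y" "v = copy 0 k" using c0 by blast
      then show ?thesis using b by (simp add: \<tau>_def assign_override override_nth[OF distinct_y] Y_iff)
    next
      case False
      then have "v \<notin> set (copies 0)" by auto
      then have "val ((\<lambda>_. b0)(0 := b)) v = val (\<lambda>_. b0) v" by (rule val_upd_notin)
      moreover have "\<tau> v = Fun (Inr (fst v, val (\<lambda>_. b0) v)) []" unfolding \<tau>_def using False by (rule if_not_P)
      ultimately show ?thesis by simp
    qed
    then have "holds N \<chi>' y b \<longleftrightarrow> sat N (val ((\<lambda>_. b0)(0 := b))) \<chi>" by (simp only: holds_def \<chi>'(3))
    moreover have "range ((\<lambda>_. b0)(0 := b)) \<subseteq> Y" using b b0 by auto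
    from \<chi>(2)[OF this] have "b \<in> \<theta> \<longleftrightarrow> sat N (val ((\<lambda>_. b0)(0 := b))) \<chi>" by simp
    ultimately show ?thesis by (simp only:)
  qed
  ultimately show ?thesis by (intro exI[of _ \<chi>'] conjI ballI)
qed

lemma tame_formula:
  assumes d: "distinct (x @ y)" and \<phi>: "formula_in LM (x @ y) \<phi>"
  shows "tame (\<lambda>a b. holds N \<phi> (x @ y) (a @ b)) (var_space M x)"
  unfolding tame_def
proof (intro allI)
  fix m S
  \<comment> \<open>The second component is at least \<open>length y\<close>, so these variables
    have the sorts of \<open>x\<close> without being copies, and quantifying them does not disturb
    the tuples coded by \<open>val\<close>.\<close>
  define xx where "xx = map (\<lambda>k. (fst (x ! k), prod_encode (0, length y + k))) [0..<length x]"
  have lx: "length xx = length x" by (simp add: xx_def)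
  have dx: "distinct xx" by (auto simp: xx_def distinct_map inj_on_def)
  have nc: "v \<notin> set xx" if "is_copy v" for v
    using that by (auto simp: xx_def is_copy_def cidx_def)
  have vx: "var_space M xx = var_space M x" by (auto simp: var_space_iff xx_def)
  have "\<forall>i. \<exists>\<chi>. wf_fm LM \<chi> \<and> (\<forall>e. sat N e \<chi> \<longleftrightarrow> holds N \<phi> (x @ y) (map (eval N e) (map Var (xx @ copies i))))"
  proof (intro allI, rule subst_tuple[OF d _ _ \<phi>])
    show "length (map Var (xx @ copies i)) = length (x @ y)" for i by (simp add: lx)
    fix i k assume k: "k < length (x @ y)"
    have "fst ((xx @ copies i) ! k) = fst ((x @ y) ! k)"
      using k by (auto simp: nth_append lx xx_def)
    then show "has_sort LM (map Var (xx @ copies i) ! k) (fst ((x @ y) ! k))"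
      using k has_sort.var[of LM "(xx @ copies i) ! k"] by (simp add: lx del: map_append)
  qed
  from choice[OF this] obtain \<chi> where \<chi>: "\<And>i. wf_fm LM (\<chi> i)"
    "\<And>i e. sat N e (\<chi> i) \<longleftrightarrow> holds N \<phi> (x @ y) (map (eval N e) (map Var (xx @ copies i)))"
    by (elim exE) blast
  have "\<exists>\<zeta>. wf_fm LM \<zeta> \<and> (\<forall>e. sat N e \<zeta> \<longleftrightarrow> (\<forall>i<m. sat N e (\<chi> i) \<longleftrightarrow> i \<in> S))"
  proof (induct m)
    case 0
    show ?case by (intro exI[of _ "Eq (Var undefined) (Var undefined)"] conjI true_wf) simp
  next
    case (Suc m)
    then obtain \<zeta> where "wf_fm LM \<zeta>" "\<forall>e. sat N e \<zeta> \<longleftrightarrow> (\<forall>i<m. sat N e (\<chi> i) \<longleftrightarrow> i \<in> S)" by blast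
    then show ?case using \<chi>(1)
      by (intro exI[of _ "Conj \<zeta> (if m \<in> S then \<chi> m else Neg (\<chi> m))"]) (auto simp: less_Suc_eq)
  qed
  then obtain \<zeta> where \<zeta>: "wf_fm LM \<zeta>" "\<And>e. sat N e \<zeta> \<longleftrightarrow> (\<forall>i<m. sat N e (\<chi> i) \<longleftrightarrow> i \<in> S)" by blast
  have "(\<exists>a\<in>var_space M x. \<forall>i<m. holds N \<phi> (x @ y) (a @ e i) \<longleftrightarrow> i \<in> S) \<longleftrightarrow> sat N (val e) (Exs xx \<zeta>)"
    if e: "range e \<subseteq> Y" for e
  proof -
    have "sat N (override (val e) xx a) (\<chi> i) \<longleftrightarrow> holds N \<phi> (x @ y) (a @ e i)"
      if a: "a \<in> var_space M x" for a i
    proof -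
      have la: "length a = length xx" using a by (simp add: var_space_iff lx)
      have "map (override (val e) xx a) xx = a"
        by (rule nth_equalityI) (use la in \<open>auto simp: override_nth[OF dx]\<close>)
      moreover have "map (override (val e) xx a) (copies i) = e i"
      proof (rule nth_equalityI)
        have "e i \<in> Y" using e by blast
        then show "length (map (override (val e) xx a) (copies i)) = length (e i)" by (simp add: Y_iff)
        fix k assume "k < length (map (override (val e) xx a) (copies i))"
        then have k: "k < length y" by simp
        then show "map (override (val e) xx a) (copies i) ! k = e i ! k"
          using nc[of "copy i k"] by (simp add: override_notin)
      qed
      ultimately have "map (eval N (override (val e) xx a)) (map Var (xx @ copies i)) = a @ e i"
        by (simp add: comp_def)
      then show ?thesis unfolding \<chi>(2) by (simp only:)
    qed
    then show ?thesis by (simp add: sat_Exs[OF dx] vx \<zeta>(2))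
  qed
  moreover have "wf_fm LM (Exs xx \<zeta>)" using \<zeta>(1) by (simp add: wf_Exs)
  ultimately show "(\<lambda>e. \<exists>a\<in>var_space M x. \<forall>i<m. holds N \<phi> (x @ y) (a @ e i) \<longleftrightarrow> i \<in> S) \<in> DD"
    unfolding DD_def by blast
qed

text \<open>NIP is a hypothesis on formulas of \<open>L\<close>, without parameters. The constants
  of \<chi> are therefore turned into fresh variables, which together with the remaining free
  variables form the tuple \<open>zs\<close>; every member of the family is then a fibre of one
  \<open>L\<close>-formula over a tuple for \<open>zs\<close>.\<close>

lemma nip_DD:
  assumes nip: "nip_theory_of L M" and P: "P \<in> DD"
  shows "\<exists>k. vcb (\<lambda>e b. P (e(0 := b))) U Y k"
proof -
  obtain \<chi> where \<chi>: "wf_fm LM \<chi>" "\<And>e. range e \<subseteq> Y \<Longrightarrow> P e \<longleftrightarrow> sat N (val e) \<chi>"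
    using P by (auto simp: DD_def)
  define C where "C = params \<chi>"
  have "\<exists>\<kappa>. inj_on \<kappa> C \<and> (\<forall>c. fst (\<kappa> c) = fst c) \<and> (\<forall>c. \<kappa> c \<notin> fv \<chi> \<union> bv \<chi> \<union> set (copies 0))"
    by (rule fresh_param_vars) (simp_all add: C_def finite_params finite_fv finite_bv)
  then obtain \<kappa> where \<kappa>: "inj_on \<kappa> C" "\<And>c. fst (\<kappa> c) = fst c"
    "\<And>c. \<kappa> c \<notin> fv \<chi>" "\<And>c. \<kappa> c \<notin> bv \<chi>" "\<And>c. \<kappa> c \<notin> set (copies 0)" by blast
  define \<zeta> where "\<zeta> = unparam \<kappa> \<chi>"
  have wf: "wf_fm L \<zeta>" unfolding \<zeta>_def by (rule wf_unparam[OF \<chi>(1) \<kappa>(2)])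
  obtain zs where zs: "set zs = fv \<zeta> - set (copies 0)" "distinct zs"
    using finite_distinct_list[of "fv \<zeta> - set (copies 0)"] finite_fv by blast
  have dz: "distinct (copies 0 @ zs)" using zs distinct_copies by auto
  have fz: "formula_in L (copies 0 @ zs) \<zeta>" using wf zs(1) by (auto simp: formula_in_def)
  have "nip_formula M \<zeta> (copies 0) zs" using nip dz fz unfolding nip_theory_of_def by blast
  then have "vc_dim Y ((\<lambda>c. {b\<in>Y. holds M \<zeta> (copies 0 @ zs) (b @ c)}) ` var_space M zs) < \<infinity>"
    by (simp add: nip_formula_def fibre_def Y_copies)
  from vc_dim_less[OF this] obtain n where
    n: "vcb (\<lambda>c b. holds M \<zeta> (copies 0 @ zs) (b @ c)) (var_space M zs) Y (n + 1)" by blast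
  have "vcb (\<lambda>e b. P (e(0 := b))) U Y (n + 1)"
  proof (rule vcb_transfer[OF n])
    fix e assume e: "e \<in> U"
    then have eY: "range e \<subseteq> Y" by (simp add: U_def)
    \<comment> \<open>This valuation restores the constants of \<chi>: the fresh variables receive
      the elements they replaced.\<close>
    define f where "f g v = (if v \<in> \<kappa> ` C then snd (inv_into C \<kappa> v) else val g v)" for g v
    define c where "c = map (f e) zs"
    have "f e v \<in> univ M (fst v)" for v
    proof (cases "v \<in> \<kappa> ` C")
      case True
      then obtain d where d: "d \<in> C" "v = \<kappa> d" by blast
      then have "snd d \<in> univ M (fst d)" using params_sorted[OF \<chi>(1)] by (auto simp: C_def)
      then show ?thesis using d \<kappa>(1,2) by (simp add: f_def)
    next
      case False
      then show ?thesis using val_sorted[OF eY] by (simp add: f_def)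
    qed
    then have cz: "c \<in> var_space M zs" by (simp add: var_space_iff c_def)
    have "P (e(0 := b)) \<longleftrightarrow> holds M \<zeta> (copies 0 @ zs) (b @ c)" if b: "b \<in> Y" for b
    proof -
      let ?g = "e(0 := b)"
      have "range ?g \<subseteq> Y" using eY b by auto
      then have "P ?g \<longleftrightarrow> sat N (val ?g) \<chi>" by (rule \<chi>(2))
      also have "\<dots> \<longleftrightarrow> sat N (f ?g) \<chi>"
        by (rule sat_cong) (use \<kappa>(3) in \<open>auto simp: f_def\<close>)
      also have "\<dots> \<longleftrightarrow> sat M (f ?g) \<zeta>"
        unfolding \<zeta>_def
      proof (rule sat_unparam[symmetric])
        show "f ?g (\<kappa> d) = snd d" if "d \<in> params \<chi>" for d using that \<kappa>(1) by (simp add: f_def C_def)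
        show "bv \<chi> \<inter> \<kappa> ` params \<chi> = {}" using \<kappa>(4) by blast
      qed
      also have "\<dots> \<longleftrightarrow> holds M \<zeta> (copies 0 @ zs) (b @ c)"
        unfolding holds_def
      proof (rule sat_cong)
        fix v assume "v \<in> fv \<zeta>"
        then have "v \<in> set (copies 0 @ zs)" using zs(1) by auto
        then obtain k where k: "k < length (copies 0 @ zs)" "v = (copies 0 @ zs) ! k"
          unfolding in_set_conv_nth by blast
        have lb: "length b = length y" using b by (simp add: Y_iff)
        have "assign (copies 0 @ zs) (b @ c) v = (b @ c) ! k"
          unfolding assign_override k(2)
          by (rule override_nth[OF dz _ k(1)]) (simp add: lb c_def)
        also have "\<dots> = f ?g v"
        proof (cases "k < length y")
          case True
          then have v: "v = copy 0 k" using k(2) by (simp add: nth_append)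
          then have "v \<in> set (copies 0)" using True by simp
          then have "v \<notin> \<kappa> ` C" using \<kappa>(5) by blast
          then show ?thesis using True v lb by (simp add: f_def nth_append)
        next
          case False
          then have v: "v = zs ! (k - length y)" and k': "k - length y < length zs"
            using k by (simp_all add: nth_append)
          then have "v \<in> set zs" by simp
          then have "v \<notin> set (copies 0)" using zs(1) by blast
          then have "val ?g v = val e v" by (rule val_upd_notin)
          then have "f ?g v = f e v" by (simp add: f_def)
          then show ?thesis using False v k' lb by (simp add: c_def nth_append)
        qed
        finally show "f ?g v = assign (copies 0 @ zs) (b @ c) v" by simp
      qed
      finally show ?thesis .
    qed
    then show "\<exists>d\<in>var_space M zs. \<forall>b\<in>Y. P (e(0 := b)) \<longleftrightarrow> holds M \<zeta> (copies 0 @ zs) (b @ d)"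
      using cz by blast
  qed
  then show ?thesis by blast
qed

end

section \<open>Return to formulas over the structure\<close>

lemma holds_instance_at:
  fixes \<phi> :: "('s, 'f + 's \<times> 'a, 'r) fm" and x y :: "'s var list" and M :: "('s, 'f, 'r, 'a) struct"
  assumes d: "distinct (x @ y)" and \<phi>: "fv \<phi> \<subseteq> set (x @ y)"
    and a: "a \<in> var_space M x" and b: "b \<in> var_space M y"
  shows "holds (expansion M) (instance_at \<phi> y b) x a \<longleftrightarrow> holds (expansion M) \<phi> (x @ y) (a @ b)"
proof -
  define \<theta> :: "'s var \<Rightarrow> ('s, 'f + 's \<times> 'a) trm" where
    "\<theta> v = (case map_of (zip y b) v of Some c \<Rightarrow> Fun (Inr (fst v, c)) [] | None \<Rightarrow> Var v)" for v
  have la: "length a = length x" and lb: "length b = length y" using a b by (simp_all add: var_space_iff)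
  have dx: "distinct x" and dy: "distinct y" using d by simp_all
  have "holds (expansion M) (instance_at \<phi> y b) x a \<longleftrightarrow> sat (expansion M) (\<lambda>v. eval (expansion M) (assign x a) (\<theta> v)) \<phi>"
    unfolding holds_def instance_at_def \<theta>_def[symmetric]
    by (rule sat_subst_closed) (simp add: \<theta>_def split: option.split)
  also have "\<dots> \<longleftrightarrow> sat (expansion M) (assign (x @ y) (a @ b)) \<phi>"
  proof (rule sat_cong)
    fix v assume "v \<in> fv \<phi>"
    then have "v \<in> set (x @ y)" using \<phi> by blast
    then obtain k where k: "k < length (x @ y)" "v = (x @ y) ! k" unfolding in_set_conv_nth by blast
    have "assign (x @ y) (a @ b) v = (a @ b) ! k"
      unfolding assign_override k(2) by (rule override_nth[OF d _ k(1)]) (simp add: la lb)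
    also have "\<dots> = eval (expansion M) (assign x a) (\<theta> v)"
    proof (cases "k < length x")
      case True
      then have v: "v = x ! k" using k(2) by (simp add: nth_append)
      have "x ! k \<in> set x" using True by simp
      then have "v \<notin> set y" using d v by auto
      then have "map_of (zip y b) v = None" using lb by (simp add: map_of_zip_is_None)
      then have "\<theta> v = Var v" by (simp add: \<theta>_def)
      then show ?thesis using True v la by (simp add: assign_override override_nth[OF dx] nth_append)
    next
      case False
      then have v: "v = y ! (k - length x)" and k': "k - length x < length y"
        using k by (simp_all add: nth_append)
      then have "map_of (zip y b) v = Some (b ! (k - length x))" using lb dy by (simp add: map_of_zip_nth)
      then show ?thesis using False la by (simp add: \<theta>_def nth_append)
    qed
    finally show "eval (expansion M) (assign x a) (\<theta> v) = assign (x @ y) (a @ b) v" by simp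
  qed
  finally show ?thesis by (simp add: holds_def)
qed

lemma pq_property_pq:
  assumes pq: "pq_property N \<phi> \<psi> x y p q" and q: "0 < q"
  shows "pq (\<lambda>a b. holds N \<phi> (x @ y) (a @ b)) (var_space N x) (defset N \<psi> y) p q"
  unfolding pq_def
proof (intro allI impI)
  let ?f = "fibre N \<phi> x y"
  fix b assume b: "\<forall>i<p. b i \<in> defset N \<psi> y"
    and ne: "\<forall>i<p. \<forall>j<p. i \<noteq> j \<longrightarrow> {a \<in> var_space N x. holds N \<phi> (x @ y) (a @ b i)} \<noteq>
      {a \<in> var_space N x. holds N \<phi> (x @ y) (a @ b j)}"
  define h where "h i = ?f (b i)" for i
  have inj: "inj_on h {..<p}" using ne unfolding inj_on_def h_def fibre_def lessThan_iff by blast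
  have G: "h ` {..<p} \<subseteq> ?f ` defset N \<psi> y" "finite (h ` {..<p})" "card (h ` {..<p}) = p"
    using b by (auto simp: h_def) (use card_image[OF inj] in \<open>simp add: h_def\<close>)
  obtain H where H: "H \<subseteq> h ` {..<p}" "card H = q" "\<Inter>H \<noteq> {}"
    using pq G unfolding pq_property_def Let_def by blast
  obtain K where K: "K \<subseteq> {..<p}" "H = h ` K" using H(1) by (metis subset_imageE)
  have "card K = q" using H(2) K inj card_image inj_on_subset by metis
  moreover obtain a where a: "a \<in> \<Inter>H" using H(3) by blast
  have hK: "a \<in> h i" if "i \<in> K" for i using a that K(2) by blast
  \<comment> \<open>An empty intersection would be the whole type; as \<open>q\<close> is positive,
    the common element lies in some fibre and so has the sorts of \<open>x\<close>.\<close>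
  obtain i where "i \<in> K" using \<open>card K = q\<close> q by (metis card.empty equals0I less_irrefl)
  then have "a \<in> var_space N x" using hK by (auto simp: h_def fibre_def)
  moreover have "\<forall>i\<in>K. holds N \<phi> (x @ y) (a @ b i)" using hK by (auto simp: h_def fibre_def)
  ultimately show "\<exists>K\<subseteq>{..<p}. card K = q \<and> (\<exists>a\<in>var_space N x. \<forall>i\<in>K. holds N \<phi> (x @ y) (a @ b i))"
    using K(1) by blast
qed

theorem theorem1p5:
  fixes L :: "('s, 'f, 'r) lang"
    and T :: "('s, 'f, 'r) fm set"
    and M :: "('s, 'f, 'r, 'a) struct"
    and \<phi> \<psi> :: "('s, 'f + 's \<times> 'a, 'r) fm"
    and x y :: "'s var list"
    and p q :: nat
  assumes "complete_theory L T"
    and "models L M T"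
    and "nip_theory_of L M"
    and "distinct (x @ y)"
    and "formula_in (lang_over L M) (x @ y) \<phi>"
    and "formula_in (lang_over L M) y \<psi>"
    and "dual_vc (expansion M) \<phi> x y < enat q"
    and "q \<le> p"
    and "pq_property (expansion M) \<phi> \<psi> x y p q"
  shows "\<exists>(n :: nat) (\<psi>' :: nat \<Rightarrow> ('s, 'f + 's \<times> 'a, 'r) fm).
    (\<forall>i < n. formula_in (lang_over L M) y (\<psi>' i)) \<and>
    (\<forall>b \<in> var_space M y.
       holds (expansion M) \<psi> y b \<longleftrightarrow> (\<exists>i < n. holds (expansion M) (\<psi>' i) y b)) \<and>
    (\<forall>i < n. consistent M x {instance_at \<phi> y b | b. b \<in> defset (expansion M) (\<psi>' i) y})"
proof -
  interpret fo_structure L M y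
    by unfold_locales (use assms(2,4) in \<open>simp_all add: models_def is_structure_def\<close>)
  let ?R = "\<lambda>a b. holds N \<phi> (x @ y) (a @ b)" and ?X = "var_space M x" and ?D = "defset N \<psi> y"
  obtain n where n: "enat n < enat q" "vcb ?R ?X Y (n + 1)"
    using vc_dim_less[OF assms(7)[unfolded dual_vc_def]] by auto
  \<comment> \<open>The strict inequality between the dual VC-dimension and \<open>q\<close> is
    exactly what makes \<open>q\<close> a bound in the sense of \<open>vcb\<close>; it also makes
    \<open>q\<close> positive.\<close>
  have vc: "vcb ?R ?X Y q" by (rule vcb_mono[OF n(2)]) (use n(1) in simp_all)
  have pq: "pq ?R ?X ?D p q" using pq_property_pq[OF assms(9)] n(1) by simp
  have ne: "\<exists>a\<in>?X. ?R a b" if "b \<in> ?D" for b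
  proof -
    have "fibre N \<phi> x y b \<noteq> {}" using assms(9) that unfolding pq_property_def Let_def by (metis imageI)
    then show ?thesis by (auto simp: fibre_def)
  qed
  obtain \<Theta> where \<Theta>: "finite \<Theta>" "\<And>\<theta>. \<theta> \<in> \<Theta> \<Longrightarrow> dset \<theta> \<and> good ?R ?X \<theta>" "?D \<subseteq> \<Union>\<Theta>"
    using good_cover[OF nip_DD[OF assms(3)] tame_formula[OF assms(4,5)] vc dset_defset[OF assms(6)] ne pq]
    by blast
  have "\<forall>\<theta>\<in>\<Theta>. \<exists>\<chi>. formula_in LM y \<chi> \<and> (\<forall>b\<in>Y. holds N \<chi> y b \<longleftrightarrow> b \<in> \<theta>)"
    using dset_formula \<Theta>(2) by blast
  from bchoice[OF this] obtain \<chi> where \<chi>: "\<And>\<theta>. \<theta> \<in> \<Theta> \<Longrightarrow> formula_in LM y (\<chi> \<theta>)"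
    "\<And>\<theta> b. \<theta> \<in> \<Theta> \<Longrightarrow> b \<in> Y \<Longrightarrow> holds N (\<chi> \<theta>) y b \<longleftrightarrow> b \<in> \<theta>" by blast
  obtain ts where ts: "set ts = \<Theta>" using finite_list[OF \<Theta>(1)] by blast
  \<comment> \<open>Conjunction with \<psi> makes the disjunction equivalent to \<psi>, as the good
    sets may extend beyond \<psi>.\<close>
  define \<psi>' where "\<psi>' i = Conj \<psi> (\<chi> (ts ! i))" for i
  have ti: "ts ! i \<in> \<Theta>" if "i < length ts" for i using that ts nth_mem by blast
  have \<psi>': "holds N (\<psi>' i) y b \<longleftrightarrow> holds N \<psi> y b \<and> b \<in> ts ! i" if "i < length ts" "b \<in> Y" for i b
    using \<chi>(2)[OF ti[OF that(1)] that(2)] by (simp add: \<psi>'_def holds_def)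
  have "formula_in LM y (\<psi>' i)" if "i < length ts" for i
    using \<chi>(1)[OF ti[OF that]] assms(6) by (simp add: \<psi>'_def formula_in_def)
  moreover have "holds N \<psi> y b \<longleftrightarrow> (\<exists>i<length ts. holds N (\<psi>' i) y b)" if b: "b \<in> Y" for b
  proof
    assume h: "holds N \<psi> y b"
    then have "b \<in> \<Union>\<Theta>" using \<Theta>(3) b by (auto simp: defset_def)
    then obtain \<theta> where "\<theta> \<in> set ts" "b \<in> \<theta>" using ts by blast
    then obtain i where "i < length ts" "b \<in> ts ! i" by (auto simp: in_set_conv_nth)
    then show "\<exists>i<length ts. holds N (\<psi>' i) y b" using \<psi>' b h by blast
  next
    assume "\<exists>i<length ts. holds N (\<psi>' i) y b"
    then show "holds N \<psi> y b" using \<psi>' b by blast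
  qed
  moreover have "consistent M x {instance_at \<phi> y b | b. b \<in> defset N (\<psi>' i) y}" if i: "i < length ts" for i
    unfolding consistent_def
  proof (intro allI impI)
    fix \<Delta> assume \<Delta>: "\<Delta> \<subseteq> {instance_at \<phi> y b | b. b \<in> defset N (\<psi>' i) y}" "finite \<Delta>"
    have "\<Delta> \<subseteq> instance_at \<phi> y ` defset N (\<psi>' i) y" using \<Delta>(1) by blast
    from finite_subset_image[OF \<Delta>(2) this]
    obtain F where F: "F \<subseteq> defset N (\<psi>' i) y" "finite F" "\<Delta> = instance_at \<phi> y ` F" by blast
    have FY: "F \<subseteq> Y" using F(1) by (auto simp: defset_def)
    have "F \<subseteq> ts ! i" using F(1) \<psi>'[OF i] by (auto simp: defset_def)
    then obtain a where a: "a \<in> ?X" "\<forall>b\<in>F. ?R a b" using \<Theta>(2)[OF ti[OF i]] F(2) unfolding good_def by blast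
    have "holds N (instance_at \<phi> y b) x a" if b: "b \<in> F" for b
    proof -
      have "b \<in> Y" using b FY by blast
      then show ?thesis using holds_instance_at[OF assms(4) _ a(1)] assms(5) a(2) b unfolding formula_in_def by blast
    qed
    then show "\<exists>a\<in>?X. \<forall>\<gamma>\<in>\<Delta>. holds N \<gamma> x a" using a(1) F(3) by blast
  qed
  ultimately show ?thesis by (intro exI[of _ "length ts"] exI[of _ \<psi>']) simp
qed

end
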